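(* Let $\mathfrak{g}_k$ be $\mathfrak{sp}_{2k}$ (symplectic case) or $\mathfrak{o}_{2k+1}$ (orthogonal case), $k\ge1$, let $\lambda$ be the highest weight of a finite-dimensional irreducible $\mathfrak{g}_k$-module $V_\lambda$ and $\mu$ the highest weight of a finite-dimensional irreducible $\mathfrak{g}_{k-1}$-module occurring in the restriction of $V_\lambda$. For $z=(z_1,\dots,z_k)\in\mathbb{C}^k$ consider the following $\mathrm{Y}^{\mp}(2)$-module $M(z)$: in the symplectic case $M(z)=\bigotimes_{j=1}^kL(\alpha_j+z_j,\beta_j+z_j)$; in the orthogonal case $M(z)=U(z)\oplus U'(z)$, where $U(z)$, $U'(z)$ are obtained from the modules $U,U'$ below by replacing every factor $L(a_j,b_j)$ by $L(a_j+z_j,b_j+z_j)$ and keeping the one-dimensional factor $W(\delta)$. Identify the underlying space of $M(z)$ with a fixed space via $L(a+z_j,b+z_j)\cong V_{a-b}$ as $\mathfrak{sl}_2$-modules. Then there is a continuous path $z(t)$, $t\in[0,\infty)$, with $z(0)=0$ (so that $M(z(0))$ is the multiplicity space $\mathrm{Hom}_{\mathfrak{g}_{k-1}}(V_\mu,V_\lambda)$ with its natural $\mathrm{Y}^{\mp}(2)$-action), such that the image of $\mathcal{B}^{\mp}$ in $\mathrm{End}(M(z(t)))$ has simple spectrum for all $t>0$, and the corresponding eigenbasis (followed continuously in $t$) tends, as $t\to+\infty$, to the basis formed by tensor products of $h$-weight vectors of the $\mathfrak{sl}_2$-modules $V_{a_j-b_j}$ (in each summand $U,U'$ in the orthogonal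 case).
   Context: $\mathrm{Y}(2)$ is the Yangian with generators $t^{(r)}_{ij}$, $i,j\in\{-1,1\}$, $r\ge1$, relations $[t^{(r+1)}_{ij},t^{(s)}_{kl}]-[t^{(r)}_{ij},t^{(s+1)}_{kl}]=t^{(r)}_{kj}t^{(s)}_{il}-t^{(s)}_{kj}t^{(r)}_{il}$, $t^{(0)}_{ij}=\delta_{ij}$, series $t_{ij}(u)=\sum_r t^{(r)}_{ij}u^{-r}$ and coproduct $\Delta(t_{ij}(u))=\sum_{c\in\{\pm1\}}t_{ic}(u)\otimes t_{cj}(u)$. Put $s_{ij}(u)=\sum_{a\in\{\pm1\}}\theta_{aj}t_{ia}(u)t_{-j,-a}(-u)=\delta_{ij}+\sum_{M\ge1}s_{ij}^{(M)}u^{-M}$ with $\theta_{aj}=\mathrm{sgn}(a)\mathrm{sgn}(j)$ (symplectic case, algebra $\mathrm{Y}^-(2)$) or $\theta_{aj}=1$ (orthogonal case, algebra $\mathrm{Y}^+(2)$); $\mathrm{Y}^{\mp}(2)$ is generated by the $s^{(M)}_{ij}$, and $\Delta(\mathrm{Y}^{\mp}(2))\subset\mathrm{Y}(2)\otimes\mathrm{Y}^{\mp}(2)$. $\mathcal{B}^{\mp}\subset\mathrm{Y}^{\mp}(2)$ is the subalgebra generated by the center of $\mathrm{Y}^{\mp}(2)$ and the $s^{(2m+1)}_{11}$, $m\ge0$. For $a-b\in\mathbb{Z}_{\ge0}$, $L(a,b)$ is the irreducible $\mathfrak{gl}_2$-module of highest weight $(a,b)$, made a $\mathrm{Y}(2)$-module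 by $t_{ij}(u)\mapsto\delta_{ij}+E_{ij}u^{-1}$; tensor products are $\mathrm{Y}(2)$-modules via $\Delta$ and are restricted to $\mathrm{Y}^{\mp}(2)$; $\mathfrak{sl}_2\subset\mathfrak{gl}_2$ is spanned by $e=E_{1,-1}$, $f=E_{-1,1}$, $h=E_{11}-E_{-1,-1}$, and $V_m$ is its irreducible module of dimension $m+1$. For $\delta\in\mathbb{C}$, $W(\delta)=\mathbb{C}w$ is the $\mathrm{Y}^+(2)$-module with $s_{11}(u)w=\frac{u+\delta}{u+1/2}w$, $s_{-1,-1}(u)w=\frac{u-\delta+1}{u+1/2}w$, $s_{\pm1,\mp1}(u)w=0$. Weights: highest weights are written as $\lambda=(\lambda_1,\dots,\lambda_k)$ with $0\ge\lambda_1\ge\dots\ge\lambda_k$, integers in the symplectic case and all integers or all half-integers in the orthogonal case; $\mu=(\mu_1,\dots,\mu_{k-1})$ similarly, and put $\mu_k=-\infty$. Symplectic case: $\alpha_1=-1/2$, $\alpha_j=\min(\lambda_{j-1},\mu_{j-1})-j+1/2$ ($2\le j\le k$), $\beta_j=\max(\lambda_j,\mu_j)-j+1/2$. Orthogonal case: $\alpha_j=\min(\lambda_{j-1},\mu_{j-1})-j+1$ ($2\le j\le k$), $\beta_j=\max(\lambda_j,\mu_j)-j+1$; if the $\lambda_i$ are integers, $U=L(0,\beta_1)\otimes\bigotimes_{j\ge2}L(\alpha_j,\beta_j)\otimes W(1/2)$ and $U'=L(-1,\beta_1)\otimes\bigotimes_{j\ge2}L(\alpha_j,\beta_j)\otimes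 W(1/2)$ ($U'=0$ if $\beta_1=0$); if they are half-integers, $U=L(-1/2,\beta_1)\otimes\bigotimes_{j\ge2}L(\alpha_j,\beta_j)\otimes W(0)$ and $U'=L(-1/2,\beta_1)\otimes\bigotimes_{j\ge2}L(\alpha_j,\beta_j)\otimes W(1)$. (By Molev's theorem these modules at $z=0$ are the multiplicity spaces $\mathrm{Hom}_{\mathfrak{g}_{k-1}}(V_\mu,V_\lambda)$ with the action of $\mathrm{Y}^{\mp}(2)$ through the homomorphism $\varphi_k:\mathrm{Y}^{\mp}(2)\to U(\mathfrak{g}_k)^{\mathfrak{g}_{k-1}}$ of Molev–Olshanski.) *)

theory Defs
  imports Complex_Main
begin

section \<open>Free associative algebras (finitely supported functions on words)\<close>

type_synonym 'g fa = "'g list \<Rightarrow> complex"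

definition fa_fin :: "'g fa \<Rightarrow> bool" where
  "fa_fin p \<longleftrightarrow> finite {w. p w \<noteq> 0}"

definition fa_zero :: "'g fa" where "fa_zero = (\<lambda>w. 0)"
definition fa_one :: "'g fa" where "fa_one = (\<lambda>w. if w = [] then 1 else 0)"
definition fa_gen :: "'g \<Rightarrow> 'g fa" where "fa_gen g = (\<lambda>w. if w = [g] then 1 else 0)"
definition fa_add :: "'g fa \<Rightarrow> 'g fa \<Rightarrow> 'g fa" where "fa_add p q = (\<lambda>w. p w + q w)"
definition fa_sub :: "'g fa \<Rightarrow> 'g fa \<Rightarrow> 'g fa" where "fa_sub p q = (\<lambda>w. p w - q w)"
definition fa_smult :: "complex \<Rightarrow> 'g fa \<Rightarrow> 'g fa" where "fa_smult c p = (\<lambda>w. c * p w)"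
definition fa_mul :: "'g fa \<Rightarrow> 'g fa \<Rightarrow> 'g fa" where
  "fa_mul p q = (\<lambda>w. \<Sum>i\<le>length w. p (take i w) * q (drop i w))"
definition fa_prod :: "'g fa list \<Rightarrow> 'g fa" where
  "fa_prod xs = foldr fa_mul xs fa_one"
definition fa_comm :: "'g fa \<Rightarrow> 'g fa \<Rightarrow> 'g fa" where
  "fa_comm p q = fa_sub (fa_mul p q) (fa_mul q p)"

section \<open>The Yangian Y(2): free algebra on t^(r)_ij modulo the RTT relations\<close>

(* generator (r,i,j) stands for t^(r)_ij, r \<ge> 1, i,j \<in> {-1,1} *)
type_synonym ygen = "nat \<times> int \<times> int"

definition tser :: "nat \<Rightarrow> int \<Rightarrow> int \<Rightarrow> ygen fa" where
  "tser r i j = (if r = 0 then (if i = j then fa_one else fa_zero) else fa_gen (r, i, j))"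

definition yrel :: "nat \<Rightarrow> nat \<Rightarrow> int \<Rightarrow> int \<Rightarrow> int \<Rightarrow> int \<Rightarrow> ygen fa" where
  "yrel r s i j k l =
     fa_sub (fa_sub (fa_comm (tser (r+1) i j) (tser s k l)) (fa_comm (tser r i j) (tser (s+1) k l)))
            (fa_sub (fa_mul (tser r k j) (tser s i l)) (fa_mul (tser s k j) (tser r i l)))"

inductive_set yideal :: "ygen fa set" where
  rel: "\<lbrakk>i \<in> {-1,1}; j \<in> {-1,1}; k \<in> {-1,1}; l \<in> {-1,1}\<rbrakk> \<Longrightarrow> yrel r s i j k l \<in> yideal"
| add: "p \<in> yideal \<Longrightarrow> q \<in> yideal \<Longrightarrow> fa_add p q \<in> yideal"
| smult: "p \<in> yideal \<Longrightarrow> fa_smult c p \<in> yideal"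
| lmul: "p \<in> yideal \<Longrightarrow> fa_fin q \<Longrightarrow> fa_mul q p \<in> yideal"
| rmul: "p \<in> yideal \<Longrightarrow> fa_fin q \<Longrightarrow> fa_mul p q \<in> yideal"

(* spc = True: symplectic case Y^-(2); spc = False: orthogonal case Y^+(2) *)
definition theta :: "bool \<Rightarrow> int \<Rightarrow> int \<Rightarrow> complex" where
  "theta spc a j = (if spc then of_int (sgn a * sgn j) else 1)"

definition s_fa :: "bool \<Rightarrow> nat \<Rightarrow> int \<Rightarrow> int \<Rightarrow> ygen fa" where
  "s_fa spc M i j = (\<lambda>w. \<Sum>a\<in>{-1,1::int}. \<Sum>r\<le>M.
       theta spc a j * (-1) ^ (M - r) * fa_mul (tser r i a) (tser (M - r) (- j) (- a)) w)"

(* symbols (M,i,j) stand for s^(M)_ij; noncommutative polynomials in them *)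
type_synonym sgen = "nat \<times> int \<times> int"

definition sgens :: "sgen set" where
  "sgens = {(M, i, j). M \<ge> 1 \<and> i \<in> {-1,1} \<and> j \<in> {-1,1}}"

definition s_poly :: "sgen fa \<Rightarrow> bool" where
  "s_poly P \<longleftrightarrow> fa_fin P \<and> (\<forall>w. P w \<noteq> 0 \<longrightarrow> set w \<subseteq> sgens)"

definition s_subst :: "bool \<Rightarrow> sgen fa \<Rightarrow> ygen fa" where
  "s_subst spc P = (\<lambda>v. \<Sum>w\<in>{w. P w \<noteq> 0}.
      P w * fa_prod (map (\<lambda>(M, i, j). s_fa spc M i j) w) v)"

definition tw_central :: "bool \<Rightarrow> sgen fa \<Rightarrow> bool" where
  "tw_central spc P \<longleftrightarrow> s_poly P \<and>
     (\<forall>Q. s_poly Q \<longrightarrow> fa_comm (s_subst spc P) (s_subst spc Q) \<in> yideal)"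

(* basis index: (summand sigma, multi-index p); sigma = 0 for U, 1 for U' *)
type_synonym idx = "nat \<times> nat list"
type_synonym mat = "idx \<Rightarrow> idx \<Rightarrow> complex"

definition mid :: mat where "mid = (\<lambda>p q. if p = q then 1 else 0)"
definition mzero :: mat where "mzero = (\<lambda>p q. 0)"
definition mmul :: "idx set \<Rightarrow> mat \<Rightarrow> mat \<Rightarrow> mat" where
  "mmul I A B = (\<lambda>p q. \<Sum>r\<in>I. A p r * B r q)"
definition mprod :: "idx set \<Rightarrow> mat list \<Rightarrow> mat" where
  "mprod I As = foldr (mmul I) As mid"

definition meval :: "idx set \<Rightarrow> (sgen \<Rightarrow> mat) \<Rightarrow> sgen fa \<Rightarrow> mat" where
  "meval I rho P = (\<lambda>p q. \<Sum>w\<in>{w. P w \<noteq> 0}. P w * mprod I (map rho w) p q)"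

inductive_set malg :: "idx set \<Rightarrow> mat set \<Rightarrow> mat set" for I G where
  gen: "X \<in> G \<Longrightarrow> X \<in> malg I G"
| one: "mid \<in> malg I G"
| add: "X \<in> malg I G \<Longrightarrow> Y \<in> malg I G \<Longrightarrow> (\<lambda>p q. X p q + Y p q) \<in> malg I G"
| smult: "X \<in> malg I G \<Longrightarrow> (\<lambda>p q. c * X p q) \<in> malg I G"
| mul: "X \<in> malg I G \<Longrightarrow> Y \<in> malg I G \<Longrightarrow> mmul I X Y \<in> malg I G"

definition is_eigvec :: "idx set \<Rightarrow> mat \<Rightarrow> (idx \<Rightarrow> complex) \<Rightarrow> complex \<Rightarrow> bool" where
  "is_eigvec I X v c \<longleftrightarrow> (\<forall>p\<in>I. (\<Sum>q\<in>I. X p q * v q) = c * v p)"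

definition lin_indep :: "idx set \<Rightarrow> (idx \<Rightarrow> idx \<Rightarrow> complex) \<Rightarrow> bool" where
  "lin_indep I v \<longleftrightarrow> (\<forall>a. (\<forall>q\<in>I. (\<Sum>b\<in>I. a b * v b q) = 0) \<longrightarrow> (\<forall>b\<in>I. a b = 0))"

definition simple_spec :: "idx set \<Rightarrow> mat set \<Rightarrow> bool" where
  "simple_spec I A \<longleftrightarrow> (\<exists>v. lin_indep I v \<and>
      (\<forall>b\<in>I. \<forall>X\<in>A. \<exists>c. is_eigvec I X (v b) c) \<and>
      (\<forall>b\<in>I. \<forall>b'\<in>I. b \<noteq> b' \<longrightarrow>
          (\<exists>X\<in>A. \<exists>c. is_eigvec I X (v b) c \<and> \<not> is_eigvec I X (v b') c)))"

(* weights are 1-indexed functions; n = number of components *)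
definition dominant :: "bool \<Rightarrow> nat \<Rightarrow> (nat \<Rightarrow> real) \<Rightarrow> bool" where
  "dominant spc n w \<longleftrightarrow>
     (n \<ge> 1 \<longrightarrow> w 1 \<le> 0) \<and> (\<forall>j. 1 \<le> j \<and> j < n \<longrightarrow> w (j+1) \<le> w j) \<and>
     (if spc then (\<forall>j\<in>{1..n}. w j \<in> \<int>)
      else (\<forall>j\<in>{1..n}. w j \<in> \<int>) \<or> (\<forall>j\<in>{1..n}. w j - 1/2 \<in> \<int>))"

(* mu occurs in the restriction of V_lambda to g_{k-1} (branching rule, Zhelobenko / Molev) *)
definition occurs :: "nat \<Rightarrow> (nat \<Rightarrow> real) \<Rightarrow> (nat \<Rightarrow> real) \<Rightarrow> bool" where
  "occurs k lam mu \<longleftrightarrow>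
     (\<forall>j\<in>{1..k-1}. mu j - lam 1 \<in> \<int>) \<and>
     (\<exists>lp. (\<forall>j\<in>{1..k}. lp j - lam 1 \<in> \<int>) \<and> lp 1 \<le> 0 \<and>
        (\<forall>j\<in>{1..k}. lam j \<le> lp j) \<and> (\<forall>j\<in>{1..k-1}. mu j \<le> lp j) \<and>
        (\<forall>j. 1 \<le> j \<and> j < k \<longrightarrow> lp (j+1) \<le> lam j \<and> lp (j+1) \<le> mu j))"

definition alpha :: "bool \<Rightarrow> (nat \<Rightarrow> real) \<Rightarrow> (nat \<Rightarrow> real) \<Rightarrow> nat \<Rightarrow> real" where
  "alpha spc lam mu j = min (lam (j-1)) (mu (j-1)) - real j + (if spc then 1/2 else 1)"

(* mu_k = -infinity *)
definition beta :: "bool \<Rightarrow> nat \<Rightarrow> (nat \<Rightarrow> real) \<Rightarrow> (nat \<Rightarrow> real) \<Rightarrow> nat \<Rightarrow> real" where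
  "beta spc k lam mu j = (if j = k then lam j else max (lam j) (mu j)) - real j + (if spc then 1/2 else 1)"

(* summands: only U (sigma=0) in the symplectic case; U (0) and U' (1) in the orthogonal case *)
definition sigset :: "bool \<Rightarrow> nat set" where
  "sigset spc = (if spc then {0} else {0, 1})"

(* highest weight (a_j, b_j) of the factor number m (0-based, j = m+1) of summand sigma, at z = 0 *)
definition fac_ab :: "bool \<Rightarrow> nat \<Rightarrow> (nat \<Rightarrow> real) \<Rightarrow> (nat \<Rightarrow> real) \<Rightarrow> nat \<Rightarrow> nat \<Rightarrow> real \<times> real" where
  "fac_ab spc k lam mu \<sigma> m =
     (if m = 0 then
        (if spc then -1/2 else if lam 1 \<in> \<int> then (if \<sigma> = 0 then 0 else -1) else -1/2)
      else alpha spc lam mu (m+1),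
      beta spc k lam mu (m+1))"

(* dim L(a,b) = a - b + 1 (0 if a - b = -1, i.e. U' = 0) *)
definition fdim :: "bool \<Rightarrow> nat \<Rightarrow> (nat \<Rightarrow> real) \<Rightarrow> (nat \<Rightarrow> real) \<Rightarrow> nat \<Rightarrow> nat \<Rightarrow> nat" where
  "fdim spc k lam mu \<sigma> m = nat (\<lfloor>fst (fac_ab spc k lam mu \<sigma> m) - snd (fac_ab spc k lam mu \<sigma> m)\<rfloor> + 1)"

definition deltaW :: "(nat \<Rightarrow> real) \<Rightarrow> nat \<Rightarrow> real" where
  "deltaW lam \<sigma> = (if lam 1 \<in> \<int> then 1/2 else if \<sigma> = 0 then 0 else 1)"

(* index set of the fixed basis: tensor products of h-weight vectors v_{p_1} x ... x v_{p_k} *)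
definition Ix :: "bool \<Rightarrow> nat \<Rightarrow> (nat \<Rightarrow> real) \<Rightarrow> (nat \<Rightarrow> real) \<Rightarrow> idx set" where
  "Ix spc k lam mu = {(\<sigma>, p). \<sigma> \<in> sigset spc \<and> length p = k \<and>
       (\<forall>m<k. p ! m < fdim spc k lam mu \<sigma> m)}"

(* gl_2-action on L(a,b) realised on V_n (n = a-b) with basis v_0..v_n:
   h v_q = (n-2q) v_q, f v_q = v_{q+1}, e v_q = q(n-q+1) v_{q-1}, E_11 + E_{-1,-1} = a + b.
   Efac a b n i j p q = matrix entry <v_p| E_ij v_q>. *)
definition Efac :: "complex \<Rightarrow> complex \<Rightarrow> nat \<Rightarrow> int \<Rightarrow> int \<Rightarrow> nat \<Rightarrow> nat \<Rightarrow> complex" where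
  "Efac a b n i j p q =
     (if i = 1 \<and> j = 1 then (if p = q then a - of_nat q else 0)
      else if i = -1 \<and> j = -1 then (if p = q then b + of_nat q else 0)
      else if i = 1 \<and> j = -1 then (if Suc p = q then of_nat q * (of_nat n - of_nat q + 1) else 0)
      else if i = -1 \<and> j = 1 then (if p = Suc q then 1 else 0)
      else 0)"

definition Eop :: "bool \<Rightarrow> nat \<Rightarrow> (nat \<Rightarrow> real) \<Rightarrow> (nat \<Rightarrow> real) \<Rightarrow> (nat \<Rightarrow> complex)
                    \<Rightarrow> nat \<Rightarrow> int \<Rightarrow> int \<Rightarrow> mat" where
  "Eop spc k lam mu z m i j = (\<lambda>(\<sigma>, p) (\<sigma>', q).
     if \<sigma> = \<sigma>' \<and> (\<forall>l<k. l \<noteq> m \<longrightarrow> p ! l = q ! l)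
     then Efac (of_real (fst (fac_ab spc k lam mu \<sigma> m)) + z (m+1))
               (of_real (snd (fac_ab spc k lam mu \<sigma> m)) + z (m+1))
               (fdim spc k lam mu \<sigma> m - 1) i j (p ! m) (q ! m)
     else 0)"

(* coefficient of u^{-r} of t_ij(u) acting on the tensor product of the first m factors,
   via the iterated coproduct (t_ij(u) -> delta_ij + E_ij u^{-1} on each factor) *)
primrec Tc :: "idx set \<Rightarrow> (nat \<Rightarrow> int \<Rightarrow> int \<Rightarrow> mat) \<Rightarrow> nat \<Rightarrow> nat \<Rightarrow> int \<Rightarrow> int \<Rightarrow> mat" where
  "Tc I E 0 r i j = (if r = 0 \<and> i = j then mid else mzero)"
| "Tc I E (Suc m) r i j = (\<lambda>p q. \<Sum>c\<in>{-1,1::int}.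
       (if c = j then Tc I E m r i c p q else 0) +
       (if r \<ge> 1 then mmul I (Tc I E m (r - 1) i c) (E m c j) p q else 0))"

(* coefficient of u^{-n} of s_cc(u) on W(delta): s_11 = (u+delta)/(u+1/2), s_{-1,-1} = (u-delta+1)/(u+1/2) *)
definition wcoef :: "real \<Rightarrow> int \<Rightarrow> nat \<Rightarrow> complex" where
  "wcoef d c n = (if n = 0 then 1
                  else of_real ((if c = 1 then d - 1/2 else 1/2 - d) * (-1/2) ^ (n - 1)))"

definition Wop :: "bool \<Rightarrow> (nat \<Rightarrow> real) \<Rightarrow> int \<Rightarrow> int \<Rightarrow> nat \<Rightarrow> mat" where
  "Wop spc lam c b n = (\<lambda>(\<sigma>, p) (\<sigma>', q).
     if c = b \<and> (\<sigma>, p) = (\<sigma>', q)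
     then (if spc then (if n = 0 then 1 else 0) else wcoef (deltaW lam \<sigma>) c n)
     else 0)"

(* action of s^(M)_ij on M(z): coproduct Delta(s_ij(u)) = sum_{c,b} theta_bj t_ic(u) t_{-j,-b}(-u) (x) s_cb(u) *)
definition Sop :: "bool \<Rightarrow> nat \<Rightarrow> (nat \<Rightarrow> real) \<Rightarrow> (nat \<Rightarrow> real) \<Rightarrow> (nat \<Rightarrow> complex) \<Rightarrow> sgen \<Rightarrow> mat" where
  "Sop spc k lam mu z g = (case g of (M, i, j) \<Rightarrow>
     (let I = Ix spc k lam mu; E = Eop spc k lam mu z in
      (\<lambda>p q. \<Sum>c\<in>{-1,1::int}. \<Sum>b\<in>{-1,1::int}. \<Sum>r\<le>M. \<Sum>s\<le>M - r.
          theta spc b j * (-1) ^ s *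
          mmul I (mmul I (Tc I E k r i c) (Tc I E k s (- j) (- b))) (Wop spc lam c b (M - r - s)) p q)))"

definition Bimage :: "bool \<Rightarrow> nat \<Rightarrow> (nat \<Rightarrow> real) \<Rightarrow> (nat \<Rightarrow> real) \<Rightarrow> (nat \<Rightarrow> complex) \<Rightarrow> mat set" where
  "Bimage spc k lam mu z =
     malg (Ix spc k lam mu)
       ({meval (Ix spc k lam mu) (Sop spc k lam mu z) P | P. tw_central spc P} \<union>
        {Sop spc k lam mu z (2 * m + 1, 1, 1) | m. True})"

end

theory Submission
  imports Defs "HOL-Analysis.Analysis" "HOL-Computational_Algebra.Field_as_Ring"
    "Jordan_Normal_Form.Char_Poly" "Subresultants.Subresultant_Gcd"
begin

text \<open>Write $s(u) = t(u) t'(-u)$ with the theta-transpose $t'$. The reflection equation and the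
symmetry of $s(u)$ show that the odd part $Q(u)$ of the polynomial version of $s_{11}(u)$ satisfies
$[Q(u), Q(v)] = 0$, so every element of the image of $\mathcal{B}$ commutes with $Q(u)$. The module
$W(\delta)$ is not a restriction of a $\mathrm{Y}(2)$-module, but it appears in the quotient, by a
row condition, of the Verma module of highest weight $(1/2, 1-\delta)$ twisted by
$(1 + \frac{1}{2}u^{-1})^{-1}$; this makes $M(z)$ accessible to the RTT calculus.

Take $z = \tau c$ with a generic vector $c$ and $u = \tau$. Then $\tau^{-2k-1} Q(\tau)$ is a polynomial in
$\eta = 1/\tau$, and its value at $\eta = 0$ is a combination of the operators $h^{(j)}$, diagonal in
the tensor product basis with distinct entries. Hence the discriminant of the characteristic polynomial of this
matrix $A$ and the determinant of the Krylov matrix with rows $(1,\dots,1) A^i$, whose inverse maps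
$(1, x, x^2, \dots)$ to the eigenvector of eigenvalue $x$, vanish only for finitely many $\eta \neq 0$.
Along a ray $\tau = t/\omega$ that avoids them the eigenvalues stay distinct and lift to continuous
functions of $\eta$, up to and including $\eta = 0$.\<close>

section \<open>Operators and the RTT relation\<close>

text \<open>Centrality is defined through commutators lying in \<open>yideal\<close>, so it says
  something about an operator only in a genuine representation of Y(2) whose \<open>sop\<close>
  agrees with \<open>Sop\<close>. This forces every factor, W(\<delta>) included, to come from
  Yangian data, and it is why the RTT calculus runs on operators, with matrices over the finite
  index set appearing as their restrictions (\<open>rep\<close>). A single operator decides the
  spectrum: Q lies in the image of B and commutes with all of it, so once Q has distinct
  eigenvalues, its eigenvectors are eigenvectors of the whole image, and Q alone separates them. Odd
  parts enter because the reflection equation leaves in [s_11(u), s_11(v)] an error built from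
  s_{1,-1} and s_{-1,1}; antisymmetrising in u and in v cancels it, thanks to the symmetry of these
  two series. At \<eta> = 0 the operator h of slot j enters with weight 1/(1 - c_j^2), so the
  direction c has to separate the basis vectors, both within and across U and U'.\<close>

typedef 'a endo = "{f :: ('a \<Rightarrow> complex) \<Rightarrow> 'a \<Rightarrow> complex.
    (\<forall>\<phi> \<psi>. f (\<lambda>x. \<phi> x + \<psi> x) = (\<lambda>x. f \<phi> x + f \<psi> x)) \<and> (\<forall>c \<phi>. f (\<lambda>x. c * \<phi> x) = (\<lambda>x. c * f \<phi> x))}"
  morphisms app Endo
  by (rule exI[of _ "\<lambda>\<phi> x. 0"]) auto

setup_lifting type_definition_endo

lemma app_scale_fun: "app A (\<lambda>x. c * \<phi> x) = (\<lambda>x. c * app A \<phi> x)"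
  using app[of A] by auto

instantiation endo :: (type) ring_1
begin

lift_definition zero_endo :: "'a endo" is "\<lambda>\<phi> x. 0" by auto
lift_definition one_endo :: "'a endo" is "\<lambda>\<phi>. \<phi>" by auto
lift_definition plus_endo :: "'a endo \<Rightarrow> 'a endo \<Rightarrow> 'a endo" is "\<lambda>f g \<phi> x. f \<phi> x + g \<phi> x"
  by (auto simp: algebra_simps)
lift_definition minus_endo :: "'a endo \<Rightarrow> 'a endo \<Rightarrow> 'a endo" is "\<lambda>f g \<phi> x. f \<phi> x - g \<phi> x"
  by (auto simp: algebra_simps)
lift_definition uminus_endo :: "'a endo \<Rightarrow> 'a endo" is "\<lambda>f \<phi> x. - f \<phi> x"
  by (auto simp: algebra_simps)
lift_definition times_endo :: "'a endo \<Rightarrow> 'a endo \<Rightarrow> 'a endo" is "\<lambda>f g \<phi>. f (g \<phi>)"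
  by auto

instance
proof
  fix a b c :: "'a endo"
  show "a * b * c = a * (b * c)" by transfer auto
  show "a + b + c = a + (b + c)" by transfer (auto simp: algebra_simps)
  show "a + b = b + a" by transfer (auto simp: algebra_simps)
  show "0 + a = a" by transfer auto
  show "- a + a = 0" by transfer auto
  show "a - b = a + - b" by transfer auto
  show "1 * a = a" by transfer auto
  show "a * 1 = a" by transfer auto
  show "(a + b) * c = a * c + b * c" by transfer auto
  show "a * (b + c) = a * b + a * c" by transfer auto
  show "(0 :: 'a endo) \<noteq> 1"
    by transfer (metis zero_neq_one)
qed

end

lemmas app_simps = zero_endo.rep_eq one_endo.rep_eq plus_endo.rep_eq minus_endo.rep_eq uminus_endo.rep_eq times_endo.rep_eq

lift_definition scale :: "complex \<Rightarrow> 'a endo \<Rightarrow> 'a endo" (infixr "*\<^sub>c" 75) is "\<lambda>c f \<phi> x. c * f \<phi> x"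
  by (auto simp: algebra_simps)

lemma app_sum: "app (\<Sum>i\<in>S. f i) \<phi> x = (\<Sum>i\<in>S. app (f i) \<phi> x)"
  by (induction S rule: infinite_finite_induct) (auto simp: app_simps)

lemma endo_eqI: "(\<And>\<phi> x. app A \<phi> x = app B \<phi> x) \<Longrightarrow> A = B"
  by (metis app_inject ext)

lemma scale_add_right: "c *\<^sub>c (A + B) = c *\<^sub>c A + c *\<^sub>c B"
  and scale_add_left: "(c + d) *\<^sub>c A = c *\<^sub>c A + d *\<^sub>c A"
  and scale_diff_right: "c *\<^sub>c (A - B) = c *\<^sub>c A - c *\<^sub>c B"
  and scale_diff_left: "(c - d) *\<^sub>c A = c *\<^sub>c A - d *\<^sub>c A"
  and scale_minus_right: "c *\<^sub>c (- A) = - (c *\<^sub>c A)"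
  and scale_minus_left: "(- c) *\<^sub>c A = - (c *\<^sub>c A)"
  and scale_scale: "c *\<^sub>c (d *\<^sub>c A) = (c * d) *\<^sub>c A"
  and scale_mult_left: "(c *\<^sub>c A) * B = c *\<^sub>c (A * B)"
  and scale_mult_right: "A * (c *\<^sub>c B) = c *\<^sub>c (A * B)"
  and scale_one: "1 *\<^sub>c A = A"
  and scale_zero_left: "0 *\<^sub>c A = 0"
  and scale_zero_right: "c *\<^sub>c (0 :: 'a endo) = 0"
  for A B :: "'a endo"
  by (rule endo_eqI; simp add: app_simps scale.rep_eq algebra_simps app_scale_fun)+

lemma app_scale: "app (c *\<^sub>c A) \<phi> x = c * app A \<phi> x"
  by (simp add: scale.rep_eq)

lemma scale_sum_right: "c *\<^sub>c (\<Sum>i\<in>S. f i) = (\<Sum>i\<in>S. c *\<^sub>c f i)"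
  by (rule endo_eqI) (simp add: app_scale app_sum sum_distrib_left)

lemma scale_sum_left: "(\<Sum>i\<in>S. f i) *\<^sub>c A = (\<Sum>i\<in>S. f i *\<^sub>c A)"
  by (rule endo_eqI) (simp add: app_scale app_sum sum_distrib_right)

lemmas scale_simps = scale_add_right scale_add_left scale_diff_right scale_diff_left scale_minus_right
  scale_minus_left scale_scale scale_mult_left scale_mult_right

lemma scale_cancel: "c *\<^sub>c A = c *\<^sub>c B \<Longrightarrow> c \<noteq> 0 \<Longrightarrow> A = B"
  by (metis left_inverse scale_one scale_scale)

lemma scale_eq_0: "c *\<^sub>c A = 0 \<Longrightarrow> c \<noteq> 0 \<Longrightarrow> A = 0"
  by (metis scale_cancel scale_zero_right)

text \<open>Evaluating at a function and a point reduces this to complex polynomials. It turns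
  identities known only for generic spectral parameters into identities of coefficients.\<close>

lemma endo_poly_zero:
  assumes "infinite S" "\<And>u. u \<in> S \<Longrightarrow> (\<Sum>r\<le>n. u ^ r *\<^sub>c a r) = 0" "r \<le> n"
  shows "a r = 0"
proof (rule endo_eqI)
  fix \<phi> x
  have "\<forall>u\<in>S. (\<Sum>r\<le>n. app (a r) \<phi> x * u ^ r) = 0"
  proof
    fix u assume "u \<in> S"
    from assms(2)[OF this] have "app (\<Sum>r\<le>n. u ^ r *\<^sub>c a r) \<phi> x = 0" by (simp add: app_simps)
    then show "(\<Sum>r\<le>n. app (a r) \<phi> x * u ^ r) = 0"
      by (simp add: app_sum app_scale mult.commute)
  qed
  then have "S \<subseteq> {u. (\<Sum>r\<le>n. app (a r) \<phi> x * u ^ r) = 0}" by auto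
  with assms(1) have "infinite {u. (\<Sum>r\<le>n. app (a r) \<phi> x * u ^ r) = 0}"
    using finite_subset by blast
  then show "app (a r) \<phi> x = app 0 \<phi> x"
    using polyfun_finite_roots[of "\<lambda>r. app (a r) \<phi> x" n] assms(3) by (auto simp: app_simps)
qed

type_synonym 'a gmat = "int \<Rightarrow> int \<Rightarrow> 'a endo"

text \<open>Here \<open>w\<close> is the difference of the spectral parameters of \<open>a\<close>
  and \<open>b\<close>. Every term contains one entry of each, so the relation is the same for t(u)
  and for its multiples by scalar functions of u.\<close>

definition rtt :: "complex \<Rightarrow> 'a gmat \<Rightarrow> 'a gmat \<Rightarrow> bool" where
  "rtt w a b \<longleftrightarrow> (\<forall>i\<in>{-1,1}. \<forall>j\<in>{-1,1}. \<forall>k\<in>{-1,1}. \<forall>l\<in>{-1,1}.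
     w *\<^sub>c (a i j * b k l - b k l * a i j) = a k j * b i l - b k j * a i l)"

lemma rttD:
  assumes "rtt w a b" "i \<in> {-1,1}" "j \<in> {-1,1}" "k \<in> {-1,1}" "l \<in> {-1,1}"
  shows "w *\<^sub>c (a i j * b k l - b k l * a i j) = a k j * b i l - b k j * a i l"
  using assms unfolding rtt_def by blast

text \<open>Compatibility of the RTT relation with the coproduct. The commutator telescopes, using
  the relation once in each tensor factor; of the four resulting sums two coincide after exchanging
  the summation indices, and the other two form the right-hand side.\<close>

lemma rtt_mult:
  assumes ab: "rtt w a b" and ab': "rtt w a' b'"
    and comm: "\<And>i j k l. a i j * b' k l = b' k l * a i j" "\<And>i j k l. b i j * a' k l = a' k l * b i j"
  shows "rtt w (\<lambda>i j. \<Sum>c\<in>{-1,1}. a i c * a' c j) (\<lambda>i j. \<Sum>c\<in>{-1,1}. b i c * b' c j)"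
  unfolding rtt_def
proof (intro ballI)
  fix i j k l :: int assume ijkl: "i \<in> {-1,1}" "j \<in> {-1,1}" "k \<in> {-1,1}" "l \<in> {-1,1}"
  let ?I = "{-1,1::int}"
  have expand: "(\<Sum>c\<in>?I. a p c * a' c q) * (\<Sum>d\<in>?I. b r d * b' d s) = (\<Sum>c\<in>?I. \<Sum>d\<in>?I. a p c * b r d * (a' c q * b' d s))"
    for p q r s
    by (simp only: sum_product) (intro sum.cong refl, metis comm(2) mult.assoc)
  have expand': "(\<Sum>d\<in>?I. b r d * b' d s) * (\<Sum>c\<in>?I. a p c * a' c q) = (\<Sum>c\<in>?I. \<Sum>d\<in>?I. b r d * a p c * (b' d s * a' c q))"
    for p q r s
    by (simp only: sum_product, subst sum.swap) (intro sum.cong refl, metis comm(1) mult.assoc)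
  have "w *\<^sub>c ((\<Sum>c\<in>?I. a i c * a' c j) * (\<Sum>c\<in>?I. b k c * b' c l) - (\<Sum>c\<in>?I. b k c * b' c l) * (\<Sum>c\<in>?I. a i c * a' c j))
     = (\<Sum>c\<in>?I. \<Sum>d\<in>?I. w *\<^sub>c (a i c * b k d - b k d * a i c) * (a' c j * b' d l)
            + b k d * a i c * (w *\<^sub>c (a' c j * b' d l - b' d l * a' c j)))"
    unfolding expand expand' sum_subtractf[symmetric] scale_sum_right
    by (intro sum.cong refl) (simp add: scale_simps algebra_simps)
  also have "\<dots> = (\<Sum>c\<in>?I. \<Sum>d\<in>?I. (a k c * b i d - b k c * a i d) * (a' c j * b' d l)
            + b k d * a i c * (a' d j * b' c l - b' d j * a' c l))"
    by (intro sum.cong refl) (use ijkl rttD[OF ab] rttD[OF ab'] in \<open>simp\<close>)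
  also have "\<dots> = (\<Sum>c\<in>?I. \<Sum>d\<in>?I. a k c * b i d * (a' c j * b' d l))
       - (\<Sum>c\<in>?I. \<Sum>d\<in>?I. b k d * a i c * (b' d j * a' c l))
       - ((\<Sum>c\<in>?I. \<Sum>d\<in>?I. b k c * a i d * (a' c j * b' d l)) - (\<Sum>c\<in>?I. \<Sum>d\<in>?I. b k d * a i c * (a' d j * b' c l)))"
    by (simp add: sum_subtractf sum.distrib algebra_simps)
  also have "(\<Sum>c\<in>?I. \<Sum>d\<in>?I. b k c * a i d * (a' c j * b' d l)) = (\<Sum>c\<in>?I. \<Sum>d\<in>?I. b k d * a i c * (a' d j * b' c l))"
    by (rule sum.swap)
  finally show "w *\<^sub>c ((\<Sum>c\<in>?I. a i c * a' c j) * (\<Sum>c\<in>?I. b k c * b' c l) - (\<Sum>c\<in>?I. b k c * b' c l) * (\<Sum>c\<in>?I. a i c * a' c j))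
     = (\<Sum>c\<in>?I. a k c * a' c j) * (\<Sum>c\<in>?I. b i c * b' c l) - (\<Sum>c\<in>?I. b k c * b' c j) * (\<Sum>c\<in>?I. a i c * a' c l)"
    unfolding expand expand' by simp
qed

text \<open>For \<open>a\<close> = T(u) and \<open>b\<close> = T(-u) this is s_{p,-q}(u), up to a
  sign for q = 1 in the symplectic case. Flipping the second index makes both labels row indices of
  T, so that RTT acts on them alike.\<close>

definition Bop :: "complex \<Rightarrow> 'a gmat \<Rightarrow> 'a gmat \<Rightarrow> 'a gmat" where
  "Bop \<theta> a b p q = a p 1 * b q (-1) + \<theta> *\<^sub>c (a p (-1) * b q 1)"

text \<open>The R-matrix form: on the left the two row labels are exchanged, on the right, where
  \<open>b\<close> stands first, the two column labels.\<close>

lemma rtt_row: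
  assumes "rtt w a b" "i \<in> {-1,1}" "j \<in> {-1,1}" "k \<in> {-1,1}" "l \<in> {-1,1}"
  shows "w *\<^sub>c (a i j * b k l) - a k j * b i l = w *\<^sub>c (b k l * a i j) - b k j * a i l"
  using rttD[OF assms] by (simp add: scale_simps algebra_simps)

section \<open>The reflection equation\<close>

definition eps :: "complex \<Rightarrow> int \<Rightarrow> complex" where "eps \<theta> x = (if x = 1 then 1 else \<theta>)"

lemma Bop_sum: "Bop \<theta> a b p q = (\<Sum>x\<in>{-1,1}. eps \<theta> x *\<^sub>c (a p x * b q (- x)))"
  by (simp add: Bop_def eps_def scale_one add.commute)

lemma Bop_mult:
  "Bop \<theta> a a' p q * Bop \<theta> b b' r s = (\<Sum>x\<in>{-1,1}. \<Sum>y\<in>{-1,1}. (eps \<theta> x * eps \<theta> y) *\<^sub>c (a p x * a' q (- x) * b r y * b' s (- y)))"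
  unfolding Bop_sum sum_product by (intro sum.cong refl) (simp add: scale_simps mult.assoc mult.commute[where 'a=complex])

text \<open>Two RTT exchanges carry each side to the common order b, a, a', b'. What is left agrees
  after renaming the summation labels: flipping the signs of both labels multiplies each
  \<open>eps\<close> by \<theta>, and \<theta>^2 = 1.\<close>

lemma reflection:
  assumes rtts: "rtt (-(u+v)) a' b" "rtt (u-v) a b" "rtt (-(u+v)) b' a" "rtt (u-v) b' a'"
    and \<theta>: "\<theta> * \<theta> = 1"
    and pqrs: "p \<in> {-1,1}" "q \<in> {-1,1}" "r \<in> {-1,1}" "s \<in> {-1,1}"
  defines "F \<equiv> \<lambda>p q r s. Bop \<theta> a a' p q * Bop \<theta> b b' r s"
    and "G \<equiv> \<lambda>p q r s. Bop \<theta> b b' r s * Bop \<theta> a a' p q"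
  shows "(u-v) *\<^sub>c (-(u+v) *\<^sub>c F p q r s - F p r q s) - (-(u+v) *\<^sub>c F r q p s - F r p q s)
       = (u-v) *\<^sub>c (-(u+v) *\<^sub>c G p q r s - G s q r p) - (-(u+v) *\<^sub>c G p s r q - G q s r p)"
proof -
  let ?I = "{-1,1::int}"
  define w where "w = -(u+v)"
  define d where "d = u - v"
  have neg: "x \<in> ?I \<Longrightarrow> - x \<in> ?I" for x by auto
  have \<theta>': "\<theta> * (\<theta> * c) = c" for c using \<theta> by (metis mult.assoc mult_1)
  \<comment> \<open>\<open>N\<close> and \<open>M\<close> are the summands of the left and the right
    side in the order b, a, a', b'.\<close>
  define N where "N x y = w *\<^sub>c ((d *\<^sub>c (b r y * a p x) - b r x * a p y) * a' q (-x) * b' s (-y))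
      - (d *\<^sub>c (b r (-x) * a p x) - b r x * a p (-x)) * a' q y * b' s (-y)" for x y
  define M where "M x y = b r y * (w *\<^sub>c (a p x * (d *\<^sub>c (a' q (-x) * b' s (-y)) - a' q (-y) * b' s (-x)))
      - a p (-y) * (d *\<^sub>c (a' q (-x) * b' s x) - a' q x * b' s (-x)))" for x y
  have L: "d *\<^sub>c (w *\<^sub>c (a p x * a' q (- x) * b r y * b' s (- y)) - a p x * a' r (- x) * b q y * b' s (- y))
      - (w *\<^sub>c (a r x * a' q (- x) * b p y * b' s (- y)) - a r x * a' p (- x) * b q y * b' s (- y)) = N x y"
    (is "?L = _") if xy: "x \<in> ?I" "y \<in> ?I" for x y
  proof -
    have "?L = (d *\<^sub>c (a p x * (w *\<^sub>c (a' q (-x) * b r y) - a' r (-x) * b q y))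
        - a r x * (w *\<^sub>c (a' q (-x) * b p y) - a' p (-x) * b q y)) * b' s (-y)"
      by (simp add: scale_simps algebra_simps)
    also have "\<dots> = (d *\<^sub>c (a p x * (w *\<^sub>c (b r y * a' q (-x)) - b r (-x) * a' q y))
        - a r x * (w *\<^sub>c (b p y * a' q (-x)) - b p (-x) * a' q y)) * b' s (-y)"
      using pqrs xy neg by (simp only: rtt_row[OF rtts(1), folded w_def])
    also have "\<dots> = w *\<^sub>c ((d *\<^sub>c (a p x * b r y) - a r x * b p y) * a' q (-x) * b' s (-y))
      - (d *\<^sub>c (a p x * b r (-x)) - a r x * b p (-x)) * a' q y * b' s (-y)"
      by (simp add: scale_simps algebra_simps)
    also have "\<dots> = N x y"
      unfolding N_def using pqrs xy neg by (simp only: rtt_row[OF rtts(2), folded d_def])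
    finally show ?thesis .
  qed
  have R: "d *\<^sub>c (w *\<^sub>c (b r y * b' s (-y) * a p x * a' q (-x)) - b r y * b' p (-y) * a s x * a' q (-x))
      - (w *\<^sub>c (b r y * b' q (-y) * a p x * a' s (-x)) - b r y * b' p (-y) * a q x * a' s (-x)) = M x y"
    (is "?L = _") if xy: "x \<in> ?I" "y \<in> ?I" for x y
  proof -
    have "?L = b r y * (d *\<^sub>c ((w *\<^sub>c (b' s (-y) * a p x) - b' p (-y) * a s x) * a' q (-x))
        - (w *\<^sub>c (b' q (-y) * a p x) - b' p (-y) * a q x) * a' s (-x))"
      by (simp add: scale_simps algebra_simps)
    also have "\<dots> = b r y * (d *\<^sub>c ((w *\<^sub>c (a p x * b' s (-y)) - a p (-y) * b' s x) * a' q (-x))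
        - (w *\<^sub>c (a p x * b' q (-y)) - a p (-y) * b' q x) * a' s (-x))"
      using pqrs xy neg by (simp only: rtt_row[OF rtts(3), folded w_def])
    also have "\<dots> = b r y * (w *\<^sub>c (a p x * (d *\<^sub>c (b' s (-y) * a' q (-x)) - b' q (-y) * a' s (-x)))
      - a p (-y) * (d *\<^sub>c (b' s x * a' q (-x)) - b' q x * a' s (-x)))"
      by (simp add: scale_simps algebra_simps)
    also have "\<dots> = M x y"
      unfolding M_def using pqrs xy neg by (simp add: rtt_row[OF rtts(4), folded d_def])
    finally show ?thesis .
  qed
  have G: "G p' q' r' s' = (\<Sum>x\<in>?I. \<Sum>y\<in>?I. (eps \<theta> x * eps \<theta> y) *\<^sub>c (b r' y * b' s' (-y) * a p' x * a' q' (-x)))" for p' q' r' s'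
    unfolding G_def Bop_mult by (subst sum.swap) (simp only: mult.commute)
  have "d *\<^sub>c (w *\<^sub>c F p q r s - F p r q s) - (w *\<^sub>c F r q p s - F r p q s)
     = (\<Sum>x\<in>?I. \<Sum>y\<in>?I. (eps \<theta> x * eps \<theta> y) *\<^sub>c (d *\<^sub>c (w *\<^sub>c (a p x * a' q (- x) * b r y * b' s (- y)) - a p x * a' r (- x) * b q y * b' s (- y))
      - (w *\<^sub>c (a r x * a' q (- x) * b p y * b' s (- y)) - a r x * a' p (- x) * b q y * b' s (- y))))"
    unfolding F_def Bop_mult scale_sum_right sum_subtractf[symmetric]
    by (intro sum.cong refl) (simp add: scale_simps mult_ac)
  also have "\<dots> = (\<Sum>x\<in>?I. \<Sum>y\<in>?I. (eps \<theta> x * eps \<theta> y) *\<^sub>c N x y)"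
    by (intro sum.cong refl) (simp only: L)
  also have "\<dots> = (\<Sum>x\<in>?I. \<Sum>y\<in>?I. (eps \<theta> x * eps \<theta> y) *\<^sub>c M x y)"
    unfolding N_def M_def eps_def by (simp add: \<theta>' scale_simps algebra_simps)
  also have "\<dots> = (\<Sum>x\<in>?I. \<Sum>y\<in>?I. (eps \<theta> x * eps \<theta> y) *\<^sub>c (d *\<^sub>c (w *\<^sub>c (b r y * b' s (-y) * a p x * a' q (-x)) - b r y * b' p (-y) * a s x * a' q (-x))
      - (w *\<^sub>c (b r y * b' q (-y) * a p x * a' s (-x)) - b r y * b' p (-y) * a q x * a' s (-x))))"
    by (intro sum.cong refl) (simp only: R)
  also have "\<dots> = d *\<^sub>c (w *\<^sub>c G p q r s - G s q r p) - (w *\<^sub>c G p s r q - G q s r p)"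
    unfolding G scale_sum_right sum_subtractf[symmetric]
    by (intro sum.cong refl) (simp add: scale_simps mult_ac)
  finally show ?thesis unfolding w_def d_def .
qed

text \<open>RTT for two equal rows and parameters u, -u, whose difference is 2u, rewrites products
  of T(u) and T(-u) in the opposite order. The two equations combine because \<theta> (2u\<theta> -
  1) = 2u - \<theta>.\<close>

lemma Bop_symmetry:
  assumes "rtt (2*u) a a'" "p \<in> {-1,1}" and \<theta>: "\<theta> * \<theta> = 1"
  shows "(2*u-1) *\<^sub>c Bop \<theta> a a' p p = (2*u*\<theta>-1) *\<^sub>c Bop \<theta> a' a p p"
proof -
  have 1: "(2*u-1) *\<^sub>c (a p 1 * a' p (-1)) = (2*u) *\<^sub>c (a' p (-1) * a p 1) - a' p 1 * a p (-1)"
    using rtt_row[OF assms(1), of p 1 p "-1"] assms(2) by (simp add: scale_simps scale_one)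
  have 2: "(2*u-1) *\<^sub>c (a p (-1) * a' p 1) = (2*u) *\<^sub>c (a' p 1 * a p (-1)) - a' p (-1) * a p 1"
    using rtt_row[OF assms(1), of p "-1" p "1"] assms(2) by (simp add: scale_simps scale_one)
  have t: "\<theta> * (2*u*\<theta>-1) = 2*u - \<theta>" using \<theta> by (simp add: algebra_simps)
  have "(2*u-1) *\<^sub>c Bop \<theta> a a' p p = (2*u-1) *\<^sub>c (a p 1 * a' p (-1)) + \<theta> *\<^sub>c ((2*u-1) *\<^sub>c (a p (-1) * a' p 1))"
    by (simp add: Bop_def scale_simps algebra_simps)
  also have "\<dots> = (2*u*\<theta>-1) *\<^sub>c (a' p 1 * a p (-1)) + (\<theta> * (2*u*\<theta>-1)) *\<^sub>c (a' p (-1) * a p 1)"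
    unfolding 1 2 t by (simp add: scale_simps scale_one mult_ac)
  finally show ?thesis by (simp add: Bop_def scale_simps mult_ac)
qed

text \<open>The reflection equation for rows $(1,-1,1,-1)$, divided by $u-v-1$.\<close>

lemma reflection_diag:
  assumes T: "\<And>x y. rtt (x - y) (T x) (T y)" and \<theta>: "\<theta> * \<theta> = 1" and uv: "u - v \<noteq> 1"
  defines "S \<equiv> \<lambda>p q x. Bop \<theta> (T x) (T (- x)) p q"
  shows "(u + v) *\<^sub>c (S 1 (-1) u * S 1 (-1) v - S 1 (-1) v * S 1 (-1) u)
       = S 1 1 v * S (-1) (-1) u - S 1 1 u * S (-1) (-1) v"
proof -
  have r: "rtt (-(u+v)) (T (-u)) (T v)" "rtt (u-v) (T u) (T v)" "rtt (-(u+v)) (T (-v)) (T u)" "rtt (u-v) (T (-v)) (T (-u))"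
    using T[of "-u" v] T[of u v] T[of "-v" u, unfolded minus_diff_commute[of v u]] T[of "-v" "-u"] by (simp_all add: algebra_simps)
  have "(u-v-1) *\<^sub>c ((u + v) *\<^sub>c (S 1 (-1) u * S 1 (-1) v - S 1 (-1) v * S 1 (-1) u))
      = (u-v-1) *\<^sub>c (S 1 1 v * S (-1) (-1) u - S 1 1 u * S (-1) (-1) v)"
    using reflection[OF r \<theta>, of 1 "-1" 1 "-1"] unfolding S_def
    by (simp add: scale_simps scale_one algebra_simps)
  then show ?thesis by (rule scale_cancel) (use uv in auto)
qed

text \<open>With p = u + v and m = u - v, each of the four commutators carries, besides one more
  factor, the sum of its own two arguments, which is the coefficient with which
  \<open>reflection_diag\<close> determines it.\<close>

lemma bilinear_expand:
  "(p * m) *\<^sub>c ((a - a') * (b - b') - (b - b') * (a - a')) =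
    m *\<^sub>c (p *\<^sub>c (a * b - b * a)) + p *\<^sub>c ((-m) *\<^sub>c (a' * b - b * a'))
    - p *\<^sub>c (m *\<^sub>c (a * b' - b' * a)) - m *\<^sub>c ((-p) *\<^sub>c (a' * b' - b' * a'))"
  by (simp add: scale_simps algebra_simps)

text \<open>The four commutators obtained by changing the signs of u and v are scalar multiples of
  one operator \<open>D\<close>, because s_{1,-1} and s_{-1,1} become even after division by
  \<open>n\<close>. In the commutator of the odd parts these scalars cancel. The excluded values are
  zeros of factors that are divided out.\<close>

lemma odd_parts_commute:
  assumes T: "\<And>x y. rtt (x - y) (T x) (T y)" and \<theta>: "\<theta> = 1 \<or> \<theta> = -1"
    and uv: "u \<noteq> v" "u \<noteq> - v" "u - v \<noteq> 1" "u - v \<noteq> -1" "u + v \<noteq> 1" "u + v \<noteq> -1" "2*u \<noteq> 1" "2 * v \<noteq> 1" "2*u \<noteq> -1" "2 * v \<noteq> -1"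
  defines "S \<equiv> \<lambda>p q x. Bop \<theta> (T x) (T (- x)) p q"
  defines "Q \<equiv> \<lambda>x. S 1 (-1) x - S 1 (-1) (-x)"
  shows "Q u * Q v = Q v * Q u"
proof -
  have \<theta>\<theta>: "\<theta> * \<theta> = 1" using \<theta> by auto
  define C where "C x y = S 1 (-1) x * S 1 (-1) y - S 1 (-1) y * S 1 (-1) x" for x y
  \<comment> \<open>This is 1 for \<theta> = 1 and 1 + 2x for \<theta> = -1;
    \<open>Bop_symmetry\<close> then says that \<open>S p p x\<close> divided by \<open>n x\<close>
    is even in x.\<close>
  define n where "n x = 1 + (1 - \<theta>) * x" for x
  have n0: "n x \<noteq> 0" if "2*x \<noteq> -1" for x
    using that \<theta> by (auto simp: n_def add_eq_0_iff2 minus_equation_iff[of "2*x" 1])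
  define Y where "Y p x = (1 / n x) *\<^sub>c S p p x" for p x
  have Y: "S p p x = n x *\<^sub>c Y p x" if "2*x \<noteq> -1" for p x
    using n0[OF that] by (simp add: Y_def scale_scale scale_one)
  have sym: "Y p (- x) = Y p x" if "p \<in> {-1,1}" "2*x \<noteq> 1" "2*x \<noteq> -1" for p x
  proof (rule scale_cancel)
    have "(2*x-1) *\<^sub>c S p p x = (2*x*\<theta>-1) *\<^sub>c S p p (-x)"
      using Bop_symmetry[of x "T x" "T (-x)" p \<theta>] T[of x "-x"] that \<theta>\<theta> unfolding S_def by simp
    then have "((2*x-1) * n x) *\<^sub>c Y p x = ((2*x*\<theta>-1) * n (-x)) *\<^sub>c Y p (-x)"
      using Y[of x p] Y[of "-x" p] that by (simp add: scale_scale)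
    moreover have "(2*x*\<theta>-1) * n (-x) = (2*x-1) * n x" using \<theta> by (auto simp: n_def algebra_simps)
    ultimately show "((2*x-1) * n x) *\<^sub>c Y p (-x) = ((2*x-1) * n x) *\<^sub>c Y p x" by simp
    show "(2*x-1) * n x \<noteq> 0" using n0 that by simp
  qed
  define D where "D = Y 1 v * Y (-1) u - Y 1 u * Y (-1) v"
  have C: "(x + y) *\<^sub>c C x y = (n x * n y) *\<^sub>c D" if "x = u \<or> x = -u" "y = v \<or> y = -v" for x y
  proof -
    have xy: "2*x \<noteq> 1" "2*y \<noteq> 1" "2*x \<noteq> -1" "2*y \<noteq> -1" using that uv by (auto simp: minus_equation_iff)
    have Yxy: "Y p x = Y p u" "Y p y = Y p v" if "p \<in> {-1,1}" for p
      using that \<open>x = u \<or> x = -u\<close> \<open>y = v \<or> y = -v\<close> sym[of p u] sym[of p v] uv by auto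
    have "x - y \<noteq> 1"
    proof
      assume h: "x - y = 1"
      then have "y - x = -1" by (metis minus_diff_eq)
      with h that uv show False by (auto simp: add.commute)
    qed
    from reflection_diag[OF T \<theta>\<theta> this, folded S_def]
    have "(x + y) *\<^sub>c C x y = S 1 1 y * S (-1) (-1) x - S 1 1 x * S (-1) (-1) y"
      unfolding C_def by (simp add: S_def)
    also have "\<dots> = (n x * n y) *\<^sub>c D"
      using xy by (simp add: Y Yxy D_def scale_simps mult.commute)
    finally show ?thesis .
  qed
  have "((u+v)*(u-v)) *\<^sub>c (Q u * Q v - Q v * Q u)
      = (u-v) *\<^sub>c ((u+v) *\<^sub>c C u v) + (u+v) *\<^sub>c ((-u+v) *\<^sub>c C (-u) v)
        - (u+v) *\<^sub>c ((u+-v) *\<^sub>c C u (-v)) - (u-v) *\<^sub>c ((-u+-v) *\<^sub>c C (-u) (-v))"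
    unfolding Q_def C_def using bilinear_expand[of "u+v" "u-v"] by simp
  also have "\<dots> = ((u-v)*(n u*n v) + (u+v)*(n (-u)*n v) - (u+v)*(n u*n (-v)) - (u-v)*(n(-u)*n (-v))) *\<^sub>c D"
    by (subst (1 2 3 4) C) (simp_all add: scale_simps)
  \<comment> \<open>For n(x) = 1 + \<kappa> x one has n(u)n(v) - n(-u)n(-v) = 2\<kappa>(u + v) and
    n(-u)n(v) - n(u)n(-v) = -2\<kappa>(u - v), so the bracket is zero.\<close>
  also have "\<dots> = 0 *\<^sub>c D"
    by (rule arg_cong[where f="\<lambda>c. c *\<^sub>c D"]) (simp add: n_def algebra_simps)
  finally have "((u+v)*(u-v)) *\<^sub>c (Q u * Q v - Q v * Q u) = 0" by (simp add: scale_zero_left)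
  from scale_eq_0[OF this] uv show ?thesis by (simp add: add_eq_0_iff2)
qed

section \<open>Tensor products of evaluation modules\<close>

definition gl2_rel :: "'a gmat \<Rightarrow> bool" where
  "gl2_rel D \<longleftrightarrow> (\<forall>i\<in>{-1,1}. \<forall>j\<in>{-1,1}. \<forall>k\<in>{-1,1}. \<forall>l\<in>{-1,1}.
     D i j * D k l - D k l * D i j = (if k = j then D i l else 0) - (if i = l then D k j else 0))"

text \<open>The evaluation image of t_ij multiplied by its parameter, hence free of denominators.
  Adding z to both weights of L(a,b) amounts to adding z to \<open>x\<close>.\<close>

definition Lop :: "complex \<Rightarrow> 'a gmat \<Rightarrow> 'a gmat" where
  "Lop x D i j = (if i = j then x *\<^sub>c 1 else 0) + D i j"

text \<open>The scalar parts drop out of the commutator on the left, while on the right they produce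
  exactly the factor u - v.\<close>

lemma rtt_Lop:
  assumes "gl2_rel D"
  shows "rtt (u - v) (Lop u D) (Lop v D)"
  unfolding rtt_def
proof (intro ballI)
  fix i j k l :: int assume ijkl: "i \<in> {-1,1}" "j \<in> {-1,1}" "k \<in> {-1,1}" "l \<in> {-1,1}"
  have "Lop u D i j * Lop v D k l - Lop v D k l * Lop u D i j = D i j * D k l - D k l * D i j"
    by (simp add: Lop_def algebra_simps scale_mult_left scale_mult_right)
  also have "\<dots> = (if k = j then D i l else 0) - (if i = l then D k j else 0)"
    using assms ijkl unfolding gl2_rel_def by blast
  finally have "(u - v) *\<^sub>c (Lop u D i j * Lop v D k l - Lop v D k l * Lop u D i j)
     = (u - v) *\<^sub>c ((if k = j then D i l else 0) - (if i = l then D k j else 0))" by simp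
  also have "\<dots> = Lop u D k j * Lop v D i l - Lop v D k j * Lop u D i l"
    by (simp add: Lop_def algebra_simps scale_simps scale_zero_right mult.commute)
  finally show "(u - v) *\<^sub>c (Lop u D i j * Lop v D k l - Lop v D k l * Lop u D i j)
     = Lop u D k j * Lop v D i l - Lop v D k j * Lop u D i l" .
qed

primrec TT :: "(nat \<Rightarrow> complex) \<Rightarrow> (nat \<Rightarrow> 'a gmat) \<Rightarrow> nat \<Rightarrow> 'a gmat" where
  "TT x D 0 i j = (if i = j then 1 else 0)"
| "TT x D (Suc m) i j = (\<Sum>c\<in>{-1,1}. TT x D m i c * Lop (x m) (D m) c j)"

definition commuting_family :: "(nat \<Rightarrow> 'a gmat) \<Rightarrow> bool" where
  "commuting_family D \<longleftrightarrow> (\<forall>m m' i j k l. m \<noteq> m' \<longrightarrow> D m i j * D m' k l = D m' k l * D m i j)"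

lemma TT_commute:
  assumes "\<And>m i j. m < K \<Longrightarrow> X * D m i j = D m i j * X"
  shows "X * TT x D K i j = TT x D K i j * X"
  using assms
proof (induction K arbitrary: i j)
  case (Suc K)
  have "X * (TT x D K i c * Lop (x K) (D K) c j) = TT x D K i c * Lop (x K) (D K) c j * X" for c
  proof -
    have "X * Lop (x K) (D K) c j = Lop (x K) (D K) c j * X"
      using Suc.prems[of K] by (simp add: Lop_def algebra_simps scale_mult_left scale_mult_right)
    moreover have "X * TT x D K i c = TT x D K i c * X" using Suc by simp
    ultimately show ?thesis by (metis mult.assoc)
  qed
  then show ?case by (simp add: distrib_left distrib_right)
qed (simp)

lemma rtt_TT:
  assumes "\<And>m. m < K \<Longrightarrow> gl2_rel (D m)" "commuting_family D"
  shows "rtt (u - v) (TT (\<lambda>m. u + z m) D K) (TT (\<lambda>m. v + z m) D K)"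
  using assms(1)
proof (induction K)
  case 0
  show ?case by (simp add: rtt_def scale_zero_right)
next
  case (Suc K)
  have comm: "TT x D K i j * Lop y (D K) k l = Lop y (D K) k l * TT x D K i j" for x y i j k l
  proof -
    have "Lop y (D K) k l * D m i j = D m i j * Lop y (D K) k l" if "m < K" for m i j
      using assms(2) that by (simp add: commuting_family_def Lop_def algebra_simps scale_mult_left scale_mult_right)
    from TT_commute[of K "Lop y (D K) k l" D, OF this] show ?thesis by simp
  qed
  have "rtt ((u + z K) - (v + z K)) (Lop (u + z K) (D K)) (Lop (v + z K) (D K))"
    by (rule rtt_Lop) (use Suc in simp)
  then have "rtt (u - v) (Lop (u + z K) (D K)) (Lop (v + z K) (D K))" by simp
  from rtt_mult[OF Suc.IH this comm comm] Suc.prems show ?case by (simp add: rtt_def)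
qed

text \<open>The monodromy matrix with site parameters u y_m + z_m, divided by u^K and written in X =
  1/u; the shifts z_m sit in \<open>D\<close>. Taking y = 1 gives t(u), and y = c + 1 or c - 1 gives
  the monodromy at \<tau> or -\<tau> on the ray z = \<tau> c.\<close>

primrec Gp :: "(nat \<Rightarrow> complex) \<Rightarrow> (nat \<Rightarrow> 'a gmat) \<Rightarrow> nat \<Rightarrow> int \<Rightarrow> int \<Rightarrow> 'a endo fps" where
  "Gp y D 0 i j = (if i = j then 1 else 0)"
| "Gp y D (Suc m) i j = (\<Sum>c\<in>{-1,1}. Gp y D m i c *
     (fps_const (if c = j then y m *\<^sub>c 1 else 0) + fps_const (D m c j) * fps_X))"

definition shifted :: "(nat \<Rightarrow> complex) \<Rightarrow> (nat \<Rightarrow> 'a gmat) \<Rightarrow> nat \<Rightarrow> 'a gmat" where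
  "shifted z D m = Lop (z m) (D m)"

lemma Gp_nth_Suc:
  assumes "j \<in> {-1,1}"
  shows "fps_nth (Gp y D (Suc m) i j) r = y m *\<^sub>c fps_nth (Gp y D m i j) r
     + (\<Sum>c\<in>{-1,1}. if r = 0 then 0 else fps_nth (Gp y D m i c) (r - 1) * D m c j)"
  using assms by (auto simp add: distrib_left mult.assoc[symmetric] scale_mult_right)

lemma Gp_nth_eq_0:
  assumes "r > K"
  shows "fps_nth (Gp y D K i j) r = 0"
  using assms
proof (induction K arbitrary: r i j)
  case (Suc K)
  then show ?case by (simp add: distrib_left mult.assoc[symmetric])
qed simp

text \<open>For a series of degree at most n in X this is u^n times its value at X = 1/u.\<close>

definition Ev :: "nat \<Rightarrow> 'a endo fps \<Rightarrow> complex \<Rightarrow> 'a endo" where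
  "Ev n f u = (\<Sum>r\<le>n. u ^ (n - r) *\<^sub>c fps_nth f r)"

lemma TT_eq_Ev:
  "j \<in> {-1,1} \<Longrightarrow> TT (\<lambda>m. u * y m + z m) D K i j = Ev K (Gp y (shifted z D) K i j) u"
proof (induction K arbitrary: j)
  case 0
  then show ?case by (simp add: Ev_def scale_one scale_zero_right)
next
  case (Suc K)
  let ?G = "Gp y (shifted z D) K"
  have top: "fps_nth (?G i c) (Suc K) = 0" for c by (simp add: Gp_nth_eq_0)
  have 1: "(\<Sum>r\<le>Suc K. u ^ (Suc K - r) *\<^sub>c (y K *\<^sub>c fps_nth (?G i j) r)) = (u * y K) *\<^sub>c Ev K (?G i j) u"
    by (simp add: Ev_def scale_sum_right scale_scale top scale_zero_right Suc_diff_le mult_ac)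
  have 2: "(\<Sum>r\<le>Suc K. u ^ (Suc K - r) *\<^sub>c (\<Sum>c\<in>{-1,1}. if r = 0 then 0 else fps_nth (?G i c) (r - 1) * shifted z D K c j))
      = (\<Sum>c\<in>{-1,1}. Ev K (?G i c) u * shifted z D K c j)"
    unfolding sum.atMost_Suc_shift
    by (simp add: Ev_def sum_distrib_right scale_zero_right scale_add_right sum.distrib scale_mult_left)
  have "Ev (Suc K) (Gp y (shifted z D) (Suc K) i j) u = (\<Sum>r\<le>Suc K. u ^ (Suc K - r) *\<^sub>c (y K *\<^sub>c fps_nth (?G i j) r))
    + (\<Sum>r\<le>Suc K. u ^ (Suc K - r) *\<^sub>c (\<Sum>c\<in>{-1,1}. if r = 0 then 0 else fps_nth (?G i c) (r - 1) * shifted z D K c j))"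
    unfolding Ev_def Gp_nth_Suc[OF Suc.prems] scale_add_right sum.distrib ..
  also have "\<dots> = (u * y K) *\<^sub>c Ev K (?G i j) u + (\<Sum>c\<in>{-1,1}. Ev K (?G i c) u * shifted z D K c j)"
    unfolding 1 2 ..
  also have "\<dots> = (\<Sum>c\<in>{-1,1}. Ev K (?G i c) u * Lop (u * y K + z K) (D K) c j)"
    using Suc.prems by (auto simp: shifted_def Lop_def algebra_simps scale_mult_right scale_add_left)
  also have "\<dots> = TT (\<lambda>m. u * y m + z m) D (Suc K) i j" by (simp add: Suc.IH)
  finally show ?case ..
qed

lemma Ev_mult:
  assumes "\<And>r. r > n \<Longrightarrow> fps_nth f r = 0" "\<And>r. r > m \<Longrightarrow> fps_nth g r = 0"
  shows "Ev (n + m) (f * g) u = Ev n f u * Ev m g u"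
proof -
  have "Ev n f u * Ev m g u = (\<Sum>r\<le>n. \<Sum>s\<le>m. u ^ (n + m - (r + s)) *\<^sub>c (fps_nth f r * fps_nth g s))"
    unfolding Ev_def sum_product
    by (intro sum.cong refl) (auto simp: scale_mult_left scale_mult_right scale_scale add_ac simp flip: power_add)
  also have "\<dots> = (\<Sum>(r, s)\<in>{..n} \<times> {..m}. u ^ (n + m - (r + s)) *\<^sub>c (fps_nth f r * fps_nth g s))"
    by (simp add: sum.cartesian_product)
  also have "\<dots> = (\<Sum>(r, s)\<in>{(r, s). r + s \<le> n + m}. u ^ (n + m - (r + s)) *\<^sub>c (fps_nth f r * fps_nth g s))"
  proof (rule sum.mono_neutral_left)
    have "{(r, s). r + s \<le> n + m} \<subseteq> {..n+m} \<times> {..n+m}" by auto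
    then show "finite {(r, s). r + s \<le> n + m}" using finite_subset by blast
  qed (auto, (metis assms(1) mult_zero_left not_le scale_zero_right), (metis assms(2) mult_zero_right not_le scale_zero_right))
  also have "\<dots> = (\<Sum>k\<le>n+m. \<Sum>r\<le>k. u ^ (n + m - k) *\<^sub>c (fps_nth f r * fps_nth g (k - r)))"
    by (subst sum.triangle_reindex_eq) simp
  also have "\<dots> = Ev (n + m) (f * g) u"
    unfolding Ev_def fps_mult_nth scale_sum_right by (simp add: atLeast0AtMost)
  finally show ?thesis ..
qed

lemma Ev_add: "Ev n (f + g) u = Ev n f u + Ev n g u"
  by (simp add: Ev_def scale_add_right sum.distrib)

lemma Ev_diff: "Ev n (f - g) u = Ev n f u - Ev n g u"
  by (simp add: Ev_def scale_diff_right sum_subtractf)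

text \<open>The set for the second variable may depend on the first, as conditions such as u - v
  \<noteq> 1 require.\<close>

lemma endo_poly2_zero:
  assumes "infinite S" "\<And>u. u \<in> S \<Longrightarrow> infinite (T u)"
    and "\<And>u v. u \<in> S \<Longrightarrow> v \<in> T u \<Longrightarrow> (\<Sum>r\<le>n. \<Sum>s\<le>n. (u ^ r * v ^ s) *\<^sub>c c r s) = 0" "r \<le> n" "s \<le> n"
  shows "c r s = (0 :: 'a endo)"
proof -
  have "(\<Sum>r\<le>n. u ^ r *\<^sub>c c r s) = 0" if u: "u \<in> S" for u
  proof (rule endo_poly_zero[OF assms(2)[OF u] _ assms(5)])
    fix v assume "v \<in> T u"
    have "(\<Sum>s\<le>n. v ^ s *\<^sub>c (\<Sum>r\<le>n. u ^ r *\<^sub>c c r s)) = (\<Sum>r\<le>n. \<Sum>s\<le>n. (u ^ r * v ^ s) *\<^sub>c c r s)"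
      unfolding scale_sum_right by (subst sum.swap) (simp add: scale_scale mult.commute)
    then show "(\<Sum>s\<le>n. v ^ s *\<^sub>c (\<Sum>r\<le>n. u ^ r *\<^sub>c c r s)) = 0" using assms(3)[OF u \<open>v \<in> T u\<close>] by simp
  qed
  then show ?thesis by (intro endo_poly_zero[OF assms(1) _ assms(4), of "\<lambda>r. c r s"])
qed

section \<open>Yangian relations from the RTT relation, coefficient by coefficient\<close>

definition yangian_rel :: "(nat \<Rightarrow> 'a gmat) \<Rightarrow> bool" where
  "yangian_rel t \<longleftrightarrow> (\<forall>i\<in>{-1,1}. \<forall>j\<in>{-1,1}. \<forall>k\<in>{-1,1}. \<forall>l\<in>{-1,1}. \<forall>r s.
     (t (Suc r) i j * t s k l - t s k l * t (Suc r) i j) - (t r i j * t (Suc s) k l - t (Suc s) k l * t r i j)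
       = t r k j * t s i l - t s k j * t r i l)"

lemma yangian_relD:
  assumes "yangian_rel t" "i \<in> {-1,1}" "j \<in> {-1,1}" "k \<in> {-1,1}" "l \<in> {-1,1}"
  shows "(t (Suc r) i j * t s k l - t s k l * t (Suc r) i j) - (t r i j * t (Suc s) k l - t (Suc s) k l * t r i j)
       = t r k j * t s i l - t s k j * t r i l"
  using assms unfolding yangian_rel_def by blast

lemma poly_shift:
  "(\<Sum>r\<le>Suc K. u ^ r *\<^sub>c (if r = 0 then 0 else f (r - 1))) = u *\<^sub>c (\<Sum>r\<le>K. u ^ r *\<^sub>c (f r :: 'a endo))"
  unfolding sum.atMost_Suc_shift by (simp add: scale_sum_right scale_scale scale_zero_right)

text \<open>The RTT relation at 1/u and 1/v, multiplied by \<open>u ^ Suc K * v ^ Suc K\<close>, is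
  polynomial in both variables; the defining relations are its coefficients of u^{r+1}
  v^{s+1}.\<close>

lemma yangian_rel_nth:
  fixes G :: "int \<Rightarrow> int \<Rightarrow> 'a endo fps"
  assumes top: "\<And>i j r. r > K \<Longrightarrow> fps_nth (G i j) r = 0"
    and rtt: "\<And>u v. rtt (u - v) (\<lambda>i j. Ev K (G i j) u) (\<lambda>i j. Ev K (G i j) v)"
  shows "yangian_rel (\<lambda>r i j. fps_nth (G i j) r)"
  unfolding yangian_rel_def
proof (intro ballI allI)
  fix i j k l :: int and r s
  assume ijkl: "i \<in> {-1,1}" "j \<in> {-1,1}" "k \<in> {-1,1}" "l \<in> {-1,1}"
  define P where "P u f = (\<Sum>r\<le>K. u ^ r *\<^sub>c fps_nth f r)" for u and f :: "'a endo fps"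
  have P_mult: "P u f * P v g = (\<Sum>r\<le>K. \<Sum>s\<le>K. (u ^ r * v ^ s) *\<^sub>c (fps_nth f r * fps_nth g s))" for u v f g
    unfolding P_def sum_product by (simp add: scale_mult_left scale_mult_right scale_scale mult.commute)
  have P_mult': "P v g * P u f = (\<Sum>r\<le>K. \<Sum>s\<le>K. (u ^ r * v ^ s) *\<^sub>c (fps_nth g s * fps_nth f r))" for u v f g
    unfolding P_mult by (subst sum.swap) (simp add: mult.commute)
  define A where "A r s = fps_nth (G i j) r * fps_nth (G k l) s - fps_nth (G k l) s * fps_nth (G i j) r" for r s
  define B where "B r s = fps_nth (G k j) r * fps_nth (G i l) s - fps_nth (G k j) s * fps_nth (G i l) r" for r s
  have Atop: "A r s = 0" if "r > K \<or> s > K" for r s using that top by (auto simp: A_def)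
  have Btop: "B r s = 0" if "r > K \<or> s > K" for r s using that top by (auto simp: B_def)
  have key: "(v - u) *\<^sub>c (\<Sum>r\<le>K. \<Sum>s\<le>K. (u ^ r * v ^ s) *\<^sub>c A r s)
      = (u * v) *\<^sub>c (\<Sum>r\<le>K. \<Sum>s\<le>K. (u ^ r * v ^ s) *\<^sub>c B r s)" if "u \<noteq> 0" "v \<noteq> 0" for u v
  proof -
    have EvP: "Ev K f (1 / x) = (1 / x ^ K) *\<^sub>c P x f" if "x \<noteq> 0" for x f
      unfolding Ev_def P_def scale_sum_right scale_scale
      by (intro sum.cong refl arg_cong2[where f=scale]) (use that in \<open>simp_all add: power_diff power_divide\<close>)
    have "(1/u - 1/v) *\<^sub>c ((1 / u ^ K * (1 / v ^ K)) *\<^sub>c (P u (G i j) * P v (G k l) - P v (G k l) * P u (G i j)))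
       = (1 / u ^ K * (1 / v ^ K)) *\<^sub>c (P u (G k j) * P v (G i l) - P v (G k j) * P u (G i l))"
      using rttD[OF rtt[of "1/u" "1/v"] ijkl] unfolding EvP[OF that(1)] EvP[OF that(2)]
      by (simp add: scale_simps mult.commute)
    then have "(u ^ Suc K * v ^ Suc K) *\<^sub>c ((1/u - 1/v) *\<^sub>c ((1 / u ^ K * (1 / v ^ K)) *\<^sub>c (P u (G i j) * P v (G k l) - P v (G k l) * P u (G i j))))
       = (u ^ Suc K * v ^ Suc K) *\<^sub>c ((1 / u ^ K * (1 / v ^ K)) *\<^sub>c (P u (G k j) * P v (G i l) - P v (G k j) * P u (G i l)))"
      by simp
    moreover have "u ^ Suc K * v ^ Suc K * ((1/u - 1/v) * (1 / u ^ K * (1 / v ^ K))) = v - u"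
      "u ^ Suc K * v ^ Suc K * (1 / u ^ K * (1 / v ^ K)) = u * v" using that by (simp_all add: field_simps)
    ultimately have "(v - u) *\<^sub>c (P u (G i j) * P v (G k l) - P v (G k l) * P u (G i j))
       = (u * v) *\<^sub>c (P u (G k j) * P v (G i l) - P v (G k j) * P u (G i l))"
      by (simp add: scale_scale)
    then show ?thesis
      unfolding P_mult[of u _ v] P_mult'[of v _ u] A_def B_def
      by (simp only: sum_subtractf scale_diff_right)
  qed
  \<comment> \<open>Coefficient of u^r v^s in (v - u) A(u,v) - u v B(u,v); the tests for index 0
    account for the shifts by one.\<close>
  define c where "c r s = (if s = 0 then 0 else A r (s - 1)) - (if r = 0 then 0 else A (r - 1) s)
     - (if r = 0 then 0 else if s = 0 then 0 else B (r - 1) (s - 1))" for r s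
  have zero: "(\<Sum>r\<le>Suc K. \<Sum>s\<le>Suc K. (u ^ r * v ^ s) *\<^sub>c c r s) = 0" if uv: "u \<noteq> 0" "v \<noteq> 0" for u v
  proof -
    have "(\<Sum>r\<le>Suc K. \<Sum>s\<le>Suc K. (u ^ r * v ^ s) *\<^sub>c c r s) =
        (\<Sum>r\<le>Suc K. u ^ r *\<^sub>c (\<Sum>s\<le>Suc K. v ^ s *\<^sub>c (if s = 0 then 0 else A r (s - 1))))
      - (\<Sum>r\<le>Suc K. u ^ r *\<^sub>c (if r = 0 then 0 else (\<Sum>s\<le>Suc K. v ^ s *\<^sub>c A (r - 1) s)))
      - (\<Sum>r\<le>Suc K. u ^ r *\<^sub>c (if r = 0 then 0 else (\<Sum>s\<le>Suc K. v ^ s *\<^sub>c (if s = 0 then 0 else B (r - 1) (s - 1)))))"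
      unfolding sum_subtractf[symmetric] scale_diff_right[symmetric]
      by (intro sum.cong refl)
         (simp only: c_def scale_sum_right scale_scale scale_diff_right sum_subtractf split: if_split, simp add: scale_zero_right)
    also have "\<dots> = v *\<^sub>c (\<Sum>r\<le>K. \<Sum>s\<le>K. (u ^ r * v ^ s) *\<^sub>c A r s)
       - u *\<^sub>c (\<Sum>r\<le>K. \<Sum>s\<le>K. (u ^ r * v ^ s) *\<^sub>c A r s) - (u * v) *\<^sub>c (\<Sum>r\<le>K. \<Sum>s\<le>K. (u ^ r * v ^ s) *\<^sub>c B r s)"
      unfolding poly_shift[where K=K and u=v] poly_shift[where K=K and u=u and f="\<lambda>r. \<Sum>s\<le>Suc K. v ^ s *\<^sub>c A r s"]
        poly_shift[where K=K and u=u and f="\<lambda>r. v *\<^sub>c (\<Sum>s\<le>K. v ^ s *\<^sub>c B r s)"]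
      by (simp add: Atop scale_zero_right scale_sum_right scale_scale mult_ac)
    also have "\<dots> = 0" using key[OF uv] by (simp add: scale_diff_left)
    finally show ?thesis .
  qed
  have "c (Suc r) (Suc s) = 0"
  proof (cases "r \<le> K \<and> s \<le> K")
    case True
    have "infinite (- {0 :: complex})" using infinite_UNIV_char_0 by (simp add: Compl_eq_Diff_UNIV)
    then show ?thesis
      using endo_poly2_zero[where S = "- {0}" and T = "\<lambda>_. - {0}" and n = "Suc K" and c = c and r = "Suc r" and s = "Suc s"] zero True by auto
  qed (auto simp: c_def Atop Btop)
  then show "fps_nth (G i j) (Suc r) * fps_nth (G k l) s - fps_nth (G k l) s * fps_nth (G i j) (Suc r)
     - (fps_nth (G i j) r * fps_nth (G k l) (Suc s) - fps_nth (G k l) (Suc s) * fps_nth (G i j) r)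
     = fps_nth (G k j) r * fps_nth (G i l) s - fps_nth (G k j) s * fps_nth (G i l) r"
    by (simp add: c_def A_def B_def)
qed

text \<open>Twisting by the automorphism $t(u) \mapsto \lambda(u) t(u)$ with $\lambda(u) = (1 - \mu u^{-1})^{-1}$.\<close>

primrec twist :: "complex \<Rightarrow> (nat \<Rightarrow> 'a gmat) \<Rightarrow> nat \<Rightarrow> 'a gmat" where
  "twist \<mu> t 0 = t 0"
| "twist \<mu> t (Suc r) = (\<lambda>i j. t (Suc r) i j + \<mu> *\<^sub>c twist \<mu> t r i j)"

text \<open>The relation is quadratic in the generators: with generating variables x and y, (1 -
  \<mu> x)(1 - \<mu> y) times the defect \<open>R\<close> of the twisted generators is the defect of
  \<open>t\<close>, which vanishes. So \<open>R\<close> satisfies a homogeneous recursion. The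
  boundary cases use that the generators of degree 0 are scalars.\<close>

lemma yangian_rel_twist:
  assumes t: "yangian_rel t" and t0: "\<And>i j. i \<in> {-1,1} \<Longrightarrow> j \<in> {-1,1} \<Longrightarrow> t 0 i j = (if i = j then 1 else 0)"
  shows "yangian_rel (twist \<mu> t)"
  unfolding yangian_rel_def
proof (intro ballI allI)
  fix i j k l :: int and r s
  assume ijkl: "i \<in> {-1,1}" "j \<in> {-1,1}" "k \<in> {-1,1}" "l \<in> {-1,1}"
  define t' where "t' = twist \<mu> t"
  define R where "R r s = (t' (Suc r) i j * t' s k l - t' s k l * t' (Suc r) i j) - (t' r i j * t' (Suc s) k l - t' (Suc s) k l * t' r i j)
       - (t' r k j * t' s i l - t' s k j * t' r i l)" for r s
  have t'0: "t' 0 i j = (if i = j then 1 else 0)" "t' 0 k l = (if k = l then 1 else 0)"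
    "t' 0 k j = (if k = j then 1 else 0)" "t' 0 i l = (if i = l then 1 else 0)"
    using ijkl by (simp_all only: t'_def twist.simps t0)
  have tS: "t (Suc r) p q = t' (Suc r) p q - \<mu> *\<^sub>c t' r p q" for r p q by (simp add: t'_def)
  have t0': "t 0 p q = t' 0 p q" for p q by (simp add: t'_def)
  have rel: "(t (Suc r) i j * t s k l - t s k l * t (Suc r) i j) - (t r i j * t (Suc s) k l - t (Suc s) k l * t r i j)
       - (t r k j * t s i l - t s k j * t r i l) = 0" for r s
    by (simp add: yangian_relD[OF t ijkl])
  have R00: "R 0 0 = 0"
    using rel[of 0 0] unfolding R_def tS t0'
    by (cases "i = j"; cases "k = j"; cases "i = l"; cases "k = l"; use t'0 in \<open>simp add: algebra_simps scale_simps scale_zero_right\<close>)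
  have R0S: "R 0 (Suc s) = \<mu> *\<^sub>c R 0 s" for s
    using rel[of 0 "Suc s"] unfolding R_def tS t0'
    by (cases "i = j"; cases "k = j"; cases "i = l"; cases "k = l"; use t'0 in \<open>simp add: algebra_simps scale_simps scale_zero_right\<close>)
  have RS0: "R (Suc r) 0 = \<mu> *\<^sub>c R r 0" for r
    using rel[of "Suc r" 0] unfolding R_def tS t0'
    by (cases "i = j"; cases "k = j"; cases "i = l"; cases "k = l"; use t'0 in \<open>simp add: algebra_simps scale_simps scale_zero_right\<close>)
  have RSS: "R (Suc r) (Suc s) = \<mu> *\<^sub>c R r (Suc s) + \<mu> *\<^sub>c R (Suc r) s - (\<mu> * \<mu>) *\<^sub>c R r s" for r s
    using rel[of "Suc r" "Suc s"] unfolding R_def tS by (simp add: algebra_simps scale_simps)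
  have R0: "R 0 s = 0" for s by (induction s) (simp_all add: R00 R0S scale_zero_right)
  have "\<forall>s. R r s = 0"
  proof (induction r)
    case (Suc r)
    have "R (Suc r) s = 0" for s
      by (induction s) (use Suc in \<open>simp_all add: RS0 RSS scale_zero_right\<close>)
    then show ?case ..
  qed (simp add: R0)
  then have "R r s = 0" by blast
  then show "(twist \<mu> t (Suc r) i j * twist \<mu> t s k l - twist \<mu> t s k l * twist \<mu> t (Suc r) i j)
     - (twist \<mu> t r i j * twist \<mu> t (Suc s) k l - twist \<mu> t (Suc s) k l * twist \<mu> t r i j)
       = twist \<mu> t r k j * twist \<mu> t s i l - twist \<mu> t s k j * twist \<mu> t r i l"
    unfolding R_def t'_def by simp
qed

section \<open>Words in the generators\<close>

definition fa_eval :: "('g \<Rightarrow> 'a endo) \<Rightarrow> 'g fa \<Rightarrow> 'a endo" where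
  "fa_eval t P = (\<Sum>w\<in>{w. P w \<noteq> 0}. P w *\<^sub>c prod_list (map t w))"

lemma fa_eval_superset:
  assumes "finite S" "{w. P w \<noteq> 0} \<subseteq> S"
  shows "fa_eval t P = (\<Sum>w\<in>S. P w *\<^sub>c prod_list (map t w))"
  unfolding fa_eval_def by (rule sum.mono_neutral_left) (use assms in \<open>auto simp: scale_zero_left\<close>)

lemma fa_fin_subset: "fa_fin p \<Longrightarrow> (\<And>w. q w \<noteq> 0 \<Longrightarrow> p w \<noteq> 0) \<Longrightarrow> fa_fin q"
  unfolding fa_fin_def by (rule finite_subset[of _ "{w. p w \<noteq> 0}"]) auto

lemma fa_fin_add: "fa_fin p \<Longrightarrow> fa_fin q \<Longrightarrow> fa_fin (fa_add p q)"
  unfolding fa_fin_def fa_add_def by (rule finite_subset[of _ "{w. p w \<noteq> 0} \<union> {w. q w \<noteq> 0}"]) auto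

lemma fa_fin_sub: "fa_fin p \<Longrightarrow> fa_fin q \<Longrightarrow> fa_fin (fa_sub p q)"
  unfolding fa_fin_def fa_sub_def by (rule finite_subset[of _ "{w. p w \<noteq> 0} \<union> {w. q w \<noteq> 0}"]) auto

lemma fa_fin_smult: "fa_fin p \<Longrightarrow> fa_fin (fa_smult c p)"
  by (rule fa_fin_subset) (auto simp: fa_smult_def)

lemma fa_mul_support:
  "{w. fa_mul p q w \<noteq> 0} \<subseteq> (\<lambda>(x, y). x @ y) ` ({w. p w \<noteq> 0} \<times> {w. q w \<noteq> 0})"
proof
  fix w assume "w \<in> {w. fa_mul p q w \<noteq> 0}"
  then have "\<exists>i\<in>{..length w}. p (take i w) * q (drop i w) \<noteq> 0"
    unfolding fa_mul_def by (metis (mono_tags, lifting) mem_Collect_eq sum.not_neutral_contains_not_neutral)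
  then obtain i where "p (take i w) \<noteq> 0" "q (drop i w) \<noteq> 0" by auto
  then show "w \<in> (\<lambda>(x, y). x @ y) ` ({w. p w \<noteq> 0} \<times> {w. q w \<noteq> 0})"
    by (intro image_eqI[of _ _ "(take i w, drop i w)"]) auto
qed

lemma fa_fin_mul: "fa_fin p \<Longrightarrow> fa_fin q \<Longrightarrow> fa_fin (fa_mul p q)"
  unfolding fa_fin_def by (rule finite_subset[OF fa_mul_support]) auto

lemma fa_fin_one: "fa_fin fa_one" and fa_fin_zero: "fa_fin fa_zero" and fa_fin_gen: "fa_fin (fa_gen g)"
  by (simp_all add: fa_fin_def fa_one_def fa_zero_def fa_gen_def)

lemma fa_fin_prod: "(\<And>x. x \<in> set xs \<Longrightarrow> fa_fin x) \<Longrightarrow> fa_fin (fa_prod xs)"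
  unfolding fa_prod_def by (induction xs) (auto intro: fa_fin_one fa_fin_mul)

lemma fa_fin_sum: "finite S \<Longrightarrow> (\<And>x. x \<in> S \<Longrightarrow> fa_fin (f x)) \<Longrightarrow> fa_fin (\<lambda>w. \<Sum>x\<in>S. f x w)"
proof (induction S rule: finite_induct)
  case empty
  then show ?case by (simp add: fa_fin_def)
next
  case (insert x S)
  then show ?case using fa_fin_add[of "f x" "\<lambda>w. \<Sum>x\<in>S. f x w"] by (simp add: fa_add_def)
qed

lemma fa_eval_add: "fa_fin p \<Longrightarrow> fa_fin q \<Longrightarrow> fa_eval t (fa_add p q) = fa_eval t p + fa_eval t q"
proof -
  assume "fa_fin p" "fa_fin q"
  then have f: "finite ({w. p w \<noteq> 0} \<union> {w. q w \<noteq> 0})" by (simp add: fa_fin_def)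
  show ?thesis
    by (subst (1 2 3) fa_eval_superset[OF f]) (auto simp: fa_add_def scale_add_left sum.distrib)
qed

lemma fa_eval_smult: "fa_fin p \<Longrightarrow> fa_eval t (fa_smult c p) = c *\<^sub>c fa_eval t p"
proof -
  assume "fa_fin p"
  then have f: "finite {w. p w \<noteq> 0}" by (simp add: fa_fin_def)
  show ?thesis
    by (subst (1 2) fa_eval_superset[OF f]) (auto simp: fa_smult_def scale_scale scale_sum_right)
qed

lemma fa_eval_sub: "fa_fin p \<Longrightarrow> fa_fin q \<Longrightarrow> fa_eval t (fa_sub p q) = fa_eval t p - fa_eval t q"
proof -
  assume pq: "fa_fin p" "fa_fin q"
  have "fa_sub p q = fa_add p (fa_smult (-1) q)" by (simp add: fa_sub_def fa_add_def fa_smult_def)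
  then show ?thesis using pq by (simp add: fa_eval_add fa_eval_smult fa_fin_smult scale_minus_left scale_one)
qed

lemma fa_eval_sum: "finite S \<Longrightarrow> (\<And>x. x \<in> S \<Longrightarrow> fa_fin (f x)) \<Longrightarrow> fa_eval t (\<lambda>w. \<Sum>x\<in>S. f x w) = (\<Sum>x\<in>S. fa_eval t (f x))"
proof (induction S rule: finite_induct)
  case empty
  then show ?case by (simp add: fa_eval_def)
next
  case (insert x S)
  then show ?case using fa_eval_add[of "f x" "\<lambda>w. \<Sum>x\<in>S. f x w" t] fa_fin_sum[of S f] by (simp add: fa_add_def)
qed

lemma fa_eval_one: "fa_eval t fa_one = 1" and fa_eval_zero: "fa_eval t fa_zero = 0" and fa_eval_gen: "fa_eval t (fa_gen g) = t g"
  by (simp_all add: fa_eval_def fa_one_def fa_zero_def fa_gen_def scale_one)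

lemma fa_eval_mul:
  assumes "fa_fin p" "fa_fin q"
  shows "fa_eval t (fa_mul p q) = fa_eval t p * fa_eval t q"
proof -
  define P where "P = {w. p w \<noteq> 0}"
  define Q where "Q = {w. q w \<noteq> 0}"
  define S where "S = (\<lambda>(x, y). x @ y) ` (P \<times> Q)"
  have fin: "finite P" "finite Q" "finite S" using assms by (auto simp: P_def Q_def S_def fa_fin_def)
  have "fa_eval t (fa_mul p q) = (\<Sum>w\<in>S. fa_mul p q w *\<^sub>c prod_list (map t w))"
    by (rule fa_eval_superset[OF fin(3)]) (use fa_mul_support in \<open>auto simp: S_def P_def Q_def\<close>)
  also have "\<dots> = (\<Sum>w\<in>S. \<Sum>i\<le>length w. (p (take i w) * q (drop i w)) *\<^sub>c (prod_list (map t (take i w)) * prod_list (map t (drop i w))))"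
    unfolding fa_mul_def scale_sum_left
    by (intro sum.cong refl) (simp flip: prod_list.append map_append)
  also have "\<dots> = (\<Sum>(w, i)\<in>(SIGMA w:S. {..length w}). (p (take i w) * q (drop i w)) *\<^sub>c (prod_list (map t (take i w)) * prod_list (map t (drop i w))))"
    by (rule sum.Sigma) (use fin in auto)
  also have "\<dots> = (\<Sum>(x, y)\<in>P \<times> Q. (p x * q y) *\<^sub>c (prod_list (map t x) * prod_list (map t y)))"
  \<comment> \<open>A word with a split point corresponds to the pair of its parts.
    \<open>S'\<close> collects the splits whose parts do not both lie in the supports; they
    contribute 0 and have no partner among the pairs.\<close>
  proof (rule sum.reindex_bij_witness_not_neutral[where T'="{}" and i="\<lambda>(x, y). (x @ y, length x)"
          and j="\<lambda>(w, i). (take i w, drop i w)"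
          and S'="{(w, i). w \<in> S \<and> i \<le> length w \<and> p (take i w) * q (drop i w) = 0}"])
    show "finite {(w, i). w \<in> S \<and> i \<le> length w \<and> p (take i w) * q (drop i w) = 0}"
      by (rule finite_subset[of _ "SIGMA w:S. {..length w}"]) (use fin in auto)
    have "x @ y \<in> S" if "p x \<noteq> 0" "q y \<noteq> 0" for x y using that by (auto simp: S_def P_def Q_def)
    then show "(case b of (x, y) \<Rightarrow> (x @ y, length x)) \<in> (SIGMA w:S. {..length w}) - {(w, i). w \<in> S \<and> i \<le> length w \<and> p (take i w) * q (drop i w) = 0}"
      if "b \<in> P \<times> Q - {}" for b
      using that by (auto simp: P_def Q_def)
  qed (auto simp: P_def Q_def scale_zero_left)
  also have "\<dots> = fa_eval t p * fa_eval t q"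
    unfolding fa_eval_def sum_product sum.cartesian_product P_def Q_def
    by (intro sum.cong refl) (auto simp: scale_mult_left scale_mult_right scale_scale mult.commute[where 'a=complex])
  finally show ?thesis .
qed

lemma fa_eval_prod: "(\<And>x. x \<in> set xs \<Longrightarrow> fa_fin x) \<Longrightarrow> fa_eval t (fa_prod xs) = prod_list (map (fa_eval t) xs)"
proof (induction xs)
  case (Cons x xs)
  then show ?case using fa_eval_mul[of x "fa_prod xs" t] fa_fin_prod[of xs] by (simp add: fa_prod_def)
qed (simp add: fa_prod_def fa_eval_one)

lemma fa_eval_comm: "fa_fin p \<Longrightarrow> fa_fin q \<Longrightarrow> fa_eval t (fa_comm p q) = fa_eval t p * fa_eval t q - fa_eval t q * fa_eval t p"
  by (simp add: fa_comm_def fa_eval_sub fa_fin_mul fa_eval_mul)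

lemma fa_fin_comm: "fa_fin p \<Longrightarrow> fa_fin q \<Longrightarrow> fa_fin (fa_comm p q)"
  by (simp add: fa_comm_def fa_fin_sub fa_fin_mul)

lemma fa_fin_tser: "fa_fin (tser r i j)"
  by (simp add: tser_def fa_fin_one fa_fin_zero fa_fin_gen)

lemma fa_fin_yrel: "fa_fin (yrel r s i j k l)"
  by (simp add: yrel_def fa_fin_sub fa_fin_comm fa_fin_mul fa_fin_tser)

lemma fa_fin_s_fa: "fa_fin (s_fa spc M i j)"
  unfolding s_fa_def
  by (intro fa_fin_sum fa_fin_smult[unfolded fa_smult_def] fa_fin_mul fa_fin_tser) auto

lemma fa_fin_s_subst: "s_poly P \<Longrightarrow> fa_fin (s_subst spc P)"
  unfolding s_subst_def
  by (intro fa_fin_sum fa_fin_smult[unfolded fa_smult_def] fa_fin_prod) (auto simp: s_poly_def fa_fin_def fa_fin_s_fa[unfolded fa_fin_def])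

definition yangian_rep :: "(nat \<Rightarrow> 'a gmat) \<Rightarrow> bool" where
  "yangian_rep t \<longleftrightarrow> yangian_rel t \<and> (\<forall>i\<in>{-1,1}. \<forall>j\<in>{-1,1}. t 0 i j = (if i = j then 1 else 0))"

definition yeval :: "(nat \<Rightarrow> 'a gmat) \<Rightarrow> ygen fa \<Rightarrow> 'a endo" where
  "yeval t = fa_eval (\<lambda>(r, i, j). t r i j)"

lemma yeval_tser: "yangian_rep t \<Longrightarrow> i \<in> {-1,1} \<Longrightarrow> j \<in> {-1,1} \<Longrightarrow> yeval t (tser r i j) = t r i j"
  by (auto simp: yeval_def tser_def fa_eval_one fa_eval_zero fa_eval_gen yangian_rep_def)

text \<open>Finite support is part of the induction because the rules for \<open>fa_eval\<close> on
  sums and products hold for finitely supported elements.\<close>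

lemma yeval_yideal:
  assumes t: "yangian_rep t"
  shows "p \<in> yideal \<Longrightarrow> fa_fin p \<and> yeval t p = 0"
proof (induction rule: yideal.induct)
  case (rel i j k l r s)
  have "yeval t (yrel r s i j k l) = (t (Suc r) i j * t s k l - t s k l * t (Suc r) i j) - (t r i j * t (Suc s) k l - t (Suc s) k l * t r i j)
       - (t r k j * t s i l - t s k j * t r i l)"
    using yeval_tser[OF t] rel unfolding yeval_def yrel_def
    by (simp add: fa_eval_sub fa_eval_comm fa_eval_mul fa_fin_sub fa_fin_comm fa_fin_mul fa_fin_tser)
  with yangian_relD[of t i j k l r s] t rel show ?case by (simp add: fa_fin_yrel yangian_rep_def)
qed (auto simp: yeval_def fa_eval_add fa_eval_smult fa_eval_mul fa_fin_add fa_fin_smult fa_fin_mul scale_zero_right)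

definition sop :: "bool \<Rightarrow> (nat \<Rightarrow> 'a gmat) \<Rightarrow> sgen \<Rightarrow> 'a endo" where
  "sop spc t = (\<lambda>(M, i, j). \<Sum>a\<in>{-1,1}. \<Sum>r\<le>M. (theta spc a j * (-1) ^ (M - r)) *\<^sub>c (t r i a * t (M - r) (- j) (- a)))"

lemma yeval_s_fa:
  assumes t: "yangian_rep t" and ij: "i \<in> {-1,1}" "j \<in> {-1,1}"
  shows "yeval t (s_fa spc M i j) = sop spc t (M, i, j)"
proof -
  have "s_fa spc M i j = (\<lambda>w. \<Sum>a\<in>{-1,1}. (\<lambda>w. \<Sum>r\<le>M. fa_smult (theta spc a j * (-1) ^ (M - r)) (fa_mul (tser r i a) (tser (M - r) (- j) (- a))) w) w)"
    by (simp add: s_fa_def fa_smult_def)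
  then have "yeval t (s_fa spc M i j) = yeval t \<dots>" by (rule arg_cong)
  also have "\<dots> = sop spc t (M, i, j)"
    unfolding yeval_def
  proof (subst fa_eval_sum)
    show "fa_fin (\<lambda>w. \<Sum>r\<le>M. fa_smult (theta spc a j * (-1) ^ (M - r)) (fa_mul (tser r i a) (tser (M - r) (- j) (- a))) w)" for a
      by (intro fa_fin_sum fa_fin_smult fa_fin_mul fa_fin_tser) simp
    have "fa_eval (\<lambda>(r, i, j). t r i j) (\<lambda>w. \<Sum>r\<le>M. fa_smult (theta spc a j * (-1) ^ (M - r)) (fa_mul (tser r i a) (tser (M - r) (- j) (- a))) w)
       = (\<Sum>r\<le>M. (theta spc a j * (-1) ^ (M - r)) *\<^sub>c (t r i a * t (M - r) (- j) (- a)))" if a: "a \<in> {-1,1}" for a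
    proof (subst fa_eval_sum)
      have "- j \<in> {-1,1}" "- a \<in> {-1,1}" using ij a by auto
      then show "(\<Sum>r\<le>M. fa_eval (\<lambda>(r, i, j). t r i j) (fa_smult (theta spc a j * (-1) ^ (M - r)) (fa_mul (tser r i a) (tser (M - r) (- j) (- a)))))
         = (\<Sum>r\<le>M. (theta spc a j * (-1) ^ (M - r)) *\<^sub>c (t r i a * t (M - r) (- j) (- a)))"
        by (intro sum.cong refl)
          (use ij a yeval_tser[OF t, unfolded yeval_def] in \<open>simp only: fa_eval_smult fa_eval_mul fa_fin_mul fa_fin_tser\<close>)
    qed (auto intro: fa_fin_smult fa_fin_mul fa_fin_tser)
    then show "(\<Sum>a\<in>{-1,1}. fa_eval (\<lambda>(r, i, j). t r i j) (\<lambda>w. \<Sum>r\<le>M. fa_smult (theta spc a j * (-1) ^ (M - r)) (fa_mul (tser r i a) (tser (M - r) (- j) (- a))) w))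
       = sop spc t (M, i, j)"
      unfolding sop_def by simp
  qed simp
  finally show ?thesis .
qed

text \<open>In an \<open>s_poly\<close> all indices lie in {-1,1}, the range on which
  \<open>yangian_rep\<close> normalises degree 0 and \<open>tser\<close> evaluates to
  \<open>t\<close>.\<close>

lemma yeval_s_subst:
  assumes t: "yangian_rep t" and P: "s_poly P"
  shows "yeval t (s_subst spc P) = fa_eval (sop spc t) P"
proof -
  have fin: "finite {w. P w \<noteq> 0}" using P by (simp add: s_poly_def fa_fin_def)
  have "s_subst spc P = (\<lambda>v. \<Sum>w\<in>{w. P w \<noteq> 0}. fa_smult (P w) (fa_prod (map (\<lambda>(M, i, j). s_fa spc M i j) w)) v)"
    by (simp add: s_subst_def fa_smult_def)
  then have "yeval t (s_subst spc P) = yeval t \<dots>" by (rule arg_cong)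
  also have "\<dots> = (\<Sum>w\<in>{w. P w \<noteq> 0}. P w *\<^sub>c prod_list (map (\<lambda>(M, i, j). yeval t (s_fa spc M i j)) w))"
    unfolding yeval_def
  proof (subst fa_eval_sum[OF fin])
    have f: "fa_fin (fa_prod (map (\<lambda>(M, i, j). s_fa spc M i j) w))" for w
      by (rule fa_fin_prod) (auto simp: fa_fin_s_fa)
    then show "fa_fin (fa_smult (P w) (fa_prod (map (\<lambda>(M, i, j). s_fa spc M i j) w)))" for w
      by (rule fa_fin_smult)
    show "(\<Sum>w | P w \<noteq> 0. fa_eval (\<lambda>(r, i, j). t r i j) (fa_smult (P w) (fa_prod (map (\<lambda>(M, i, j). s_fa spc M i j) w)))) =
       (\<Sum>w | P w \<noteq> 0. P w *\<^sub>c prod_list (map (\<lambda>(M, i, j). fa_eval (\<lambda>(r, i, j). t r i j) (s_fa spc M i j)) w))"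
      by (intro sum.cong refl, subst fa_eval_smult[OF f], subst fa_eval_prod)
        (auto simp: fa_fin_s_fa o_def case_prod_unfold)
  qed
  also have "\<dots> = fa_eval (sop spc t) P"
  proof -
    have mp: "map (\<lambda>(M, i, j). yeval t (s_fa spc M i j)) w = map (sop spc t) w" if "P w \<noteq> 0" for w
    proof (rule map_cong[OF refl])
      fix g assume "g \<in> set w"
      then have "g \<in> sgens" using P that by (auto simp: s_poly_def)
      then show "(case g of (M, i, j) \<Rightarrow> yeval t (s_fa spc M i j)) = sop spc t g"
        using yeval_s_fa[OF t] by (auto simp: sgens_def)
    qed
    show ?thesis unfolding fa_eval_def
    proof (intro sum.cong refl)
      fix w assume "w \<in> {w. P w \<noteq> 0}"
      then have "P w \<noteq> 0" by simp
      from mp[OF this] show "P w *\<^sub>c (\<Prod>(M, i, j)\<leftarrow>w. yeval t (s_fa spc M i j)) = P w *\<^sub>c prod_list (map (sop spc t) w)"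
        by (rule arg_cong)
    qed
  qed
  finally show ?thesis .
qed

text \<open>A representation of Y(2) kills \<open>yideal\<close>, so a commutator lying there
  becomes 0; centrality is tested against the single generator \<open>fa_gen g\<close>.\<close>

lemma central_commutes:
  assumes t: "yangian_rep t" and P: "tw_central spc P" and g: "g \<in> sgens"
  shows "fa_eval (sop spc t) P * sop spc t g = sop spc t g * fa_eval (sop spc t) P"
proof -
  have P': "s_poly P" using P by (simp add: tw_central_def)
  have Q: "s_poly (fa_gen g)" using g by (auto simp: s_poly_def fa_fin_gen) (auto simp: fa_gen_def split: if_splits)
  from P Q have "fa_comm (s_subst spc P) (s_subst spc (fa_gen g)) \<in> yideal" by (simp add: tw_central_def)
  from yeval_yideal[OF t this]
  have "yeval t (s_subst spc P) * yeval t (s_subst spc (fa_gen g)) - yeval t (s_subst spc (fa_gen g)) * yeval t (s_subst spc P) = 0"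
    using fa_fin_s_subst[OF P'] fa_fin_s_subst[OF Q] by (simp add: yeval_def fa_eval_comm)
  then show ?thesis
    unfolding yeval_s_subst[OF t P'] yeval_s_subst[OF t Q] by (simp add: fa_eval_gen)
qed

section \<open>Highest weight operators\<close>

text \<open>Operators act on functions of all exponent vectors, so that each tensor factor is a full Verma
module; the finite-dimensional modules are recovered from the rows indexed by \<open>I\<close>, in which
only columns from \<open>I\<close> occur. No truncation has to be respected when checking relations.\<close>

type_synonym xidx = "nat \<times> (nat \<Rightarrow> nat)"

text \<open>\<open>app X \<phi> x\<close> is row x of X applied to the column \<phi>, and the
  coefficients are those of \<open>Efac\<close> with n = a - b. The factor a - b - p vanishes at the
  last exponent, so rows of the finite-dimensional module never reach beyond it. The weights depend
  on \<sigma> in order to treat U and U' at once.\<close>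

lift_definition glop :: "(nat \<Rightarrow> complex) \<Rightarrow> (nat \<Rightarrow> complex) \<Rightarrow> nat \<Rightarrow> xidx gmat" is
  "\<lambda>a b m i j \<phi> x. case x of (\<sigma>, p) \<Rightarrow>
     if i = 1 \<and> j = 1 then (a \<sigma> - of_nat (p m)) * \<phi> (\<sigma>, p)
     else if i = -1 \<and> j = -1 then (b \<sigma> + of_nat (p m)) * \<phi> (\<sigma>, p)
     else if i = 1 \<and> j = -1 then of_nat (Suc (p m)) * (a \<sigma> - b \<sigma> - of_nat (p m)) * \<phi> (\<sigma>, p(m := Suc (p m)))
     else if i = -1 \<and> j = 1 then (if p m = 0 then 0 else \<phi> (\<sigma>, p(m := p m - 1)))
     else 0"
  by (auto simp: fun_eq_iff algebra_simps)

lemma app_glop: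
  "app (glop a b m 1 1) \<phi> (\<sigma>, p) = (a \<sigma> - of_nat (p m)) * \<phi> (\<sigma>, p)"
  "app (glop a b m (-1) (-1)) \<phi> (\<sigma>, p) = (b \<sigma> + of_nat (p m)) * \<phi> (\<sigma>, p)"
  "app (glop a b m 1 (-1)) \<phi> (\<sigma>, p) = of_nat (Suc (p m)) * (a \<sigma> - b \<sigma> - of_nat (p m)) * \<phi> (\<sigma>, p(m := Suc (p m)))"
  "app (glop a b m (-1) 1) \<phi> (\<sigma>, p) = (if p m = 0 then 0 else \<phi> (\<sigma>, p(m := p m - 1)))"
  by (simp_all add: glop.rep_eq)

lemma gl2_rel_glop: "gl2_rel (glop a b m)"
proof -
  have core: "\<forall>i\<in>{-1,1}. \<forall>j\<in>{-1,1}. \<forall>k\<in>{-1,1}. \<forall>l\<in>{-1,1}.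
     app (glop a b m i j * glop a b m k l - glop a b m k l * glop a b m i j) \<phi> (\<sigma>, p)
     = app ((if k = j then glop a b m i l else 0) - (if i = l then glop a b m k j else 0)) \<phi> (\<sigma>, p)" for \<phi> \<sigma> p
  proof (cases "p m")
    case 0
    have upd: "p(m := 0) = p" by (rule fun_upd_idem) (rule 0)
    show ?thesis
      by (intro ballI; elim insertE emptyE; hypsubst; simp add: app_simps app_glop 0 upd; simp add: algebra_simps)
  next
    case (Suc n)
    have upd: "p(m := Suc n) = p" by (rule fun_upd_idem) (rule Suc)
    show ?thesis
      by (intro ballI; elim insertE emptyE; hypsubst; simp add: app_simps app_glop Suc upd; simp add: algebra_simps)
  qed
  show ?thesis
    unfolding gl2_rel_def
  proof (intro ballI endo_eqI)
    fix i j k l :: int and \<phi> and x :: xidx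
    assume ijkl: "i \<in> {-1,1}" "j \<in> {-1,1}" "k \<in> {-1,1}" "l \<in> {-1,1}"
    with core[of \<phi> "fst x" "snd x"]
    show "app (glop a b m i j * glop a b m k l - glop a b m k l * glop a b m i j) \<phi> x
      = app ((if k = j then glop a b m i l else 0) - (if i = l then glop a b m k j else 0)) \<phi> x"
      unfolding prod.collapse by blast
  qed
qed

lemma glop_outside: "\<not> (i \<in> {-1,1} \<and> j \<in> {-1,1}) \<Longrightarrow> glop a b m i j = 0"
proof (rule endo_eqI)
  fix \<phi> and x :: xidx
  assume "\<not> (i \<in> {-1,1} \<and> j \<in> {-1,1})"
  then have "(i = 1 \<and> j = 1) = False" "(i = -1 \<and> j = -1) = False" "(i = 1 \<and> j = -1) = False" "(i = -1 \<and> j = 1) = False"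
    by auto
  then show "app (glop a b m i j) \<phi> x = app 0 \<phi> x"
    by (simp only: glop.rep_eq zero_endo.rep_eq if_False case_prod_beta)
qed

lemma glop_commute:
  assumes "m \<noteq> m'"
  shows "glop a b m i j * glop a' b' m' k l = glop a' b' m' k l * glop a b m i j"
proof -
  have core: "\<forall>i\<in>{-1,1}. \<forall>j\<in>{-1,1}. \<forall>k\<in>{-1,1}. \<forall>l\<in>{-1,1}.
    app (glop a b m i j * glop a' b' m' k l) \<phi> (\<sigma>, p) = app (glop a' b' m' k l * glop a b m i j) \<phi> (\<sigma>, p)" for \<phi> \<sigma> p
  proof -
    have tw: "p(m := u, m' := v) = p(m' := v, m := u)" for u v by (rule fun_upd_twist[OF assms])
    show ?thesis
      by (intro ballI; elim insertE emptyE; hypsubst; simp add: app_simps app_glop tw assms assms[symmetric])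
  qed
  show ?thesis
  proof (cases "(i \<in> {-1,1} \<and> j \<in> {-1,1}) \<and> (k \<in> {-1,1} \<and> l \<in> {-1,1})")
    case True
    show ?thesis
    proof (rule endo_eqI)
      fix \<phi> and x :: xidx
      from core[of \<phi> "fst x" "snd x"] True
      show "app (glop a b m i j * glop a' b' m' k l) \<phi> x = app (glop a' b' m' k l * glop a b m i j) \<phi> x"
        unfolding prod.collapse by blast
    qed
  next
    case False
    then show ?thesis using glop_outside by (metis mult_zero_left mult_zero_right)
  qed
qed

lemma gl2_rel_0: "gl2_rel (\<lambda>i j. 0)"
  by (simp add: gl2_rel_def)

section \<open>The module M(z) inside the rows of these operators\<close>

locale multiplicity_space =
  fixes spc :: bool and k :: nat and lam mu :: "nat \<Rightarrow> real"
  assumes k: "k \<ge> 1" and dom_lam: "dominant spc k lam" and dom_mu: "dominant spc (k - 1) mu" and occ: "occurs k lam mu"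
begin

abbreviation I where "I \<equiv> Ix spc k lam mu"
abbreviation fa where "fa \<sigma> m \<equiv> fst (fac_ab spc k lam mu \<sigma> m)"
abbreviation fb where "fb \<sigma> m \<equiv> snd (fac_ab spc k lam mu \<sigma> m)"
abbreviation dims where "dims \<equiv> fdim spc k lam mu"

definition emb :: "idx \<Rightarrow> xidx" where
  "emb = (\<lambda>(\<sigma>, p). (\<sigma>, \<lambda>m. if m < k then p ! m else 0))"

text \<open>Slot \<open>k\<close> carries the Verma module of highest weight $(1/2, 1-\delta)$; its row with
exponent 0 yields $W(\delta)$ after the twist \<open>tw\<close> below.\<close>

definition E0 :: "nat \<Rightarrow> xidx gmat" where
  "E0 m = (if m < k then glop (\<lambda>\<sigma>. of_real (fa \<sigma> m)) (\<lambda>\<sigma>. of_real (fb \<sigma> m)) m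
     else if m = k \<and> \<not> spc then glop (\<lambda>\<sigma>. 1/2) (\<lambda>\<sigma>. 1 - of_real (deltaW lam \<sigma>)) m
     else (\<lambda>i j. 0))"

lemma gl2_rel_E0: "gl2_rel (E0 m)"
  by (simp add: E0_def gl2_rel_glop gl2_rel_0)

lemma commuting_E0: "commuting_family E0"
  unfolding commuting_family_def E0_def by (auto intro: glop_commute)

lemma lam_mu_int:
  assumes "1 \<le> j" "j \<le> k"
  shows "lam j - lam 1 \<in> \<int>" "j < k \<Longrightarrow> mu j - lam 1 \<in> \<int>"
proof -
  have mem: "(1::nat) \<in> {1..k}" "j \<in> {1..k}" using k assms by auto
  consider "\<forall>j\<in>{1..k}. lam j \<in> \<int>" | "\<forall>j\<in>{1..k}. lam j - 1/2 \<in> \<int>"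
    using dom_lam unfolding dominant_def by (auto split: if_splits)
  then show "lam j - lam 1 \<in> \<int>"
  proof cases
    case 1
    then show ?thesis using mem by (intro Ints_diff) blast+
  next
    case 2
    then have "lam j - 1/2 \<in> \<int>" "lam 1 - 1/2 \<in> \<int>" using mem by blast+
    from Ints_diff[OF this] show ?thesis by simp
  qed
  show "mu j - lam 1 \<in> \<int>" if "j < k"
    using occ that assms unfolding occurs_def by auto
qed

text \<open>All components of \<lambda> and \<mu> are congruent to \<lambda>_1 modulo 1, so
  \<open>alpha\<close> and \<open>beta\<close> share the class of \<lambda>_1, shifted by 1/2 in the
  symplectic case. The fixed first weight of slot 0 is compared with this class by cases.\<close>

lemma fac_diff_int:
  assumes "m < k" "\<sigma> \<in> sigset spc"
  shows "fa \<sigma> m - fb \<sigma> m \<in> \<int>"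
proof -
  have beta: "lam 1 - beta spc k lam mu (Suc m) + (if spc then 1/2 else 0) \<in> \<int>"
  proof -
    have "(if Suc m = k then lam (Suc m) else max (lam (Suc m)) (mu (Suc m))) - lam 1 \<in> \<int>"
      using lam_mu_int[of "Suc m"] assms(1) by (auto simp: max_def)
    then have "- ((if Suc m = k then lam (Suc m) else max (lam (Suc m)) (mu (Suc m))) - lam 1) + real (Suc m) - (if spc then 0 else 1) \<in> \<int>"
      by (intro Ints_add Ints_diff) (auto simp only: Ints_minus Ints_of_nat Ints_0 Ints_1 split: if_split)
    then show ?thesis by (simp add: beta_def algebra_simps split: if_splits)
  qed
  show ?thesis
  proof (cases "m = 0")
    case True
    have half: "lam 1 + 1/2 \<in> \<int>" if "\<not> spc" "lam 1 \<notin> \<int>"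
    proof -
      have "lam 1 - 1/2 \<in> \<int>" using dom_lam that k unfolding dominant_def by auto
      then have "lam 1 - 1/2 + 1 \<in> \<int>" by (intro Ints_add) auto
      then show ?thesis by (simp add: add.commute)
    qed
    have int: "lam 1 \<in> \<int>" if spc using dom_lam that k unfolding dominant_def by auto
    have "fa \<sigma> m - fb \<sigma> m = (lam 1 - beta spc k lam mu (Suc m) + (if spc then 1/2 else 0)) +
       (if spc then - lam 1 - 1 else if lam 1 \<in> \<int> then (if \<sigma> = 0 then - lam 1 else - lam 1 - 1) else - (lam 1 + 1/2))"
      using True by (simp add: fac_ab_def)
    moreover have "(if spc then - lam 1 - 1 else if lam 1 \<in> \<int> then (if \<sigma> = 0 then - lam 1 else - lam 1 - 1) else - (lam 1 + 1/2)) \<in> \<int>"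
    proof (cases spc)
      case True
      then show ?thesis using Ints_diff[OF Ints_minus[OF int[OF True]] Ints_1] by simp
    next
      case False
      show ?thesis
      proof (cases "lam 1 \<in> \<int>")
        case True
        then show ?thesis using Ints_minus[OF True] Ints_diff[OF Ints_minus[OF True] Ints_1] False by simp
      next
        case f: False
        then show ?thesis using Ints_minus[OF half[OF False f]] False by simp
      qed
    qed
    ultimately show ?thesis using Ints_add[OF beta] by presburger
  next
    case False
    have "lam 1 - alpha spc lam mu (Suc m) + (if spc then 1/2 else 0) \<in> \<int>"
    proof -
      have "min (lam m) (mu m) - lam 1 \<in> \<int>"
        using lam_mu_int[of m] assms(1) False by (auto simp: min_def)
      then have "- (min (lam m) (mu m) - lam 1) + real (Suc m) - (if spc then 0 else 1) \<in> \<int>"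
        by (intro Ints_add Ints_diff) (auto simp only: Ints_minus Ints_of_nat Ints_0 Ints_1 split: if_split)
      then show ?thesis by (simp add: alpha_def algebra_simps split: if_splits)
    qed
    from Ints_diff[OF beta this] show ?thesis using False by (simp add: fac_ab_def)
  qed
qed

text \<open>For positive dimension the truncation by \<open>nat\<close> in \<open>fdim\<close> is
  invisible; a factor of dimension 0, as for U' = 0, leaves no basis index of that summand.\<close>

lemma dims_eq:
  assumes "m < k" "\<sigma> \<in> sigset spc" "dims \<sigma> m > 0"
  shows "of_real (fa \<sigma> m) - of_real (fb \<sigma> m) = (of_nat (dims \<sigma> m) - 1 :: complex)"
proof -
  obtain n where n: "fa \<sigma> m - fb \<sigma> m = of_int n" using fac_diff_int[OF assms(1,2)] Ints_cases by blast
  then have d: "dims \<sigma> m = nat (n + 1)" by (simp add: fdim_def)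
  then have "n + 1 > 0" using assms(3) by simp
  then have "(of_nat (dims \<sigma> m) :: complex) = of_int (n + 1)" unfolding d by simp
  moreover have "(of_real (fa \<sigma> m) - of_real (fb \<sigma> m) :: complex) = of_int n" by (simp flip: of_real_diff add: n)
  ultimately show ?thesis by simp
qed

lemma finite_I: "finite I"
proof -
  define D where "D = Max ((\<lambda>(\<sigma>, m). dims \<sigma> m) ` ({0,1} \<times> {..<k}))"
  have D: "dims \<sigma> m \<le> D" if "\<sigma> \<in> {0,1}" "m < k" for \<sigma> m
    unfolding D_def by (rule Max_ge) (use that in auto)
  have "I \<subseteq> {0,1} \<times> {p. set p \<subseteq> {..<D} \<and> length p = k}"
  proof
    fix x assume "x \<in> I"
    then obtain \<sigma> p where x: "x = (\<sigma>, p)" "\<sigma> \<in> {0,1}" "length p = k" "\<And>m. m < k \<Longrightarrow> p ! m < dims \<sigma> m"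
      by (auto simp: Ix_def sigset_def split: if_splits)
    have "p ! m < D" if "m < k" for m using x(4)[OF that] D[OF x(2) that] by simp
    then show "x \<in> {0,1} \<times> {p. set p \<subseteq> {..<D} \<and> length p = k}" using x by (auto simp: in_set_conv_nth)
  qed
  then show ?thesis by (rule finite_subset) (intro finite_SigmaI finite_lists_length_eq; simp)
qed

lemma emb_inj: "inj_on emb I"
proof (rule inj_onI)
  fix x y assume xy: "x \<in> I" "y \<in> I" "emb x = emb y"
  then have "snd x ! m = snd y ! m" if "m < k" for m
    using that by (auto simp: emb_def fun_eq_iff split: prod.splits) (metis that)
  with xy show "x = y" by (auto simp: emb_def Ix_def intro!: nth_equalityI split: prod.splits)
qed

text \<open>Rows in the image of \<open>emb\<close> involve only columns from that image. So the
  functions vanishing there form an invariant subspace of \<open>X\<close>, and \<open>A\<close> is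
  the action on the quotient; this makes \<open>rep\<close> compatible with products.\<close>

definition rep :: "Defs.mat \<Rightarrow> xidx endo \<Rightarrow> bool" where
  "rep A X \<longleftrightarrow> (\<forall>p\<in>I. \<forall>\<phi>. app X \<phi> (emb p) = (\<Sum>q\<in>I. A p q * \<phi> (emb q)))"

lemma rep_mid: "rep mid 1"
  using finite_I by (simp add: rep_def mid_def app_simps if_distrib[of "\<lambda>c. c * _"] cong: if_cong)

lemma rep_0: "rep mzero 0"
  by (simp add: rep_def mzero_def app_simps)

lemma rep_mult: "rep A X \<Longrightarrow> rep B Y \<Longrightarrow> rep (mmul I A B) (X * Y)"
proof -
  assume A: "rep A X" and B: "rep B Y"
  show "rep (mmul I A B) (X * Y)"
    unfolding rep_def
  proof (intro ballI allI)
    fix p \<phi> assume p: "p \<in> I"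
    have "app (X * Y) \<phi> (emb p) = (\<Sum>q\<in>I. A p q * (\<Sum>r\<in>I. B q r * \<phi> (emb r)))"
      using A B p by (simp add: app_simps rep_def)
    also have "\<dots> = (\<Sum>r\<in>I. (\<Sum>q\<in>I. A p q * B q r) * \<phi> (emb r))"
      by (simp add: sum_distrib_left sum_distrib_right mult.assoc) (rule sum.swap)
    finally show "app (X * Y) \<phi> (emb p) = (\<Sum>r\<in>I. mmul I A B p r * \<phi> (emb r))" by (simp add: mmul_def)
  qed
qed

lemma rep_add: "rep A X \<Longrightarrow> rep B Y \<Longrightarrow> rep (\<lambda>p q. A p q + B p q) (X + Y)"
  by (simp add: rep_def app_simps distrib_right sum.distrib)

lemma rep_scale: "rep A X \<Longrightarrow> rep (\<lambda>p q. c * A p q) (c *\<^sub>c X)"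
  by (simp add: rep_def app_scale sum_distrib_left mult.assoc)

lemma rep_sum: "(\<And>i. i \<in> S \<Longrightarrow> rep (A i) (X i)) \<Longrightarrow> rep (\<lambda>p q. \<Sum>i\<in>S. A i p q) (\<Sum>i\<in>S. X i)"
proof (induction S rule: infinite_finite_induct)
  case (insert x F)
  then show ?case using rep_add[of "A x" "X x" "\<lambda>p q. \<Sum>i\<in>F. A i p q" "\<Sum>i\<in>F. X i"] by simp
qed (use rep_0 in \<open>simp_all add: mzero_def\<close>)

lemma rep_entry:
  assumes "rep A X" "p \<in> I" "q \<in> I"
  shows "A p q = app X (\<lambda>x. if x = emb q then 1 else 0) (emb p)"
proof -
  have "app X (\<lambda>x. if x = emb q then 1 else 0) (emb p) = (\<Sum>q'\<in>I. A p q' * (if emb q' = emb q then 1 else 0))"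
    using assms unfolding rep_def by blast
  also have "\<dots> = (\<Sum>q'\<in>I. if q' = q then A p q else 0)"
    by (intro sum.cong refl) (use emb_inj assms(3) in \<open>auto dest: inj_onD\<close>)
  also have "\<dots> = A p q" using finite_I assms(3) by simp
  finally show ?thesis ..
qed

lemma rep_unique:
  assumes "rep A X" "rep B X" "p \<in> I" "q \<in> I"
  shows "A p q = B p q"
  using rep_entry[OF assms(1,3,4)] rep_entry[OF assms(2,3,4)] by simp

definition zx :: "(nat \<Rightarrow> complex) \<Rightarrow> nat \<Rightarrow> complex" where
  "zx z m = (if m < k then z (Suc m) else 0)"

abbreviation Ez where "Ez z \<equiv> shifted (zx z) E0"

lemma sum_Eop:
  assumes "(\<sigma>, p) \<in> I" "m < k"
  shows "(\<Sum>q\<in>I. Eop spc k lam mu z m i j (\<sigma>, p) q * \<phi> (emb q)) =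
    (\<Sum>y<dims \<sigma> m. Efac (of_real (fa \<sigma> m) + z (Suc m)) (of_real (fb \<sigma> m) + z (Suc m)) (dims \<sigma> m - 1) i j (p ! m) y
      * \<phi> (\<sigma>, (snd (emb (\<sigma>, p)))(m := y)))"
proof -
  define h where "h y = (\<sigma>, p[m := y])" for y
  have p: "length p = k" "\<sigma> \<in> sigset spc" "\<And>m. m < k \<Longrightarrow> p ! m < dims \<sigma> m" using assms(1) by (auto simp: Ix_def)
  have hI: "h y \<in> I" if "y < dims \<sigma> m" for y
    using that p assms(2) by (auto simp: h_def Ix_def nth_list_update)
  have emb_h: "emb (h y) = (\<sigma>, (snd (emb (\<sigma>, p)))(m := y))" for y
    using p(1) assms(2) by (auto simp: h_def emb_def fun_eq_iff nth_list_update)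
  have inj: "inj_on h {..<dims \<sigma> m}"
    using p(1) assms(2) by (auto simp: inj_on_def h_def) (metis nth_list_update_eq)
  have "(\<Sum>q\<in>I. Eop spc k lam mu z m i j (\<sigma>, p) q * \<phi> (emb q))
      = (\<Sum>q\<in>h ` {..<dims \<sigma> m}. Eop spc k lam mu z m i j (\<sigma>, p) q * \<phi> (emb q))"
  proof (rule sum.mono_neutral_right[OF finite_I])
    show "h ` {..<dims \<sigma> m} \<subseteq> I" using hI by auto
    show "\<forall>q\<in>I - h ` {..<dims \<sigma> m}. Eop spc k lam mu z m i j (\<sigma>, p) q * \<phi> (emb q) = 0"
    proof
      fix q assume q: "q \<in> I - h ` {..<dims \<sigma> m}"
      obtain \<sigma>' q' where q': "q = (\<sigma>', q')" by force
      have "\<not> (\<sigma> = \<sigma>' \<and> (\<forall>l<k. l \<noteq> m \<longrightarrow> p ! l = q' ! l))"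
      proof
        assume c: "\<sigma> = \<sigma>' \<and> (\<forall>l<k. l \<noteq> m \<longrightarrow> p ! l = q' ! l)"
        have "length q' = k" "q' ! m < dims \<sigma> m" using q q' c assms(2) by (auto simp: Ix_def)
        then have "q = h (q' ! m)" unfolding h_def q' using c p(1) assms(2)
          by (auto intro!: nth_equalityI simp: nth_list_update)
        with \<open>q' ! m < dims \<sigma> m\<close> q show False by blast
      qed
      then show "Eop spc k lam mu z m i j (\<sigma>, p) q * \<phi> (emb q) = 0" by (auto simp: Eop_def q')
    qed
  qed
  also have "\<dots> = (\<Sum>y<dims \<sigma> m. Eop spc k lam mu z m i j (\<sigma>, p) (h y) * \<phi> (emb (h y)))"
    by (simp add: sum.reindex[OF inj])
  also have "\<dots> = (\<Sum>y<dims \<sigma> m. Efac (of_real (fa \<sigma> m) + z (Suc m)) (of_real (fb \<sigma> m) + z (Suc m)) (dims \<sigma> m - 1) i j (p ! m) y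
      * \<phi> (\<sigma>, (snd (emb (\<sigma>, p)))(m := y)))"
    unfolding emb_h using p(1) assms(2)
    by (intro sum.cong refl) (auto simp: Eop_def h_def nth_list_update)
  finally show ?thesis .
qed

lemma rep_Eop:
  assumes m: "m < k" and ij: "i \<in> {-1,1}" "j \<in> {-1,1}"
  shows "rep (Eop spc k lam mu z m i j) (Ez z m i j)"
  unfolding rep_def
proof (intro ballI allI)
  fix x \<phi> assume x: "x \<in> I"
  obtain \<sigma> p where sp: "x = (\<sigma>, p)" by force
  define e where "e = snd (emb x)"
  have p: "length p = k" "\<sigma> \<in> sigset spc" "p ! m < dims \<sigma> m" using x m by (auto simp: Ix_def sp)
  have em: "e m = p ! m" and ex: "emb x = (\<sigma>, e)" using m by (auto simp: e_def emb_def sp)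
  let ?a = "of_real (fa \<sigma> m) :: complex" and ?b = "of_real (fb \<sigma> m) :: complex"
  have n: "of_nat (dims \<sigma> m - 1) = ?a - ?b" using dims_eq[OF m p(2)] p(3) by (simp add: of_nat_diff)
  have S: "(\<Sum>q\<in>I. Eop spc k lam mu z m i j x q * \<phi> (emb q)) =
    (\<Sum>y<dims \<sigma> m. Efac (?a + z (Suc m)) (?b + z (Suc m)) (dims \<sigma> m - 1) i j (p ! m) y * \<phi> (\<sigma>, e(m := y)))" for i j
    using sum_Eop[of \<sigma> p m] x m by (simp add: sp e_def)
  have L: "app (Ez z m i j) \<phi> (emb x) = (if i = j then z (Suc m) * \<phi> (\<sigma>, e) else 0) +
      app (glop (\<lambda>\<sigma>. of_real (fa \<sigma> m)) (\<lambda>\<sigma>. of_real (fb \<sigma> m)) m i j) \<phi> (\<sigma>, e)" for i j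
    using m by (simp add: shifted_def Lop_def zx_def E0_def ex app_simps app_scale)
  have upd: "e(m := p ! m) = e" by (rule fun_upd_idem) (rule em)
  have delta: "(\<Sum>y<dims \<sigma> m. (if p ! m = y then f y else 0) * g y) = f (p ! m) * g (p ! m)" for f g :: "nat \<Rightarrow> complex"
    using p(3) by (simp add: if_distrib[of "\<lambda>c. c * _"] sum.delta' cong: if_cong)
  from ij consider "i = 1" "j = 1" | "i = -1" "j = -1" | "i = 1" "j = -1" | "i = -1" "j = 1" by auto
  then show "app (Ez z m i j) \<phi> (emb x) = (\<Sum>q\<in>I. Eop spc k lam mu z m i j x q * \<phi> (emb q))"
  proof cases
    case 1
    have "(\<Sum>q\<in>I. Eop spc k lam mu z m 1 1 x q * \<phi> (emb q)) = (?a + z (Suc m) - of_nat (p ! m)) * \<phi> (\<sigma>, e(m := p ! m))"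
      unfolding S Efac_def by (simp add: delta)
    then show ?thesis unfolding 1 L by (simp add: app_glop em upd algebra_simps)
  next
    case 2
    have "(\<Sum>q\<in>I. Eop spc k lam mu z m (-1) (-1) x q * \<phi> (emb q)) = (?b + z (Suc m) + of_nat (p ! m)) * \<phi> (\<sigma>, e(m := p ! m))"
      unfolding S Efac_def by (simp add: delta)
    then show ?thesis unfolding 2 L by (simp add: app_glop em upd algebra_simps)
  next
    case 3
    have "(\<Sum>q\<in>I. Eop spc k lam mu z m 1 (-1) x q * \<phi> (emb q)) =
        (\<Sum>y<dims \<sigma> m. if y = Suc (p ! m) then of_nat (Suc (p ! m)) * (?a - ?b - of_nat (p ! m)) * \<phi> (\<sigma>, e(m := Suc (p ! m))) else 0)"
      unfolding S Efac_def n by (intro sum.cong refl) auto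
    also have "\<dots> = of_nat (Suc (p ! m)) * (?a - ?b - of_nat (p ! m)) * \<phi> (\<sigma>, e(m := Suc (p ! m)))"
    proof (cases "Suc (p ! m) < dims \<sigma> m")
      \<comment> \<open>At the last exponent the column \<open>Suc (p ! m)\<close> is absent from
        the matrix, and the weight factor vanishes there.\<close>
      case False
      with p(3) have "p ! m = dims \<sigma> m - 1" by simp
      then have "?a - ?b - of_nat (p ! m) = 0" using n by simp
      then show ?thesis by simp
    qed simp
    finally show ?thesis unfolding 3 L by (simp add: app_glop em)
  next
    case 4
    have "(\<Sum>q\<in>I. Eop spc k lam mu z m (-1) 1 x q * \<phi> (emb q)) = (\<Sum>y<dims \<sigma> m. if p ! m = Suc y then \<phi> (\<sigma>, e(m := y)) else 0)"
      unfolding S Efac_def by (intro sum.cong refl) auto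
    also have "\<dots> = (if p ! m = 0 then 0 else \<phi> (\<sigma>, e(m := p ! m - 1)))"
    proof (cases "p ! m")
      case (Suc n')
      then have "(\<Sum>y<dims \<sigma> m. if p ! m = Suc y then \<phi> (\<sigma>, e(m := y)) else 0) = (\<Sum>y<dims \<sigma> m. if n' = y then \<phi> (\<sigma>, e(m := y)) else 0)"
        by (intro sum.cong refl) auto
      also have "\<dots> = \<phi> (\<sigma>, e(m := n'))" using p(3) Suc by (simp add: sum.delta')
      finally show ?thesis using Suc by simp
    qed simp
    finally show ?thesis unfolding 4 L by (simp add: app_glop em)
  qed
qed

lemma rep_Tc:
  assumes "m \<le> k" "i \<in> {-1,1}" "j \<in> {-1,1}"
  shows "rep (Tc I (Eop spc k lam mu z) m r i j) (fps_nth (Gp (\<lambda>_. 1) (Ez z) m i j) r)"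
  using assms
proof (induction m arbitrary: r j)
  case 0
  then show ?case using rep_mid rep_0 by (cases r) auto
next
  case (Suc m)
  let ?T = "Tc I (Eop spc k lam mu z) m" and ?G = "\<lambda>i j. fps_nth (Gp (\<lambda>_. 1) (Ez z) m i j)"
  have IH: "rep (?T r i c) (?G i c r)" if "c \<in> {-1,1}" for c r using Suc that by simp
  have zero: "rep (\<lambda>p q. 0) 0" using rep_0 by (simp add: mzero_def)
  have "rep (\<lambda>p q. \<Sum>c\<in>{-1,1}. (if c = j then ?T r i c p q else 0) +
       (if r \<ge> 1 then mmul I (?T (r - 1) i c) (Eop spc k lam mu z m c j) p q else 0))
      (\<Sum>c\<in>{-1,1}. (if c = j then ?G i c r else 0) + (if r \<ge> 1 then ?G i c (r - 1) * Ez z m c j else 0))"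
  proof (intro rep_sum rep_add)
    fix c :: int assume c: "c \<in> {-1,1}"
    show "rep (\<lambda>p q. if c = j then ?T r i c p q else 0) (if c = j then ?G i c r else 0)"
      using IH[OF c] zero by (cases "c = j") simp_all
    have "rep (mmul I (?T (r - 1) i c) (Eop spc k lam mu z m c j)) (?G i c (r - 1) * Ez z m c j)"
      by (intro rep_mult IH c rep_Eop) (use Suc.prems c in auto)
    then show "rep (\<lambda>p q. if r \<ge> 1 then mmul I (?T (r - 1) i c) (Eop spc k lam mu z m c j) p q else 0)
      (if r \<ge> 1 then ?G i c (r - 1) * Ez z m c j else 0)"
      using zero by simp
  qed
  moreover have "(\<Sum>c\<in>{-1,1}. (if c = j then ?G i c r else 0) + (if r \<ge> 1 then ?G i c (r - 1) * Ez z m c j else 0))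
     = fps_nth (Gp (\<lambda>_. 1) (Ez z) (Suc m) i j) r"
    unfolding Gp_nth_Suc[OF Suc.prems(3)] using Suc.prems(3) by (auto simp: scale_one)
  ultimately show ?case by simp
qed

end

section \<open>Series calculus and the one-dimensional factor W(\<delta>)\<close>

definition fneg :: "'a endo fps \<Rightarrow> 'a endo fps" where
  "fneg f = Abs_fps (\<lambda>n. (-1) ^ n *\<^sub>c fps_nth f n)"

definition fscale :: "complex \<Rightarrow> 'a endo fps \<Rightarrow> 'a endo fps" where
  "fscale c f = Abs_fps (\<lambda>n. c *\<^sub>c fps_nth f n)"

definition geo :: "complex \<Rightarrow> 'a endo fps" where
  "geo \<mu> = Abs_fps (\<lambda>n. \<mu> ^ n *\<^sub>c 1)"

lemma fneg_nth: "fps_nth (fneg f) n = (-1) ^ n *\<^sub>c fps_nth f n"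
  by (simp add: fneg_def)

lemma fscale_nth: "fps_nth (fscale c f) n = c *\<^sub>c fps_nth f n"
  by (simp add: fscale_def)

lemma fneg_mult: "fneg (f * g) = fneg f * fneg g"
proof (rule fps_ext)
  fix n
  show "fps_nth (fneg (f * g)) n = fps_nth (fneg f * fneg g) n"
    unfolding fneg_nth fps_mult_nth scale_sum_right
    by (intro sum.cong refl) (simp add: scale_mult_left scale_mult_right scale_scale flip: power_add)
qed

lemma fneg_sum: "fneg (\<Sum>i\<in>S. f i) = (\<Sum>i\<in>S. fneg (f i))"
  by (rule fps_ext) (simp add: fneg_nth scale_sum_right fps_sum_nth)

lemma fscale_mult_left: "fscale c f * g = fscale c (f * g)"
  by (rule fps_ext) (simp add: fscale_nth fps_mult_nth scale_sum_right scale_mult_left)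

lemma fscale_mult_right: "f * fscale c g = fscale c (f * g)"
  by (rule fps_ext) (simp add: fscale_nth fps_mult_nth scale_sum_right scale_mult_right)

lemma fscale_sum: "fscale c (\<Sum>i\<in>S. f i) = (\<Sum>i\<in>S. fscale c (f i))"
  by (rule fps_ext) (simp add: fscale_nth scale_sum_right fps_sum_nth)

lemma fscale_fscale: "fscale c (fscale d f) = fscale (c * d) f"
  by (rule fps_ext) (simp add: fscale_nth scale_scale)

lemma geo_commute: "geo \<mu> * f = f * geo \<mu>"
proof (rule fps_ext)
  fix n
  have "fps_nth (geo \<mu> * f) n = (\<Sum>i=0..n. \<mu> ^ i *\<^sub>c fps_nth f (n - i))"
    by (simp add: fps_mult_nth geo_def scale_mult_left)
  also have "\<dots> = (\<Sum>i=0..n. \<mu> ^ (n - i) *\<^sub>c fps_nth f i)"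
    by (subst sum.atLeastAtMost_rev) simp
  also have "\<dots> = fps_nth (f * geo \<mu>) n"
    by (simp add: fps_mult_nth geo_def scale_mult_right)
  finally show "fps_nth (geo \<mu> * f) n = fps_nth (f * geo \<mu>) n" .
qed

lemma fps_commute:
  assumes "\<And>m n. fps_nth f m * fps_nth g n = fps_nth g n * fps_nth f m"
  shows "f * g = (g * f :: 'a endo fps)"
proof (rule fps_ext)
  fix n
  have "fps_nth (f * g) n = (\<Sum>i=0..n. fps_nth g (n - i) * fps_nth f i)"
    unfolding fps_mult_nth by (simp only: assms)
  also have "\<dots> = fps_nth (g * f) n"
    unfolding fps_mult_nth by (subst sum.atLeastAtMost_rev) simp
  finally show "fps_nth (f * g) n = fps_nth (g * f) n" .
qed

lemma twist_fps: "Abs_fps (\<lambda>r. twist \<mu> t r i j) = Abs_fps (\<lambda>r. t r i j) * geo \<mu>"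
proof (rule fps_ext)
  fix n
  have "twist \<mu> t n i j = (\<Sum>r\<le>n. \<mu> ^ (n - r) *\<^sub>c t r i j)"
  proof (induction n)
    case (Suc n)
    have "(\<Sum>r\<le>Suc n. \<mu> ^ (Suc n - r) *\<^sub>c t r i j) = t (Suc n) i j + (\<Sum>r\<le>n. \<mu> *\<^sub>c (\<mu> ^ (n - r) *\<^sub>c t r i j))"
      by (simp add: scale_one scale_scale Suc_diff_le add.commute)
    then show ?case using Suc by (simp add: scale_sum_right)
  qed (simp add: scale_one)
  then show "fps_nth (Abs_fps (\<lambda>r. twist \<mu> t r i j)) n = fps_nth (Abs_fps (\<lambda>r. t r i j) * geo \<mu>) n"
    by (simp add: fps_mult_nth geo_def scale_mult_right atLeast0AtMost)
qed

lemma Gp_commute: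
  assumes "\<And>m i j. m < K \<Longrightarrow> X * D m i j = D m i j * X"
  shows "X * fps_nth (Gp y D K i j) r = fps_nth (Gp y D K i j) r * X"
  using assms
proof (induction K arbitrary: i j r)
  case (Suc K)
  have a: "X * fps_nth (Gp y D K i j) r = fps_nth (Gp y D K i j) r * X" for i j r using Suc by simp
  have b: "fps_nth (Gp y D K i c) r * X * D K c j = fps_nth (Gp y D K i c) r * D K c j * X" for i c j r
    using Suc.prems[of K c j] by (metis lessI mult.assoc)
  show ?case
    by (simp add: distrib_left distrib_right mult.assoc[symmetric] scale_mult_left scale_mult_right a b)
qed simp

text \<open>Coefficients of (1 - \<mu>^2 X^2)^{-1}, the product of the twist factors at u and at
  -u.\<close>

definition hseries :: "complex \<Rightarrow> nat \<Rightarrow> complex" where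
  "hseries \<mu> n = (if even n then \<mu> ^ n else 0)"

lemma geo_fneg_geo: "geo \<mu> * fneg (geo \<mu>) = Abs_fps (\<lambda>n. hseries \<mu> n *\<^sub>c 1)"
proof (rule fps_ext)
  fix n
  have alt: "(\<Sum>i=0..n. (-1) ^ i) = (if even n then 1 else (0::complex))" for n
    by (induction n) auto
  have p: "\<mu> ^ i * \<mu> ^ (n - i) = \<mu> ^ n" if "i \<le> n" for i using that by (simp flip: power_add)
  have "fps_nth (fneg (geo \<mu>) * geo \<mu>) n = (\<Sum>i=0..n. ((-1) ^ i * (\<mu> ^ i * \<mu> ^ (n - i))) *\<^sub>c 1)"
    unfolding fps_mult_nth
    by (intro sum.cong refl) (simp add: geo_def fneg_nth scale_mult_left scale_mult_right scale_scale mult_ac)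
  also have "\<dots> = (\<Sum>i=0..n. ((-1) ^ i * \<mu> ^ n) *\<^sub>c 1)"
    by (intro sum.cong refl) (simp add: p)
  also have "\<dots> = hseries \<mu> n *\<^sub>c 1"
    unfolding scale_sum_left[symmetric] sum_distrib_right[symmetric] alt by (simp add: hseries_def)
  finally show "fps_nth (geo \<mu> * fneg (geo \<mu>)) n = fps_nth (Abs_fps (\<lambda>n. hseries \<mu> n *\<^sub>c 1)) n"
    by (simp add: geo_commute)
qed

lemma sop_fps:
  "sop spc t (M, i, j) = fps_nth (\<Sum>a\<in>{-1,1}. fscale (theta spc a j)
     (Abs_fps (\<lambda>r. t r i a) * fneg (Abs_fps (\<lambda>r. t r (- j) (- a))))) M"
  unfolding sop_def fps_sum_nth fscale_nth fps_mult_nth scale_sum_right prod.case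
  by (intro sum.cong refl) (auto simp: fneg_nth scale_mult_right scale_scale)

text \<open>This cocycle identity lets the signs split along the coproduct.\<close>

lemma theta_trans: "a \<in> {-1,1} \<Longrightarrow> b \<in> {-1,1} \<Longrightarrow> j \<in> {-1,1} \<Longrightarrow> theta spc a j = theta spc b j * theta spc a b"
  by (auto simp: theta_def)

context multiplicity_space
begin

definition tw where "tw = (if spc then 0 else -1/2 :: complex)"

text \<open>The twist is by a scalar series and is applied to the product of all k + 1 slots; moving
  it into slot k gives the factor \<open>V\<close>.\<close>

definition tk :: "(nat \<Rightarrow> complex) \<Rightarrow> nat \<Rightarrow> xidx gmat" where
  "tk z = twist tw (\<lambda>r i j. fps_nth (Gp (\<lambda>_. 1) (Ez z) (Suc k) i j) r)"

definition V :: "int \<Rightarrow> int \<Rightarrow> xidx endo fps" where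
  "V c j = (fps_const (if c = j then 1 else 0) + fps_const (E0 k c j) * fps_X) * geo tw"

text \<open>The series s_cb(u) of slot k alone, the second tensor factor in the coproduct of
  s_ij(u).\<close>

definition W :: "int \<Rightarrow> int \<Rightarrow> xidx endo fps" where
  "W c b = (\<Sum>a\<in>{-1,1}. fscale (theta spc a b) (V c a * fneg (V (- b) (- a))))"

lemma Ez_k: "Ez z k c j = E0 k c j"
  by (simp add: shifted_def Lop_def zx_def scale_zero_left)

lemma tk_fps: "Abs_fps (\<lambda>r. tk z r i j) = (\<Sum>c\<in>{-1,1}. Gp (\<lambda>_. 1) (Ez z) k i c * V c j)"
  unfolding tk_def twist_fps fps_nth_inverse
  by (simp add: V_def Ez_k scale_one distrib_right mult.assoc)

lemma V_commute: "V c a * fneg (Gp (\<lambda>_. 1) (Ez z) k i j) = fneg (Gp (\<lambda>_. 1) (Ez z) k i j) * V c a"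
proof -
  let ?f = "fneg (Gp (\<lambda>_. 1) (Ez z) k i j)"
  define A :: "xidx endo fps" where "A = fps_const (if c = a then 1 else 0)"
  define B where "B = fps_const (E0 k c a)"
  have E: "E0 k c a * Ez z m i j = Ez z m i j * E0 k c a" if "m < k" for m i j
    using commuting_E0 that unfolding commuting_family_def
    by (auto simp: shifted_def Lop_def distrib_left distrib_right scale_mult_left scale_mult_right)
  have A: "A * ?f = ?f * A" by (simp add: A_def)
  have B: "B * ?f = ?f * B"
    by (rule fps_commute)
      (simp add: B_def fneg_nth scale_mult_left scale_mult_right Gp_commute[of k "E0 k c a" "Ez z", OF E])
  have X: "fps_X * ?f = ?f * fps_X" by (rule fps_mult_fps_X_commute)
  define C where "C = A + B * fps_X"
  have "B * fps_X * ?f = ?f * (B * fps_X)" unfolding mult.assoc X unfolding mult.assoc[symmetric] B ..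
  then have C: "C * ?f = ?f * C" using A by (simp add: C_def distrib_left distrib_right)
  have "V c a * ?f = C * (geo tw * ?f)" by (simp only: V_def C_def A_def B_def mult.assoc)
  also have "\<dots> = C * ?f * geo tw" unfolding geo_commute mult.assoc ..
  also have "\<dots> = ?f * V c a" unfolding C by (simp only: V_def C_def A_def B_def mult.assoc)
  finally show ?thesis .
qed

text \<open>The coproduct formula built into \<open>Sop\<close>, derived from the monodromy of k + 1
  slots: the slot k factor of t(u) commutes with the other slots of t(-u), and
  \<open>theta_trans\<close> splits the signs.\<close>

lemma sop_tk:
  assumes "i \<in> {-1,1}" "j \<in> {-1,1}"
  shows "sop spc (tk z) (M, i, j) = (\<Sum>c\<in>{-1,1}. \<Sum>b\<in>{-1,1}. theta spc b j *\<^sub>c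
    fps_nth (Gp (\<lambda>_. 1) (Ez z) k i c * (fneg (Gp (\<lambda>_. 1) (Ez z) k (- j) (- b)) * W c b)) M)"
proof -
  let ?I = "{-1,1::int}"
  let ?U = "Gp (\<lambda>_. 1) (Ez z) k"
  \<comment> \<open>The inner label of the second factor is renamed from c to -b to match the form
    of \<open>Sop\<close>.\<close>
  have inner: "(\<Sum>c\<in>?I. fneg (?U (- j) c) * fneg (V c (- a))) = (\<Sum>b\<in>?I. fneg (?U (- j) (- b)) * fneg (V (- b) (- a)))" for a
    by (simp add: add.commute)
  have "(\<Sum>a\<in>?I. fscale (theta spc a j) (Abs_fps (\<lambda>r. tk z r i a) * fneg (Abs_fps (\<lambda>r. tk z r (- j) (- a)))))
    = (\<Sum>a\<in>?I. fscale (theta spc a j) ((\<Sum>c\<in>?I. ?U i c * V c a) * (\<Sum>b\<in>?I. fneg (?U (- j) (- b)) * fneg (V (- b) (- a)))))"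
    unfolding tk_fps fneg_sum fneg_mult inner ..
  also have "\<dots> = (\<Sum>a\<in>?I. \<Sum>c\<in>?I. \<Sum>b\<in>?I. fscale (theta spc a j) (?U i c * (fneg (?U (- j) (- b)) * (V c a * fneg (V (- b) (- a))))))"
    unfolding sum_product fscale_sum
  proof (intro sum.cong refl arg_cong2[where f=fscale])
    fix a c b
    have "?U i c * V c a * (fneg (?U (- j) (- b)) * fneg (V (- b) (- a)))
       = ?U i c * (V c a * fneg (?U (- j) (- b))) * fneg (V (- b) (- a))" by (simp only: mult.assoc)
    then show "?U i c * V c a * (fneg (?U (- j) (- b)) * fneg (V (- b) (- a)))
       = ?U i c * (fneg (?U (- j) (- b)) * (V c a * fneg (V (- b) (- a))))"
      by (simp only: V_commute mult.assoc)
  qed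
  also have "\<dots> = (\<Sum>c\<in>?I. \<Sum>b\<in>?I. \<Sum>a\<in>?I. fscale (theta spc a j) (?U i c * (fneg (?U (- j) (- b)) * (V c a * fneg (V (- b) (- a))))))"
    by (subst sum.swap) (intro sum.cong refl sum.swap)
  also have "\<dots> = (\<Sum>c\<in>?I. \<Sum>b\<in>?I. fscale (theta spc b j) (?U i c * (fneg (?U (- j) (- b)) * W c b)))"
  proof (intro sum.cong refl)
    fix c b assume b: "b \<in> ?I"
    show "(\<Sum>a\<in>?I. fscale (theta spc a j) (?U i c * (fneg (?U (- j) (- b)) * (V c a * fneg (V (- b) (- a))))))
      = fscale (theta spc b j) (?U i c * (fneg (?U (- j) (- b)) * W c b))"
      unfolding W_def sum_distrib_left fscale_sum fscale_mult_right fscale_fscale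
      by (intro sum.cong refl) (use theta_trans[OF _ b assms(2)] in simp)
  qed
  finally show ?thesis
    unfolding sop_fps fps_sum_nth[symmetric] by (simp add: fps_sum_nth fscale_nth)
qed

end

lemma linear_mult_nth:
  "fps_nth ((fps_const p + fps_const q * fps_X) * fneg (fps_const r + fps_const s * fps_X)) n =
    (if n = 0 then p * r else if n = 1 then q * r - p * s else if n = 2 then - (q * s) else (0 :: 'a endo))"
proof -
  have g: "fps_nth (fneg (fps_const r + fps_const s * fps_X)) n = (if n = 0 then r else if n = 1 then - s else 0)" for n
    by (auto simp: fneg_nth scale_one scale_minus_left scale_minus_right scale_zero_right)
  have "fps_nth ((fps_const p + fps_const q * fps_X) * fneg (fps_const r + fps_const s * fps_X)) n =
     p * fps_nth (fneg (fps_const r + fps_const s * fps_X)) n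
     + q * (if n = 0 then 0 else fps_nth (fneg (fps_const r + fps_const s * fps_X)) (n - 1))"
    by (simp add: distrib_right mult.assoc)
  also have "\<dots> = (if n = 0 then p * r else if n = 1 then q * r - p * s else if n = 2 then - (q * s) else 0)"
    unfolding g by auto
  finally show ?thesis .
qed

lemma sum_upto_2:
  fixes g :: "nat \<Rightarrow> 'a :: comm_monoid_add"
  assumes "\<And>i. i > 2 \<Longrightarrow> g i = 0"
  shows "(\<Sum>i=0..n. g i) = g 0 + (if n \<ge> 1 then g 1 else 0) + (if n \<ge> 2 then g 2 else 0)"
proof (induction n)
  case (Suc n)
  consider "n = 0" | "n = 1" | "n > 1" by linarith
  then show ?case
  proof cases
    case 3
    then have "g (Suc n) = 0" using assms by simp
    then show ?thesis using Suc 3 by simp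
  qed (use Suc in \<open>simp_all add: numeral_2_eq_2\<close>)
qed simp

context multiplicity_space
begin

text \<open>Coefficients of s_cb(u) of slot k before the twist, a polynomial of degree at most 2 in
  1/u.\<close>

definition W0 :: "int \<Rightarrow> int \<Rightarrow> nat \<Rightarrow> xidx endo" where "W0 c b n = (\<Sum>a\<in>{-1,1}. theta spc a b *\<^sub>c
  (if n = 0 then (if c = a then 1 else 0) * (if b = a then 1 else 0)
   else if n = 1 then E0 k c a * (if b = a then 1 else 0) - (if c = a then 1 else 0) * E0 k (- b) (- a)
   else if n = 2 then - (E0 k c a * E0 k (- b) (- a)) else (0::xidx endo)))"

lemma W_nth: "fps_nth (W c b) n = hseries tw n *\<^sub>c W0 c b 0
    + (if n \<ge> 1 then hseries tw (n - 1) *\<^sub>c W0 c b 1 else 0) + (if n \<ge> 2 then hseries tw (n - 2) *\<^sub>c W0 c b 2 else 0)"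
proof -
  let ?L = "\<lambda>c a. fps_const (if c = a then 1 else 0) + fps_const (E0 k c a) * fps_X"
  have V: "V c a * fneg (V (- b) (- a)) = ?L c a * fneg (?L (- b) (- a)) * Abs_fps (\<lambda>n. hseries tw n *\<^sub>c 1)" for a
  proof -
    have "V c a * fneg (V (- b) (- a)) = ?L c a * (geo tw * fneg (?L (- b) (- a))) * fneg (geo tw)"
      unfolding V_def fneg_mult mult.assoc ..
    also have "\<dots> = ?L c a * fneg (?L (- b) (- a)) * (geo tw * fneg (geo tw))"
      unfolding geo_commute mult.assoc ..
    finally show ?thesis unfolding geo_fneg_geo .
  qed
  have W: "W c b = (\<Sum>a\<in>{-1,1}. fscale (theta spc a b) (?L c a * fneg (?L (- b) (- a)))) * Abs_fps (\<lambda>n. hseries tw n *\<^sub>c 1)"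
    unfolding W_def V sum_distrib_right fscale_mult_left ..
  have Q: "fps_nth (\<Sum>a\<in>{-1,1}. fscale (theta spc a b) (?L c a * fneg (?L (- b) (- a)))) r = W0 c b r" for r
    unfolding fps_sum_nth fscale_nth linear_mult_nth W0_def
    by (intro sum.cong refl arg_cong2[where f=scale]) simp
  have "fps_nth (W c b) n = (\<Sum>r=0..n. hseries tw (n - r) *\<^sub>c W0 c b r)"
    unfolding W fps_mult_nth Q by (simp add: scale_mult_right)
  also have "\<dots> = hseries tw n *\<^sub>c W0 c b 0
    + (if n \<ge> 1 then hseries tw (n - 1) *\<^sub>c W0 c b 1 else 0) + (if n \<ge> 2 then hseries tw (n - 2) *\<^sub>c W0 c b 2 else 0)"
    by (subst sum_upto_2) (simp_all add: W0_def scale_zero_right)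
  finally show ?thesis .
qed

text \<open>In the row of exponent 0 of a Verma module of weight (a, b), the coefficient of u^{-2}
  in s_{1,-1} contains the factor a + (a - 1), which forces a = 1/2. With b = 1 - \<delta> the
  diagonal series are (1 - 1/(2u))(1 + \<delta>/u) and (1 - 1/(2u))(1 + (1 - \<delta>)/u), and
  division by 1 - 1/(4u^2), the effect of the twist, leaves the two series of W(\<delta>).\<close>

lemma W_row:
  assumes c: "c \<in> {-1,1}" and b: "b \<in> {-1,1}" and e: "e k = 0"
  shows "app (fps_nth (W c b) n) \<phi> (\<sigma>, e) =
    (if c = b then (if spc then (if n = 0 then 1 else 0) else wcoef (deltaW lam \<sigma>) c n) * \<phi> (\<sigma>, e) else 0)"
proof (cases spc)
  case True
  have "E0 k c a = 0" for c a unfolding E0_def using True by simp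
  moreover have "hseries tw n = (if n = 0 then 1 else 0)" unfolding hseries_def tw_def using True by simp
  ultimately show ?thesis
    using c b True unfolding W_nth W0_def
    by (auto simp: theta_def app_simps app_scale)
next
  case False
  define \<delta> :: complex where "\<delta> = of_real (deltaW lam \<sigma>)"
  define F where "F = E0 k"
  have F: "F = glop (\<lambda>\<sigma>. 1/2) (\<lambda>\<sigma>. 1 - of_real (deltaW lam \<sigma>)) k" unfolding F_def E0_def using False by simp
  have th: "theta spc a b = 1" for a b using False by (simp add: theta_def)
  have row: "app (F 1 1) \<psi> (\<sigma>, e) = 1/2 * \<psi> (\<sigma>, e)" "app (F (-1) (-1)) \<psi> (\<sigma>, e) = (1 - \<delta>) * \<psi> (\<sigma>, e)"
    "app (F 1 (-1)) \<psi> (\<sigma>, e) = (\<delta> - 1/2) * \<psi> (\<sigma>, e(k := 1))" "app (F (-1) 1) \<psi> (\<sigma>, e) = 0" for \<psi>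
    unfolding F by (simp_all add: app_glop e \<delta>_def)
  have row1: "app (F (-1) 1) \<psi> (\<sigma>, e(k := 1)) = \<psi> (\<sigma>, e)" "app (F 1 1) \<psi> (\<sigma>, e(k := 1)) = - 1/2 * \<psi> (\<sigma>, e(k := 1))" for \<psi>
  proof -
    have "e(k := 0) = e" by (rule fun_upd_idem) (rule e)
    then show "app (F (-1) 1) \<psi> (\<sigma>, e(k := 1)) = \<psi> (\<sigma>, e)" unfolding F by (simp add: app_glop)
    show "app (F 1 1) \<psi> (\<sigma>, e(k := 1)) = - 1/2 * \<psi> (\<sigma>, e(k := 1))" unfolding F by (simp add: app_glop)
  qed
  \<comment> \<open>\<open>y\<close> and \<open>q\<close> are the coefficients of u^{-1} and u^{-2}
    in the untwisted diagonal series.\<close>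
  define y where "y = (if c = 1 then \<delta> - 1/2 else 1/2 - \<delta>)"
  define q where "q = (if c = 1 then - \<delta> / 2 else (\<delta> - 1) / 2)"
  have 0: "app (W0 c b 0) \<phi> (\<sigma>, e) = (if c = b then \<phi> (\<sigma>, e) else 0)"
    using c b by (auto simp: W0_def th app_simps app_scale)
  have 1: "app (W0 c b 1) \<phi> (\<sigma>, e) = (if c = b then y * \<phi> (\<sigma>, e) else 0)"
    using c b by (auto simp: W0_def th app_simps app_scale row y_def algebra_simps simp flip: F_def)
  have 2: "app (W0 c b 2) \<phi> (\<sigma>, e) = (if c = b then q * \<phi> (\<sigma>, e) else 0)"
    using c b by (auto simp: W0_def th app_simps app_scale row row1 row1[unfolded One_nat_def] q_def field_simps simp flip: F_def)
  have w: "hseries tw n + (if n \<ge> 1 then hseries tw (n - 1) * y else 0) + (if n \<ge> 2 then hseries tw (n - 2) * q else 0)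
      = wcoef (deltaW lam \<sigma>) c n"
  proof -
    have tw: "tw = -1/2" unfolding tw_def using False by simp
    have wc: "wcoef (deltaW lam \<sigma>) c n = (if n = 0 then 1 else y * tw ^ (n - 1))" for n
      using c by (auto simp: wcoef_def y_def \<delta>_def tw)
    \<comment> \<open>This says that 1 + \<open>tw\<close> X divides 1 + \<open>y\<close> X +
      \<open>q\<close> X^2, so one of the two linear factors of the denominator cancels.\<close>
    have id: "tw * tw + q = y * tw" using c by (auto simp: tw q_def y_def algebra_simps add_divide_distrib diff_divide_distrib)
    consider "n = 0" | "n = 1" | m where "n = Suc (Suc m)" by (metis One_nat_def not0_implies_Suc)
    then show ?thesis
    proof cases
      case 3
      have "tw ^ m * (tw * tw + q) = tw ^ m * (y * tw)" by (simp only: id)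
      then show ?thesis unfolding wc 3 by (simp add: hseries_def algebra_simps)
    qed (simp_all add: wc hseries_def)
  qed
  have "app (fps_nth (W c b) n) \<phi> (\<sigma>, e) = (if c = b then (hseries tw n + (if n \<ge> 1 then hseries tw (n - 1) * y else 0)
     + (if n \<ge> 2 then hseries tw (n - 2) * q else 0)) * \<phi> (\<sigma>, e) else 0)"
    using 0 1 2 by (cases "c = b") (simp_all add: W_nth app_simps app_scale algebra_simps)
  then show ?thesis unfolding w using False by simp
qed

lemma rep_Wop:
  assumes "c \<in> {-1,1}" "b \<in> {-1,1}"
  shows "rep (Wop spc lam c b n) (fps_nth (W c b) n)"
  unfolding rep_def
proof (intro ballI allI)
  fix x \<phi> assume x: "x \<in> I"
  obtain \<sigma> p where sp: "x = (\<sigma>, p)" by force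
  have ex: "emb x = (\<sigma>, snd (emb x))" "snd (emb x) k = 0" by (simp_all add: sp emb_def)
  define w where "w = (if c = b then (if spc then (if n = 0 then 1 else 0) else wcoef (deltaW lam \<sigma>) c n) else 0)"
  have "(\<Sum>q\<in>I. Wop spc lam c b n x q * \<phi> (emb q)) = (\<Sum>q\<in>I. if q = x then w * \<phi> (emb x) else 0)"
  proof (intro sum.cong refl)
    fix q
    show "Wop spc lam c b n x q * \<phi> (emb q) = (if q = x then w * \<phi> (emb x) else 0)"
      by (cases q; cases "q = x") (auto simp: Wop_def w_def sp)
  qed
  also have "\<dots> = w * \<phi> (emb x)" using x finite_I by simp
  finally show "app (fps_nth (W c b) n) \<phi> (emb x) = (\<Sum>q\<in>I. Wop spc lam c b n x q * \<phi> (emb q))"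
    using W_row[of c b "snd (emb x)" n \<phi> \<sigma>, OF assms ex(2)] by (simp add: w_def flip: ex(1))
qed

lemma rep_Sop:
  assumes ij: "i \<in> {-1,1}" "j \<in> {-1,1}"
  shows "rep (Sop spc k lam mu z (M, i, j)) (sop spc (tk z) (M, i, j))"
proof -
  let ?I = "{-1,1::int}"
  let ?U = "Gp (\<lambda>_. 1) (Ez z) k"
  let ?T = "Tc I (Eop spc k lam mu z) k"
  have "rep (\<lambda>p q. \<Sum>c\<in>?I. \<Sum>b\<in>?I. \<Sum>r\<le>M. \<Sum>s\<le>M - r. theta spc b j * (-1) ^ s *
        mmul I (mmul I (?T r i c) (?T s (- j) (- b))) (Wop spc lam c b (M - r - s)) p q)
      (\<Sum>c\<in>?I. \<Sum>b\<in>?I. \<Sum>r\<le>M. \<Sum>s\<le>M - r. (theta spc b j * (-1) ^ s) *\<^sub>c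
        (fps_nth (?U i c) r * fps_nth (?U (- j) (- b)) s * fps_nth (W c b) (M - r - s)))"
    by (intro rep_sum rep_scale rep_mult rep_Tc rep_Wop) (use ij in auto)
  moreover have "(\<Sum>c\<in>?I. \<Sum>b\<in>?I. \<Sum>r\<le>M. \<Sum>s\<le>M - r. (theta spc b j * (-1) ^ s) *\<^sub>c
        (fps_nth (?U i c) r * fps_nth (?U (- j) (- b)) s * fps_nth (W c b) (M - r - s))) = sop spc (tk z) (M, i, j)"
    unfolding sop_tk[OF ij]
    by (intro sum.cong refl)
      (simp add: fps_mult_nth fneg_nth sum_distrib_left scale_sum_right scale_mult_left scale_mult_right scale_scale mult.assoc atLeast0AtMost)
  ultimately show ?thesis unfolding Sop_def Let_def prod.case by (simp only:)
qed

lemma rtt_Ev: "rtt (u - v) (\<lambda>i j. Ev (Suc k) (Gp (\<lambda>_. 1) (Ez z) (Suc k) i j) u) (\<lambda>i j. Ev (Suc k) (Gp (\<lambda>_. 1) (Ez z) (Suc k) i j) v)"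
proof -
  have eq: "Ev (Suc k) (Gp (\<lambda>_. 1) (Ez z) (Suc k) i j) u = TT (\<lambda>m. u + zx z m) E0 (Suc k) i j" if "j \<in> {-1,1}" for i j u
    using TT_eq_Ev[OF that, of u "\<lambda>_. 1" "zx z" E0 "Suc k" i] by simp
  have "rtt (u - v) (TT (\<lambda>m. u + zx z m) E0 (Suc k)) (TT (\<lambda>m. v + zx z m) E0 (Suc k))"
    by (rule rtt_TT[OF gl2_rel_E0 commuting_E0])
  then show ?thesis unfolding rtt_def by (intro ballI) (simp only: eq)
qed

lemma yangian_rep_tk: "yangian_rep (tk z)"
proof -
  have G0: "fps_nth (Gp (\<lambda>_. 1) (Ez z) K i j) 0 = (if i = j then 1 else 0)" if "j \<in> {-1,1}" for K i j
    using that
  proof (induction K arbitrary: j)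
    case (Suc K)
    then show ?case unfolding Gp_nth_Suc[OF Suc.prems] by (simp add: scale_one scale_zero_right)
  qed auto
  have "yangian_rel (\<lambda>r i j. fps_nth (Gp (\<lambda>_. 1) (Ez z) (Suc k) i j) r)"
    by (rule yangian_rel_nth[OF Gp_nth_eq_0 rtt_Ev])
  then have "yangian_rel (tk z)" unfolding tk_def
    by (rule yangian_rel_twist) (rule G0)
  moreover have "tk z 0 i j = (if i = j then 1 else 0)" if "j \<in> {-1,1}" for i j
    by (simp only: tk_def twist.simps G0[OF that])
  ultimately show ?thesis unfolding yangian_rep_def by blast
qed

end

section \<open>The odd coefficients of s_11 commute\<close>

lemma Ev_fneg: "Ev n f (- u) = (-1) ^ n *\<^sub>c Ev n (fneg f) u"
  unfolding Ev_def scale_sum_right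
proof (intro sum.cong refl)
  fix r assume "r \<in> {..n}"
  then have "(- u) ^ (n - r) = (-1) ^ n * (u ^ (n - r) * (-1) ^ r)"
    by (subst power_minus) (simp add: uminus_power_if mult.commute)
  then show "(- u) ^ (n - r) *\<^sub>c fps_nth f r = (-1) ^ n *\<^sub>c (u ^ (n - r) *\<^sub>c fps_nth (fneg f) r)"
    by (simp only: fneg_nth scale_scale mult.assoc)
qed

lemma Ev_fscale: "Ev n (fscale c f) u = c *\<^sub>c Ev n f u"
  unfolding Ev_def scale_sum_right by (intro sum.cong refl) (simp add: fscale_nth scale_scale mult.commute)

lemma hseries_even: "hseries \<mu> (Suc (Suc n)) = \<mu>\<^sup>2 * hseries \<mu> n"
  by (simp add: hseries_def power2_eq_square)

lemma fps_mult_top: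
  assumes "\<And>r. r > n \<Longrightarrow> fps_nth f r = 0" "\<And>r. r > m \<Longrightarrow> fps_nth g r = 0" "r > n + m"
  shows "fps_nth (f * g) r = (0 :: 'a endo)"
  unfolding fps_mult_nth
proof (intro sum.neutral ballI)
  fix i assume "i \<in> {0..r}"
  then have "i > n \<or> r - i > m" using assms(3) by auto
  then show "fps_nth f i * fps_nth g (r - i) = 0" using assms(1,2) by auto
qed

context multiplicity_space
begin

abbreviation G where "G z \<equiv> Gp (\<lambda>_. 1) (Ez z) (Suc k)"

text \<open>u^{k+1} times t_ij(u) before the twist, the polynomial form to which RTT is
  applied.\<close>

definition That :: "(nat \<Rightarrow> complex) \<Rightarrow> complex \<Rightarrow> xidx gmat" where
  "That z u i j = Ev (Suc k) (G z i j) u"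

text \<open>The series s_11(u) of all k + 1 slots before the twist, a polynomial of degree at most
  2k + 2 in 1/u.\<close>

definition Sh :: "(nat \<Rightarrow> complex) \<Rightarrow> xidx endo fps" where
  "Sh z = (\<Sum>a\<in>{-1,1}. fscale (theta spc a 1) (G z 1 a * fneg (G z (-1) (- a))))"

definition Qop :: "(nat \<Rightarrow> complex) \<Rightarrow> complex \<Rightarrow> xidx endo" where
  "Qop z u = Bop (theta spc (-1) 1) (That z u) (That z (- u)) 1 (-1) - Bop (theta spc (-1) 1) (That z (- u)) (That z u) 1 (-1)"

lemma Sh_top: "r > 2 * Suc k \<Longrightarrow> fps_nth (Sh z) r = 0"
  unfolding Sh_def fps_sum_nth fscale_nth
  by (intro sum.neutral ballI, subst fps_mult_top[of "Suc k" _ "Suc k"]) (simp_all add: Gp_nth_eq_0 fneg_nth scale_zero_right del: Gp.simps)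

lemma Bop_That: "Bop (theta spc (-1) 1) (That z u) (That z (- u)) 1 (-1) = (-1) ^ Suc k *\<^sub>c Ev (2 * Suc k) (Sh z) u"
proof -
  have m: "Ev (2 * Suc k) (G z 1 a * fneg (G z (-1) (- a))) u = Ev (Suc k) (G z 1 a) u * Ev (Suc k) (fneg (G z (-1) (- a))) u" for a
    unfolding mult_2 by (rule Ev_mult) (simp_all add: Gp_nth_eq_0 fneg_nth scale_zero_right del: Gp.simps)
  define A where "A j = Ev (Suc k) (G z 1 j) u" for j
  define B where "B j = Ev (Suc k) (fneg (G z (-1) j)) u" for j
  have T: "That z u 1 j = A j" "That z (- u) (-1) j = (-1) ^ Suc k *\<^sub>c B j" for j
    by (simp_all only: That_def Ev_fneg A_def B_def)
  have "Ev (2 * Suc k) (Sh z) u = (\<Sum>a\<in>{-1,1}. theta spc a 1 *\<^sub>c (A a * B (- a)))"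
    unfolding Sh_def A_def B_def m[symmetric] Ev_fscale[symmetric] by (simp add: Ev_add del: Gp.simps)
  also have "\<dots> = A 1 * B (-1) + theta spc (-1) 1 *\<^sub>c (A (-1) * B 1)"
    by (simp add: theta_def scale_one add.commute)
  finally show ?thesis unfolding Bop_def T
    by (simp only: scale_mult_right scale_add_right scale_scale mult.commute[of "(-1) ^ Suc k"])
qed

text \<open>The sign comes from the k + 1 factors -u in T(-u). As 2k + 2 is even, taking the odd
  part in u keeps exactly the coefficients of odd index.\<close>

lemma Qop_eq: "Qop z u = (-1) ^ Suc k *\<^sub>c (\<Sum>r\<le>2 * Suc k. (2 * u ^ (2 * Suc k - r)) *\<^sub>c (if odd r then fps_nth (Sh z) r else 0))"
proof -
  have "Qop z u = (-1) ^ Suc k *\<^sub>c (Ev (2 * Suc k) (Sh z) u - Ev (2 * Suc k) (Sh z) (- u))"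
    unfolding Qop_def scale_diff_right Bop_That using Bop_That[of z "- u"] by simp
  also have "Ev (2 * Suc k) (Sh z) u - Ev (2 * Suc k) (Sh z) (- u) =
     (\<Sum>r\<le>2 * Suc k. (2 * u ^ (2 * Suc k - r)) *\<^sub>c (if odd r then fps_nth (Sh z) r else 0))"
    unfolding Ev_def sum_subtractf[symmetric] scale_diff_left[symmetric]
  proof (intro sum.cong refl)
    fix r assume r: "r \<in> {..2 * Suc k}"
    show "(u ^ (2 * Suc k - r) - (- u) ^ (2 * Suc k - r)) *\<^sub>c fps_nth (Sh z) r
       = (2 * u ^ (2 * Suc k - r)) *\<^sub>c (if odd r then fps_nth (Sh z) r else 0)"
    proof (cases "odd r")
      case True
      then have "odd (2 * Suc k - r)" using r by simp
      then have "(- u) ^ (2 * Suc k - r) = - (u ^ (2 * Suc k - r))" by (rule power_minus_odd)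
      then show ?thesis using True by simp
    next
      case False
      then have "even (2 * Suc k - r)" using r by simp
      then have "(- u) ^ (2 * Suc k - r) = u ^ (2 * Suc k - r)" by (rule power_minus_even)
      then show ?thesis using False by (simp add: scale_zero_left scale_zero_right)
    qed
  qed
  finally show ?thesis .
qed

lemma Qop_commute:
  assumes uv: "u \<noteq> v" "u \<noteq> - v" "u - v \<noteq> 1" "u - v \<noteq> -1" "u + v \<noteq> 1" "u + v \<noteq> -1" "2*u \<noteq> 1" "2 * v \<noteq> 1" "2*u \<noteq> -1" "2 * v \<noteq> -1"
  shows "Qop z u * Qop z v = Qop z v * Qop z u"
proof -
  have T: "rtt (x - y) (That z x) (That z y)" for x y
    using rtt_Ev[of x y z] by (simp only: That_def[abs_def])
  have th: "theta spc (-1) 1 = 1 \<or> theta spc (-1) 1 = -1" by (simp add: theta_def)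
  show ?thesis
    using odd_parts_commute[OF T th uv] unfolding Qop_def minus_minus .
qed

text \<open>So far Q(u) and Q(v) commute only away from finitely many lines in the (u, v) plane;
  comparing coefficients removes these exceptions.\<close>

lemma Sh_odd_commute:
  assumes "odd r" "odd s"
  shows "fps_nth (Sh z) r * fps_nth (Sh z) s = fps_nth (Sh z) s * fps_nth (Sh z) r"
proof (cases "r \<le> 2 * Suc k \<and> s \<le> 2 * Suc k")
  case True
  let ?n = "2 * Suc k"
  let ?S = "\<lambda>r. if odd r then fps_nth (Sh z) r else 0"
  define P where "P u = (\<Sum>r\<le>?n. u ^ r *\<^sub>c ?S r)" for u
  have QP: "Qop z (1 / u) = (2 * (-1) ^ Suc k / u ^ ?n) *\<^sub>c P u" if "u \<noteq> 0" for u
    unfolding Qop_eq P_def scale_sum_right scale_scale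
    by (intro sum.cong refl arg_cong2[where f=scale]) (use that in \<open>simp_all add: power_diff power_divide\<close>)
  \<comment> \<open>With spectral parameters x = 1/u and y = 1/v the index r becomes the exponent of
    u. \<open>T x\<close> omits 0 and the inverses of all values of y excluded by
    \<open>Qop_commute\<close>; omitting u = 2 and u = -2 below excludes 2x = 1 and 2x = -1.\<close>
  define T where "T x = UNIV - ({0} \<union> inverse ` {x, -x, x-1, x+1, 1-x, -1-x, 1/2, -1/2})" for x :: complex
  have "?S r * ?S s - ?S s * ?S r = 0"
  proof (rule endo_poly2_zero[where S="UNIV - {0, 2, -2}" and T="\<lambda>u. T (1/u)" and n="?n" and c="\<lambda>r s. ?S r * ?S s - ?S s * ?S r"])
    show "infinite (UNIV - {0, 2, -2 :: complex})" by (rule Diff_infinite_finite) (auto simp: infinite_UNIV_char_0)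
    show "infinite (T (1 / u))" for u unfolding T_def by (rule Diff_infinite_finite) (auto simp: infinite_UNIV_char_0)
    fix u v :: complex assume u: "u \<in> UNIV - {0, 2, -2}" and v: "v \<in> T (1 / u)"
    define x where "x = 1 / u"
    define y where "y = 1 / v"
    have uv: "u \<noteq> 0" "v \<noteq> 0" using u v by (auto simp: T_def)
    have iy: "y \<notin> {x, -x, x-1, x+1, 1-x, -1-x, 1/2, -1/2}"
    proof
      assume "y \<in> {x, -x, x-1, x+1, 1-x, -1-x, 1/2, -1/2}"
      then have "inverse y \<in> inverse ` {x, -x, x-1, x+1, 1-x, -1-x, 1/2, -1/2}" by blast
      moreover have "inverse y = v" by (simp add: y_def inverse_eq_divide)
      ultimately show False using v unfolding T_def x_def by blast
    qed
    have x: "2 * x \<noteq> 1" "2 * x \<noteq> -1"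
      using u uv(1) by (auto simp: x_def divide_eq_eq minus_equation_iff[of u])
    have "x - y = 1 \<Longrightarrow> y = x - 1" "x - y = -1 \<Longrightarrow> y = x + 1" "x + y = 1 \<Longrightarrow> y = 1 - x" "x + y = -1 \<Longrightarrow> y = -1 - x"
      by (metis add_diff_cancel_left' diff_add_cancel diff_diff_eq2 diff_minus_eq_add)+
    moreover have "x = - y \<Longrightarrow> y = - x" by simp
    moreover have "2 * y = 1 \<Longrightarrow> y = 1/2" "2 * y = -1 \<Longrightarrow> y = -1/2"
      by (metis nonzero_mult_div_cancel_left zero_neq_numeral)+
    ultimately have "Qop z x * Qop z y = Qop z y * Qop z x"
      using iy x by (intro Qop_commute) blast+
    then have "P u * P v = P v * P u"
      unfolding x_def y_def QP[OF uv(1)] QP[OF uv(2)] scale_mult_left scale_mult_right scale_scale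
      using uv by (subst (asm) (2) mult.commute) (drule scale_cancel, auto)
    moreover have "P u * P v = (\<Sum>r\<le>?n. \<Sum>s\<le>?n. (u ^ r * v ^ s) *\<^sub>c (?S r * ?S s))"
      unfolding P_def sum_product by (intro sum.cong refl) (simp add: scale_mult_left scale_mult_right scale_scale mult.commute)
    moreover have "P v * P u = (\<Sum>r\<le>?n. \<Sum>s\<le>?n. (u ^ r * v ^ s) *\<^sub>c (?S s * ?S r))"
      unfolding P_def sum_product
      by (subst sum.swap) (intro sum.cong refl, simp add: scale_mult_left scale_mult_right scale_scale mult.commute)
    ultimately show "(\<Sum>r\<le>?n. \<Sum>s\<le>?n. (u ^ r * v ^ s) *\<^sub>c (?S r * ?S s - ?S s * ?S r)) = 0"
      by (simp only: scale_diff_right sum_subtractf) simp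
  qed (use True in auto)
  then show ?thesis using assms by simp
next
  case False
  then have "fps_nth (Sh z) r = 0 \<or> fps_nth (Sh z) s = 0" using Sh_top by (meson not_le)
  then show ?thesis by auto
qed

lemma sop_eq_Sh: "sop spc (tk z) (M, 1, 1) = (\<Sum>r\<le>M. hseries tw (M - r) *\<^sub>c fps_nth (Sh z) r)"
proof -
  have tk: "Abs_fps (\<lambda>r. tk z r i a) = G z i a * geo tw" for i a
    unfolding tk_def twist_fps fps_nth_inverse ..
  have prod: "Abs_fps (\<lambda>r. tk z r 1 a) * fneg (Abs_fps (\<lambda>r. tk z r (- 1) (- a)))
     = (G z 1 a * fneg (G z (-1) (- a))) * Abs_fps (\<lambda>n. hseries tw n *\<^sub>c 1)" for a
  proof -
    have "Abs_fps (\<lambda>r. tk z r 1 a) * fneg (Abs_fps (\<lambda>r. tk z r (- 1) (- a)))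
      = G z 1 a * (geo tw * fneg (G z (-1) (- a))) * fneg (geo tw)"
      unfolding tk fneg_mult mult.assoc ..
    also have "\<dots> = G z 1 a * fneg (G z (-1) (- a)) * (geo tw * fneg (geo tw))"
      unfolding geo_commute mult.assoc ..
    finally show ?thesis unfolding geo_fneg_geo .
  qed
  have "sop spc (tk z) (M, 1, 1) = fps_nth (Sh z * Abs_fps (\<lambda>n. hseries tw n *\<^sub>c 1)) M"
    unfolding sop_fps prod fscale_mult_left[symmetric] sum_distrib_right[symmetric] Sh_def ..
  then show ?thesis by (simp add: fps_mult_nth scale_mult_right atLeast0AtMost)
qed

text \<open>\<open>hseries\<close> is supported in even degrees, so a coefficient of odd index
  involves only odd coefficients of \<open>Sh\<close>.\<close>

lemma sop_odd_commute:
  assumes "odd M" "odd M'"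
  shows "sop spc (tk z) (M, 1, 1) * sop spc (tk z) (M', 1, 1) = sop spc (tk z) (M', 1, 1) * sop spc (tk z) (M, 1, 1)"
proof -
  have "(hseries tw (M - r) *\<^sub>c fps_nth (Sh z) r) * (hseries tw (M' - s) *\<^sub>c fps_nth (Sh z) s)
      = (hseries tw (M' - s) *\<^sub>c fps_nth (Sh z) s) * (hseries tw (M - r) *\<^sub>c fps_nth (Sh z) r)"
    if "r \<le> M" "s \<le> M'" for r s
  proof (cases "odd r \<and> odd s")
    case True
    then show ?thesis
      using Sh_odd_commute[of r s z] by (simp add: scale_mult_left scale_mult_right scale_scale mult.commute)
  next
    case False
    then have "hseries tw (M - r) = 0 \<or> hseries tw (M' - s) = 0" using that assms by (auto simp: hseries_def)
    then show ?thesis by (auto simp: scale_zero_left)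
  qed
  then show ?thesis
    unfolding sop_eq_Sh sum_product by (subst (2) sum.swap) (intro sum.cong refl, simp)
qed

text \<open>Multiplication by 1 - \<open>tw\<close>^2 X^2 inverts the factor \<open>hseries\<close>.
  It preserves parity, so the odd coefficients of \<open>Sh\<close> come from the odd
  generators.\<close>

lemma Sh_eq_sop: "fps_nth (Sh z) M = sop spc (tk z) (M, 1, 1) - (if M \<ge> 2 then tw\<^sup>2 *\<^sub>c sop spc (tk z) (M - 2, 1, 1) else 0)"
proof (cases "M \<ge> 2")
  case True
  then obtain n where M: "M = Suc (Suc n)" by (metis add_2_eq_Suc le_Suc_ex)
  have "sop spc (tk z) (M, 1, 1) = (\<Sum>r\<le>n. hseries tw (M - r) *\<^sub>c fps_nth (Sh z) r) + fps_nth (Sh z) M"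
    unfolding sop_eq_Sh M by (simp add: hseries_def scale_one scale_zero_left)
  also have "(\<Sum>r\<le>n. hseries tw (M - r) *\<^sub>c fps_nth (Sh z) r) = tw\<^sup>2 *\<^sub>c sop spc (tk z) (n, 1, 1)"
    unfolding sop_eq_Sh scale_sum_right M
    by (intro sum.cong refl) (simp add: Suc_diff_le hseries_even scale_scale)
  finally show ?thesis using M by simp
next
  case False
  then have "M = 0 \<or> M = 1" by auto
  then show ?thesis by (auto simp: sop_eq_Sh hseries_def scale_one scale_zero_left)
qed

end

section \<open>The image of the subalgebra commutes with Q\<close>

lemma malg_sum:
  assumes "finite S" "\<And>i. i \<in> S \<Longrightarrow> f i \<in> malg J \<G>"
  shows "(\<lambda>p q. \<Sum>i\<in>S. f i p q) \<in> malg J \<G>"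
  using assms
proof (induction S rule: finite_induct)
  case empty
  then show ?case using malg.smult[OF malg.one, of 0 J \<G>] by simp
next
  case (insert i S)
  then show ?case using malg.add[of "f i" J \<G> "\<lambda>p q. \<Sum>i\<in>S. f i p q"] by simp
qed

context multiplicity_space
begin

text \<open>The twist multiplies $s(u)$ by $\lambda(u) \lambda(-u) = (1 - \mu^2 u^{-2})^{-1}$, which the
correction term with \<open>tw\<close> undoes.\<close>

definition Bmat :: "(nat \<Rightarrow> complex) \<Rightarrow> complex \<Rightarrow> Defs.mat" where
  "Bmat z u = (\<lambda>p q. (-1) ^ Suc k * (\<Sum>r\<in>{r. r \<le> 2 * Suc k \<and> odd r}. 2 * u ^ (2 * Suc k - r) *
     (Sop spc k lam mu z (r, 1, 1) p q + (if r \<ge> 2 then - tw\<^sup>2 else 0) * Sop spc k lam mu z (r - 2, 1, 1) p q)))"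

lemma rep_Bmat: "rep (Bmat z u) (Qop z u)"
proof -
  have "rep (Bmat z u) ((-1) ^ Suc k *\<^sub>c (\<Sum>r\<in>{r. r \<le> 2 * Suc k \<and> odd r}. (2 * u ^ (2 * Suc k - r)) *\<^sub>c
      (sop spc (tk z) (r, 1, 1) + (if r \<ge> 2 then - tw\<^sup>2 else 0) *\<^sub>c sop spc (tk z) (r - 2, 1, 1))))"
    unfolding Bmat_def by (intro rep_scale rep_sum rep_add rep_Sop) auto
  moreover have "(\<Sum>r\<in>{r. r \<le> 2 * Suc k \<and> odd r}. (2 * u ^ (2 * Suc k - r)) *\<^sub>c
      (sop spc (tk z) (r, 1, 1) + (if r \<ge> 2 then - tw\<^sup>2 else 0) *\<^sub>c sop spc (tk z) (r - 2, 1, 1)))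
     = (\<Sum>r\<le>2 * Suc k. (2 * u ^ (2 * Suc k - r)) *\<^sub>c (if odd r then fps_nth (Sh z) r else 0))"
    by (rule sum.mono_neutral_cong_left) (auto simp: scale_zero_right Sh_eq_sop scale_minus_left scale_zero_left)
  ultimately show ?thesis by (simp only: Qop_eq)
qed

lemma Sop_odd_in_Bimage: "odd r \<Longrightarrow> Sop spc k lam mu z (r, 1, 1) \<in> Bimage spc k lam mu z"
  unfolding Bimage_def by (rule malg.gen) (auto elim!: oddE)

lemma Bmat_in_Bimage: "Bmat z u \<in> Bimage spc k lam mu z"
proof -
  have a: "Sop spc k lam mu z (r, 1, 1) \<in> malg I ({meval I (Sop spc k lam mu z) P | P. tw_central spc P} \<union> {Sop spc k lam mu z (2 * m + 1, 1, 1) | m. True})"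
    if "odd r" for r
    using Sop_odd_in_Bimage[OF that] unfolding Bimage_def .
  let ?M = "malg I ({meval I (Sop spc k lam mu z) P | P. tw_central spc P} \<union> {Sop spc k lam mu z (2 * m + 1, 1, 1) | m. True})"
  have trm: "(\<lambda>p q. 2 * u ^ (2 * Suc k - r) *
     (Sop spc k lam mu z (r, 1, 1) p q + (if r \<ge> 2 then - tw\<^sup>2 else 0) * Sop spc k lam mu z (r - 2, 1, 1) p q)) \<in> ?M"
    if r: "odd r" for r
  proof (rule malg.smult, rule malg.add)
    show "Sop spc k lam mu z (r, 1, 1) \<in> ?M" by (rule a[OF r])
    show "(\<lambda>p q. (if r \<ge> 2 then - tw\<^sup>2 else 0) * Sop spc k lam mu z (r - 2, 1, 1) p q) \<in> ?M"
    proof (cases "r \<ge> 2")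
      case True
      then have "odd (r - 2)" using r by simp
      then show ?thesis by (intro malg.smult a)
    next
      \<comment> \<open>Here r = 1: the index \<open>r - 2\<close> is cut off to 0, and the
        coefficient 0 removes this even generator.\<close>
      case False
      then show ?thesis using malg.smult[OF malg.one, of 0 I] by simp
    qed
  qed
  show ?thesis unfolding Bmat_def Bimage_def
  proof (rule malg.smult, rule malg_sum)
    fix r assume "r \<in> {r. r \<le> 2 * Suc k \<and> odd r}"
    then show "(\<lambda>p q. 2 * u ^ (2 * Suc k - r) *
     (Sop spc k lam mu z (r, 1, 1) p q + (if r \<ge> 2 then - tw\<^sup>2 else 0) * Sop spc k lam mu z (r - 2, 1, 1) p q)) \<in> ?M"
      by (intro trm) simp
  qed simp
qed

lemma rep_meval:
  assumes "s_poly P"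
  shows "rep (meval I (Sop spc k lam mu z) P) (fa_eval (sop spc (tk z)) P)"
proof -
  have gen: "rep (Sop spc k lam mu z g) (sop spc (tk z) g)" if "g \<in> sgens" for g
    using that rep_Sop by (auto simp: sgens_def)
  have word: "rep (mprod I (map (Sop spc k lam mu z) w)) (prod_list (map (sop spc (tk z)) w))" if "set w \<subseteq> sgens" for w
    using that by (induction w) (auto simp: mprod_def intro: rep_mid rep_mult gen)
  show ?thesis
    unfolding meval_def fa_eval_def
    by (intro rep_sum rep_scale word) (use assms in \<open>auto simp: s_poly_def\<close>)
qed

text \<open>Commutation is carried by an operator \<open>Y\<close> lifting \<open>X\<close>, because
  the ideal argument for the centre speaks about operators of a Yangian representation. Both kinds
  of generators have such lifts, and commuting with all odd s_11 is stable under the algebra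
  operations.\<close>

lemma Bimage_rep:
  assumes "X \<in> Bimage spc k lam mu z"
  shows "\<exists>Y. rep X Y \<and> (\<forall>r. odd r \<longrightarrow> Y * sop spc (tk z) (r, 1, 1) = sop spc (tk z) (r, 1, 1) * Y)"
  using assms unfolding Bimage_def
proof (induction rule: malg.induct)
  case (gen X)
  then consider P where "X = meval I (Sop spc k lam mu z) P" "tw_central spc P"
    | m where "X = Sop spc k lam mu z (2 * m + 1, 1, 1)" by auto
  then show ?case
  proof cases
    case 1
    have "(r, 1, 1) \<in> sgens" if "odd r" for r using that by (simp add: sgens_def odd_pos Suc_leI)
    then show ?thesis
      using rep_meval[of P z] central_commutes[OF yangian_rep_tk 1(2)] 1
      by (intro exI[of _ "fa_eval (sop spc (tk z)) P"]) (simp add: tw_central_def)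
  next
    case 2
    have "odd (2 * m + 1)" by simp
    then show ?thesis using 2 rep_Sop[of 1 1 z "2 * m + 1"] sop_odd_commute[of "2 * m + 1"]
      by (intro exI[of _ "sop spc (tk z) (2 * m + 1, 1, 1)"]) simp
  qed
next
  case one
  show ?case using rep_mid by (intro exI[of _ 1]) simp
next
  case (add X Y)
  from add.IH obtain X' where X': "rep X X'" "\<forall>r. odd r \<longrightarrow> X' * sop spc (tk z) (r, 1, 1) = sop spc (tk z) (r, 1, 1) * X'" by (elim exE conjE)
  from add.IH obtain Y' where Y': "rep Y Y'" "\<forall>r. odd r \<longrightarrow> Y' * sop spc (tk z) (r, 1, 1) = sop spc (tk z) (r, 1, 1) * Y'" by (elim exE conjE)
  show ?case
  proof (intro exI[of _ "X' + Y'"] conjI allI impI)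
    show "rep (\<lambda>p q. X p q + Y p q) (X' + Y')" by (rule rep_add[OF X'(1) Y'(1)])
    fix r :: nat assume "odd r"
    then have "X' * sop spc (tk z) (r, 1, 1) = sop spc (tk z) (r, 1, 1) * X'"
      "Y' * sop spc (tk z) (r, 1, 1) = sop spc (tk z) (r, 1, 1) * Y'" using X'(2) Y'(2) by blast+
    then show "(X' + Y') * sop spc (tk z) (r, 1, 1) = sop spc (tk z) (r, 1, 1) * (X' + Y')"
      by (simp only: distrib_left distrib_right)
  qed
next
  case (smult X c)
  from smult.IH obtain X' where X': "rep X X'" "\<forall>r. odd r \<longrightarrow> X' * sop spc (tk z) (r, 1, 1) = sop spc (tk z) (r, 1, 1) * X'" by (elim exE conjE)
  show ?case
  proof (intro exI[of _ "c *\<^sub>c X'"] conjI allI impI)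
    show "rep (\<lambda>p q. c * X p q) (c *\<^sub>c X')" by (rule rep_scale[OF X'(1)])
    fix r :: nat assume "odd r"
    then have "X' * sop spc (tk z) (r, 1, 1) = sop spc (tk z) (r, 1, 1) * X'" using X'(2) by blast
    then show "(c *\<^sub>c X') * sop spc (tk z) (r, 1, 1) = sop spc (tk z) (r, 1, 1) * (c *\<^sub>c X')"
      by (simp only: scale_mult_left scale_mult_right)
  qed
next
  case (mul X Y)
  from mul.IH obtain X' where X': "rep X X'" "\<forall>r. odd r \<longrightarrow> X' * sop spc (tk z) (r, 1, 1) = sop spc (tk z) (r, 1, 1) * X'" by (elim exE conjE)
  from mul.IH obtain Y' where Y': "rep Y Y'" "\<forall>r. odd r \<longrightarrow> Y' * sop spc (tk z) (r, 1, 1) = sop spc (tk z) (r, 1, 1) * Y'" by (elim exE conjE)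
  show ?case
  proof (intro exI[of _ "X' * Y'"] conjI allI impI)
    show "rep (mmul I X Y) (X' * Y')" by (rule rep_mult[OF X'(1) Y'(1)])
    fix r :: nat assume r: "odd r"
    let ?s = "sop spc (tk z) (r, 1, 1)"
    have X: "X' * ?s = ?s * X'" and Y: "Y' * ?s = ?s * Y'" using X'(2) Y'(2) r by blast+
    have "X' * Y' * ?s = X' * ?s * Y'" unfolding mult.assoc Y ..
    then show "X' * Y' * ?s = ?s * (X' * Y')" unfolding X mult.assoc .
  qed
qed

text \<open>The lifts commute, and on I a matrix is determined by an operator that it
  represents.\<close>

lemma Bmat_commute:
  assumes "X \<in> Bimage spc k lam mu z" "p \<in> I" "q \<in> I"
  shows "mmul I X (Bmat z u) p q = mmul I (Bmat z u) X p q"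
proof -
  from Bimage_rep[OF assms(1)] obtain Y where Y: "rep X Y"
    "\<And>r. odd r \<Longrightarrow> Y * sop spc (tk z) (r, 1, 1) = sop spc (tk z) (r, 1, 1) * Y" by blast
  have Sh: "Y * fps_nth (Sh z) r = fps_nth (Sh z) r * Y" if "odd r" for r
    unfolding Sh_eq_sop using that Y(2)[of r] Y(2)[of "r - 2"]
    by (simp add: algebra_simps scale_mult_left scale_mult_right)
  have "Y * Qop z u = Qop z u * Y"
    unfolding Qop_eq scale_mult_left scale_mult_right sum_distrib_left sum_distrib_right
    by (intro arg_cong2[where f=scale] refl sum.cong) (simp add: Sh scale_mult_left scale_mult_right)
  then show ?thesis
    using rep_unique[OF rep_mult[OF Y(1) rep_Bmat] _ assms(2,3), of "mmul I (Bmat z u) X"] rep_mult[OF rep_Bmat Y(1)] by simp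
qed

end

section \<open>Eigenvectors of a polynomial family of matrices along a ray\<close>

text \<open>A nonconstant gcd has a complex root, which is a common root of p and its
  derivative.\<close>

lemma degree_gcd_pderiv_eq_0_iff:
  fixes p :: "complex poly"
  assumes "p \<noteq> 0"
  shows "degree (gcd p (pderiv p)) = 0 \<longleftrightarrow> rsquarefree p"
proof -
  let ?g = "gcd p (pderiv p)"
  have "?g \<noteq> 0" using assms by simp
  have "degree ?g \<noteq> 0 \<longleftrightarrow> (\<exists>a. poly ?g a = 0)"
  proof
    assume "degree ?g \<noteq> 0"
    then show "\<exists>a. poly ?g a = 0"
      using fundamental_theorem_of_algebra constant_degree by metis
  next
    assume "\<exists>a. poly ?g a = 0"
    then show "degree ?g \<noteq> 0"
      using \<open>?g \<noteq> 0\<close> by (metis poly_const_conv degree_eq_zeroE pCons_0_0)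
  qed
  also have "\<dots> \<longleftrightarrow> (\<exists>a. poly p a = 0 \<and> poly (pderiv p) a = 0)"
    by (simp add: poly_eq_0_iff_dvd)
  finally show ?thesis unfolding rsquarefree_roots by blast
qed

text \<open>The resultant of the characteristic polynomial and its derivative is a polynomial in
  \<eta>. The characteristic polynomial is monic, so no degree drops under specialisation and the
  resultant specialises as well; at \<eta> = 0 it is nonzero.\<close>

lemma finite_char_poly_multiple_roots:
  fixes A :: "complex poly mat"
  assumes A: "A \<in> carrier_mat n n"
    and 0: "card {x. poly (char_poly (map_mat (\<lambda>p. poly p 0) A)) x = 0} = n"
  shows "finite {\<eta>. card {x. poly (char_poly (map_mat (\<lambda>p. poly p \<eta>) A)) x = 0} \<noteq> n}"
proof -
  let ?c = "\<lambda>\<eta>. char_poly (map_mat (\<lambda>p. poly p \<eta>) A)"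
  define R where "R = resultant (char_poly A) (pderiv (char_poly A))"
  have Ah: "map_mat (\<lambda>p. poly p \<eta>) A \<in> carrier_mat n n" for \<eta> using A by simp
  have deg: "degree (?c \<eta>) = n" "coeff (?c \<eta>) n = 1" for \<eta>
    using degree_monic_char_poly[OF Ah[of \<eta>]] by auto
  then have nz: "?c \<eta> \<noteq> 0" for \<eta> by (metis coeff_0 zero_neq_one)
  have hom: "?c \<eta> = map_poly (\<lambda>p. poly p \<eta>) (char_poly A)" for \<eta>
    by (rule poly_hom.char_poly_hom[OF A])
  have degA: "degree (char_poly A) = n" using degree_monic_char_poly[OF A] by simp
  have pder: "pderiv (?c \<eta>) = map_poly (\<lambda>p. poly p \<eta>) (pderiv (char_poly A))" for \<eta>
    unfolding hom by (simp add: poly_eq_iff coeff_pderiv coeff_map_poly)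
  have dpder: "degree (pderiv (char_poly A)) = n - 1"
    using degA degree_pderiv[of "char_poly A"] by simp
  have R: "poly R \<eta> = resultant (?c \<eta>) (pderiv (?c \<eta>))" for \<eta>
  proof -
    have "degree (pderiv (?c \<eta>)) = n - 1" using deg degree_pderiv[of "?c \<eta>"] by simp
    then show ?thesis
      unfolding R_def using poly_hom.resultant_map_poly[of \<eta> "char_poly A" "pderiv (char_poly A)"] deg[of \<eta>] degA dpder
      by (simp add: hom[symmetric] pder[symmetric])
  qed
  have card: "card {x. poly (?c \<eta>) x = 0} = n \<longleftrightarrow> poly R \<eta> \<noteq> 0" for \<eta>
    unfolding R resultant_0_gcd using degree_gcd_pderiv_eq_0_iff[OF nz[of \<eta>]] rsquarefree_card_degree[OF nz[of \<eta>]] deg[of \<eta>]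
    by simp
  have "R \<noteq> 0" using card[of 0] 0 by auto
  then have "finite {\<eta>. poly R \<eta> = 0}" by (rule poly_roots_finite)
  then show ?thesis using card by simp
qed

text \<open>If all n roots were at distance at least e from x, the product of these distances, which
  is the norm of p(x), would be at least e^n.\<close>

lemma monic_root_near:
  fixes p :: "complex poly"
  assumes "degree p = n" "lead_coeff p = 1" "card {x. poly p x = 0} = n" "0 \<le> e" "norm (poly p x) < e ^ n"
  shows "\<exists>y. poly p y = 0 \<and> dist x y < e"
proof (rule ccontr)
  assume "\<not> ?thesis"
  then have far: "\<And>y. poly p y = 0 \<Longrightarrow> e \<le> norm (x - y)" by (force simp: dist_norm)
  have "p \<noteq> 0" using assms(2) by auto
  then have "rsquarefree p" using rsquarefree_card_degree assms by blast
  define R where "R = {z. poly p z = 0}"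
  from complex_poly_decompose_rsquarefree[OF \<open>rsquarefree p\<close>]
  have "(\<Prod>z\<in>R. [:- z, 1:]) = p" using assms(2) by (simp add: R_def)
  then have "poly p x = (\<Prod>z\<in>R. x - z)" by (auto simp: poly_prod)
  then have "norm (poly p x) = (\<Prod>z\<in>R. norm (x - z))" by (simp add: prod_norm)
  also have "\<dots> \<ge> (\<Prod>z\<in>R. e)"
    by (rule prod_mono) (use far assms(4) in \<open>auto simp: R_def\<close>)
  finally show False using assms(3,5) by (simp add: R_def)
qed

text \<open>The pairs (r, root of p r) form a covering space of the half-line, because n simple
  roots stay n separate roots nearby. The half-line is simply connected, so every root at 0 lifts to
  a continuous path; two lifts that meet once coincide, which keeps distinct paths apart.\<close>

lemma roots_lift:
  fixes p :: "real \<Rightarrow> complex poly"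
  assumes deg: "\<And>r. r \<ge> 0 \<Longrightarrow> degree (p r) = n" and lead: "\<And>r. r \<ge> 0 \<Longrightarrow> lead_coeff (p r) = 1"
    and card: "\<And>r. r \<ge> 0 \<Longrightarrow> card {x. poly (p r) x = 0} = n"
    and cont: "\<And>x. continuous_on {0..} (\<lambda>r. poly (p r) x)"
    and n: "n > 0"
  shows "\<exists>g. \<forall>x. poly (p 0) x = 0 \<longrightarrow> continuous_on {0..} (g x) \<and> g x 0 = x \<and>
    (\<forall>r\<ge>0. poly (p r) (g x r) = 0 \<and> (\<forall>y. poly (p 0) y = 0 \<longrightarrow> x \<noteq> y \<longrightarrow> g x r \<noteq> g y r))"
proof -
  have near: "\<forall>\<^sub>F r in at r0 within {0..}. \<exists>y. poly (p r) y = 0 \<and> dist x y < e"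
    if "r0 \<ge> 0" "poly (p r0) x = 0" "e > 0" for r0 x e
  proof -
    have "((\<lambda>r. poly (p r) x) \<longlongrightarrow> poly (p r0) x) (at r0 within {0..})"
      using cont[of x] that(1) by (simp add: continuous_on_def)
    then have "((\<lambda>r. norm (poly (p r) x)) \<longlongrightarrow> 0) (at r0 within {0..})"
      using that(2) by (simp add: tendsto_norm_zero)
    then have "\<forall>\<^sub>F r in at r0 within {0..}. norm (poly (p r) x) < e ^ n"
      using that(3) by (intro order_tendstoD(2)[where y=0]) auto
    moreover have "\<forall>\<^sub>F r in at r0 within {0..}. r \<in> {0..}"
      unfolding eventually_at_filter by simp
    ultimately show ?thesis
      by eventually_elim (use monic_root_near deg lead card that(3) in auto)
  qed
  define C where "C = {z. fst z \<ge> 0 \<and> poly (p (fst z)) (snd z) = 0}"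
  have fin: "finite {x. poly (p r) x = 0}" if "r \<ge> 0" for r
    using card[OF that] n by (metis card.infinite less_numeral_extra(3))
  \<comment> \<open>The radius \<open>e\<close> isolates the roots at r0; for r within
    \<open>d\<close> of r0 every such ball contains exactly one root of \<open>p r\<close>, and no
    root lies outside the balls.\<close>
  define isol where "isol r0 e d \<longleftrightarrow> (\<forall>x y. poly (p r0) x = 0 \<longrightarrow> poly (p r0) y = 0 \<longrightarrow> x \<noteq> y \<longrightarrow> ball x e \<inter> ball y e = {}) \<and>
      (\<forall>r. r \<ge> 0 \<longrightarrow> dist r r0 < d \<longrightarrow> (\<forall>y. poly (p r) y = 0 \<longrightarrow> (\<exists>x. poly (p r0) x = 0 \<and> y \<in> ball x e)) \<and>
        (\<forall>x. poly (p r0) x = 0 \<longrightarrow> (\<exists>!y. poly (p r) y = 0 \<and> y \<in> ball x e)))" for r0 e d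
  have local: "\<exists>e d. e > 0 \<and> d > 0 \<and> isol r0 e d"
    if r0: "r0 \<ge> 0" for r0
  proof -
    let ?R = "\<lambda>r. {x. poly (p r) x = 0}"
    have "\<forall>\<^sub>F e in at_right 0. \<forall>x\<in>?R r0. \<forall>y\<in>?R r0. x \<noteq> y \<longrightarrow> e < dist x y / 2"
    proof (intro eventually_ball_finite[OF fin[OF r0]] ballI)
      fix x y :: complex
      show "\<forall>\<^sub>F e in at_right 0. x \<noteq> y \<longrightarrow> e < dist x y / 2"
      proof (cases "x = y")
        case False
        then have "\<forall>\<^sub>F e in at_right 0. e < dist x y / 2" by (intro eventually_at_rightI[of 0 "dist x y / 2"]) auto
        then show ?thesis by eventually_elim simp
      qed simp
    qed
    moreover have "\<forall>\<^sub>F e in at_right (0::real). e > 0" by (simp add: eventually_at_right_less)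
    ultimately have "\<forall>\<^sub>F e in at_right 0. e > 0 \<and> (\<forall>x\<in>?R r0. \<forall>y\<in>?R r0. x \<noteq> y \<longrightarrow> e < dist x y / 2)"
      by eventually_elim auto
    from eventually_happens'[OF trivial_limit_at_right_real this]
    obtain e where e: "e > 0" "\<And>x y. x \<in> ?R r0 \<Longrightarrow> y \<in> ?R r0 \<Longrightarrow> x \<noteq> y \<Longrightarrow> e < dist x y / 2"
      by blast
    have dis: "ball x e \<inter> ball y e = {}" if "x \<in> ?R r0" "y \<in> ?R r0" "x \<noteq> y" for x y
    proof -
      { fix z assume "z \<in> ball x e" "z \<in> ball y e"
        then have "dist x y < 2 * e" using dist_triangle2[of x y z] by (simp add: dist_commute)
        with e(2)[OF that] have False by simp }
      then show ?thesis by blast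
    qed
    have "\<forall>\<^sub>F r in at r0 within {0..}. \<forall>x\<in>?R r0. \<exists>y. poly (p r) y = 0 \<and> dist x y < e"
      by (intro eventually_ball_finite fin r0 ballI near) (use e(1) in auto)
    then obtain d where d: "d > 0" "\<And>r. r \<ge> 0 \<Longrightarrow> r \<noteq> r0 \<Longrightarrow> dist r r0 < d \<Longrightarrow> \<forall>x\<in>?R r0. \<exists>y. poly (p r) y = 0 \<and> dist x y < e"
      unfolding eventually_at by auto
    have ex: "\<forall>x\<in>?R r0. \<exists>y. poly (p r) y = 0 \<and> dist x y < e" if "r \<ge> 0" "dist r r0 < d" for r
    proof (cases "r = r0")
      case True
      show ?thesis
      proof
        fix x assume "x \<in> ?R r0"
        then show "\<exists>y. poly (p r) y = 0 \<and> dist x y < e" unfolding True using e(1) by (intro exI[of _ x]) simp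
      qed
    qed (use d(2)[OF that(1) _ that(2)] in blast)
    have "(\<forall>y. poly (p r) y = 0 \<longrightarrow> (\<exists>x. poly (p r0) x = 0 \<and> y \<in> ball x e)) \<and>
        (\<forall>x. poly (p r0) x = 0 \<longrightarrow> (\<exists>!y. poly (p r) y = 0 \<and> y \<in> ball x e))" if r: "r \<ge> 0" "dist r r0 < d" for r
    proof -
      from bchoice[OF ex[OF r]] obtain f where f: "\<And>x. x \<in> ?R r0 \<Longrightarrow> poly (p r) (f x) = 0 \<and> f x \<in> ball x e"
        by auto
      \<comment> \<open>Each root at r0 has its own root of \<open>p r\<close> nearby. Both sets
        have n elements, so all roots of \<open>p r\<close> arise in this way.\<close>
      have "inj_on f (?R r0)"
        by (rule inj_onI, rule ccontr) (use f dis in \<open>metis IntI empty_iff\<close>)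
      then have "card (f ` ?R r0) = card (?R r)" using card_image[of f "?R r0"] card r0 r(1) by simp
      then have im: "f ` ?R r0 = ?R r"
        by (intro card_subset_eq[OF fin[OF r(1)]]) (use f in auto)
      have 1: "\<exists>x. x \<in> ?R r0 \<and> y = f x" if "poly (p r) y = 0" for y
        using im that by blast
      have 2: "y = f x" if "poly (p r) y = 0" "x \<in> ?R r0" "y \<in> ball x e" for x y
        using 1[OF that(1)] f dis that(2,3) by (metis IntI empty_iff)
      show ?thesis
      proof (intro conjI allI impI)
        fix y assume "poly (p r) y = 0"
        then show "\<exists>x. poly (p r0) x = 0 \<and> y \<in> ball x e" using 1[of y] f by auto
      next
        fix x assume x: "poly (p r0) x = 0"
        show "\<exists>!y. poly (p r) y = 0 \<and> y \<in> ball x e"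
          by (rule ex1I[of _ "f x"]) (use f x 2[of _ x] in auto)
      qed
    qed
    with dis show ?thesis
      by (intro exI[of _ e] exI[of _ d] conjI e(1) d(1)) (simp add: isol_def)
  qed
  have cov: "covering_space C fst {0..}"
    unfolding covering_space_def
  proof (intro conjI ballI)
    show "continuous_on C fst" by (intro continuous_intros)
    have "\<exists>y. poly (p r) y = 0" if "r \<ge> 0" for r
      using card[OF that] n by (metis (mono_tags, lifting) Collect_empty_eq card.empty less_numeral_extra(3))
    then show "fst ` C = {0..}" unfolding C_def by (auto simp: image_iff)
    fix r0 :: real assume "r0 \<in> {0..}"
    then have r0: "r0 \<ge> 0" by simp
    from local[OF r0] obtain e d where ed: "e > 0" "d > 0" and isol: "isol r0 e d"
      by blast
    have dis: "\<And>x y. poly (p r0) x = 0 \<Longrightarrow> poly (p r0) y = 0 \<Longrightarrow> x \<noteq> y \<Longrightarrow> ball x e \<inter> ball y e = {}"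
      and ex: "\<And>r y. r \<ge> 0 \<Longrightarrow> dist r r0 < d \<Longrightarrow> poly (p r) y = 0 \<Longrightarrow> (\<exists>x. poly (p r0) x = 0 \<and> y \<in> ball x e)"
      and uniq: "\<And>r x. r \<ge> 0 \<Longrightarrow> dist r r0 < d \<Longrightarrow> poly (p r0) x = 0 \<Longrightarrow> (\<exists>!y. poly (p r) y = 0 \<and> y \<in> ball x e)"
      using isol unfolding isol_def by simp_all
    define T where "T = {0..} \<inter> ball r0 d"
    define V where "V x = C \<inter> (ball r0 d \<times> ball x e)" for x
    show "\<exists>T. r0 \<in> T \<and> openin (top_of_set {0..}) T \<and> (\<exists>v. \<Union> v = C \<inter> fst -` T \<and>
            (\<forall>u\<in>v. openin (top_of_set C) u) \<and> pairwise disjnt v \<and> (\<forall>u\<in>v. \<exists>q. homeomorphism u T fst q))"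
    proof (intro exI[of _ T] conjI exI[of _ "V ` {x. poly (p r0) x = 0}"] ballI)
      show "r0 \<in> T" using r0 ed by (simp add: T_def)
      show "openin (top_of_set {0..}) T" unfolding T_def by (intro openin_open_Int) simp
      show "\<Union> (V ` {x. poly (p r0) x = 0}) = C \<inter> fst -` T"
      proof (intro equalityI subsetI)
        fix z assume z: "z \<in> C \<inter> fst -` T"
        then obtain x where "poly (p r0) x = 0" "snd z \<in> ball x e"
          using ex[of "fst z" "snd z"] by (auto simp: C_def T_def dist_commute)
        with z show "z \<in> \<Union> (V ` {x. poly (p r0) x = 0})"
          by (auto simp: V_def T_def mem_Times_iff)
      qed (auto simp: V_def T_def C_def)
      show "pairwise disjnt (V ` {x. poly (p r0) x = 0})"
        unfolding pairwise_def
      proof (intro ballI impI)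
        fix u w assume "u \<in> V ` {x. poly (p r0) x = 0}" "w \<in> V ` {x. poly (p r0) x = 0}" "u \<noteq> w"
        then obtain x y where "poly (p r0) x = 0" "poly (p r0) y = 0" "u = V x" "w = V y" "x \<noteq> y" by auto
        with dis[of x y] show "disjnt u w" by (auto simp: disjnt_def V_def)
      qed
      fix u assume "u \<in> V ` {x. poly (p r0) x = 0}"
      then obtain x where x: "poly (p r0) x = 0" and u: "u = V x" by auto
      show "openin (top_of_set C) u" unfolding u V_def by (intro openin_open_Int open_Times) auto
      define h where "h r = (THE y. poly (p r) y = 0 \<and> y \<in> ball x e)" for r
      have h: "poly (p r) (h r) = 0" "h r \<in> ball x e" if "r \<in> T" for r
      proof -
        from that have r: "r \<ge> 0" "dist r r0 < d" by (auto simp: T_def dist_commute)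
        from theI'[OF uniq[OF r x]] show "poly (p r) (h r) = 0" "h r \<in> ball x e" by (simp_all add: h_def)
      qed
      have h_eq: "y = h r" if "r \<in> T" "poly (p r) y = 0" "y \<in> ball x e" for r y
      proof -
        from that have r: "r \<ge> 0" "dist r r0 < d" by (auto simp: T_def dist_commute)
        from uniq[OF r x] h[OF that(1)] that(2,3) show ?thesis by blast
      qed
      have conth: "continuous_on T h"
        unfolding continuous_on_def
      proof (intro ballI tendstoI)
        fix r1 and e' :: real assume r1: "r1 \<in> T" and e': "e' > 0"
        \<comment> \<open>Staying closer than the distance to the boundary of the ball keeps the
          nearby root inside it, where it must be \<open>h r\<close>.\<close>
        have "0 < min e' (e - dist x (h r1))" using h(2)[OF r1] e' by simp
        have "r1 \<ge> 0" using r1 by (simp add: T_def)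
        from near[OF this h(1)[OF r1] \<open>0 < min e' (e - dist x (h r1))\<close>]
        have "\<forall>\<^sub>F r in at r1 within {0..}. \<exists>y. poly (p r) y = 0 \<and> dist (h r1) y < min e' (e - dist x (h r1))"
          .
        then have "\<forall>\<^sub>F r in at r1 within T. \<exists>y. poly (p r) y = 0 \<and> dist (h r1) y < min e' (e - dist x (h r1))"
          by (rule filter_leD[rotated]) (intro at_le, simp add: T_def)
        moreover have "\<forall>\<^sub>F r in at r1 within T. r \<in> T"
          unfolding eventually_at_filter by simp
        ultimately show "\<forall>\<^sub>F r in at r1 within T. dist (h r) (h r1) < e'"
        proof eventually_elim
          case (elim r)
          then obtain y where y: "poly (p r) y = 0" "dist (h r1) y < e'" "dist (h r1) y < e - dist x (h r1)" by auto
          then have "y \<in> ball x e" using dist_triangle[of x y "h r1"] by simp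
          from h_eq[OF elim(2) y(1) this] y(2) show ?case by (simp add: dist_commute)
        qed
      qed
      have "homeomorphism u T fst (\<lambda>r. (r, h r))"
        unfolding homeomorphism_def
      proof (intro conjI ballI)
        show "continuous_on u fst" by (intro continuous_intros)
        show "continuous_on T (\<lambda>r. (r, h r))" by (intro continuous_intros conth)
        show im: "(\<lambda>r. (r, h r)) ` T = u"
        proof (intro equalityI subsetI)
          fix z assume "z \<in> (\<lambda>r. (r, h r)) ` T"
          then obtain r where r: "r \<in> T" "z = (r, h r)" by auto
          then have "r \<ge> 0" "r \<in> ball r0 d" by (auto simp: T_def)
          with h[OF r(1)] r(2) show "z \<in> u" unfolding u V_def C_def by simp
        next
          fix z assume z: "z \<in> u"
          then have "fst z \<in> T" "poly (p (fst z)) (snd z) = 0" "snd z \<in> ball x e"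
            unfolding u V_def C_def T_def by auto
          with h_eq[of "fst z" "snd z"] show "z \<in> (\<lambda>r. (r, h r)) ` T"
            by (intro image_eqI[of _ _ "fst z"]) (simp_all add: prod_eq_iff)
        qed
        show "fst ` u = T" unfolding im[symmetric] image_image by simp
        show "(fst z, h (fst z)) = z" if "z \<in> u" for z using that unfolding im[symmetric] by auto
        show "fst (r, h r) = r" for r by simp
      qed
      then show "\<exists>q. homeomorphism u T fst q" by blast
    qed
  qed
  define lift where "lift x G \<longleftrightarrow> continuous_on {0..} G \<and> G ` {0..} \<subseteq> C \<and> G 0 = (0, x) \<and> (\<forall>r\<ge>0. fst (G r) = r)"
    for x and G :: "real \<Rightarrow> real \<times> complex"
  define G where "G x = (SOME G. lift x G)" for x
  have lift: "lift x (G x)" if x: "poly (p 0) x = 0" for x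
  proof -
    have "(0, x) \<in> C" using x by (simp add: C_def)
    then obtain G where "continuous_on {0..} G" "G \<in> {0..} \<rightarrow> C" "G 0 = (0, x)" "\<And>y. y \<in> {0..} \<Longrightarrow> fst (G y) = y"
      by (rule covering_space_lift_strong[OF cov, of "(0,x)" 0 "{0..}" "\<lambda>r. r"])
        (simp_all add: convex_imp_simply_connected convex_imp_locally_path_connected)
    then have "\<exists>G. lift x G" by (intro exI[of _ G]) (auto simp: lift_def)
    then show ?thesis unfolding G_def by (rule someI_ex)
  qed
  have G: "continuous_on {0..} (G x)" "G x ` {0..} \<subseteq> C" "G x 0 = (0, x)" "r \<ge> 0 \<Longrightarrow> fst (G x r) = r"
    if "poly (p 0) x = 0" for x r
    using lift[OF that] by (auto simp: lift_def)
  show ?thesis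
  proof (intro exI[of _ "\<lambda>x r. snd (G x r)"] allI impI conjI)
    fix x assume x: "poly (p 0) x = 0"
    show "continuous_on {0..} (\<lambda>r. snd (G x r))" by (intro continuous_intros G x)
    show "snd (G x 0) = x" using G(3)[OF x] by simp
    show "poly (p r) (snd (G x r)) = 0" if "r \<ge> 0" for r
    proof -
      have "G x r \<in> C" using G(2)[OF x] that by auto
      then show ?thesis using G(4)[OF x that] by (simp add: C_def)
    qed
    fix r y assume r: "(r::real) \<ge> 0" and y: "poly (p 0) y = 0" and "x \<noteq> y"
    show "snd (G x r) \<noteq> snd (G y r)"
    proof
      assume "snd (G x r) = snd (G y r)"
      then have "G x r = G y r" using G(4)[OF x r] G(4)[OF y r] by (simp add: prod_eq_iff)
      have GC: "G x \<in> {0..} \<rightarrow> C" "G y \<in> {0..} \<rightarrow> C"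
        using G(2)[OF x] G(2)[OF y] by (simp_all only: image_subset_iff_funcset)
      have "G x 0 = G y 0"
      proof (rule covering_space_lift_unique[OF cov, of "G x" r "G y" "{0..}" "\<lambda>r. r" 0])
        show "t = fst (G x t)" "t = fst (G y t)" if "t \<in> {0..}" for t
          using G(4)[OF x] G(4)[OF y] that by simp_all
      qed (use \<open>G x r = G y r\<close> G(1)[OF x] G(1)[OF y] GC r in simp_all)
      then show False using G(3)[OF x] G(3)[OF y] \<open>x \<noteq> y\<close> by simp
    qed
  qed
qed

section \<open>Continuous eigenvectors from the Krylov matrix\<close>

unbundle no vec_syntax

text \<open>A nonzero b can lie on the line through 0 and 1 + i s only for s = Im b / Re b, so
  finitely many slopes are excluded.\<close>

lemma ray_avoiding_finite:
  assumes "finite B" "(0::complex) \<notin> B"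
  obtains \<omega> where "\<omega> \<noteq> 0" "\<And>r::real. \<omega> * of_real r \<notin> B"
proof -
  have "finite ((\<lambda>b. Im b / Re b) ` B)" using assms(1) by simp
  then obtain s where s: "s \<notin> (\<lambda>b. Im b / Re b) ` B" using ex_new_if_finite infinite_UNIV_char_0 by blast
  show ?thesis
  proof (rule that[of "Complex 1 s"])
    show "Complex 1 s \<noteq> 0" by (simp add: complex_eq_iff)
    show "Complex 1 s * of_real r \<notin> B" for r
    proof
      assume b: "Complex 1 s * of_real r \<in> B"
      then have "r \<noteq> 0" using assms(2) by auto
      then have "s = Im (Complex 1 s * of_real r) / Re (Complex 1 s * of_real r)" by simp
      with s b show False by blast
    qed
  qed
qed

text \<open>The numbers \<open>a i\<close> are coefficients of a polynomial of degree below n with n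
  distinct roots.\<close>

lemma vandermonde_kernel:
  fixes d :: "nat \<Rightarrow> complex"
  assumes "inj_on d {..<n}" "\<And>j. j < n \<Longrightarrow> (\<Sum>i<n. a i * d j ^ i) = 0" "i < n"
  shows "a i = 0"
proof -
  define q where "q = (\<Sum>i<n. monom (a i) i)"
  have "card {x. poly q x = 0} \<ge> n" if "q \<noteq> 0"
  proof -
    have "d ` {..<n} \<subseteq> {x. poly q x = 0}"
      using assms(2) by (auto simp: q_def poly_sum poly_monom)
    then have "card (d ` {..<n}) \<le> card {x. poly q x = 0}"
      by (intro card_mono poly_roots_finite that)
    then show ?thesis using assms(1) by (simp add: card_image)
  qed
  moreover have "card {x. poly q x = 0} < n" if "q \<noteq> 0"
  proof -
    have "degree q \<le> n - 1" unfolding q_def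
      by (rule degree_sum_le) (auto intro: order_trans[OF degree_monom_le])
    then have "degree q < n" using assms(3) by simp
    then show ?thesis using card_poly_roots_bound[OF that] by linarith
  qed
  ultimately have "q = 0" by linarith
  then have "coeff q i = 0" by simp
  then show ?thesis using assms(3) by (simp add: q_def coeff_sum if_distrib cong: if_cong)
qed

lemma smult_mat_one_vec:
  assumes "w \<in> carrier_vec n"
  shows "(c \<cdot>\<^sub>m 1\<^sub>m n) *\<^sub>v w = c \<cdot>\<^sub>v (w :: complex vec)"
proof (rule eq_vecI)
  fix i assume "i < dim_vec (c \<cdot>\<^sub>v w)"
  then have i: "i < n" using assms by simp
  have "((c \<cdot>\<^sub>m 1\<^sub>m n) *\<^sub>v w) $ i = (\<Sum>j\<in>{0..<n}. c * (if j = i then 1 else 0) * w $ j)"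
    using i assms by (simp add: scalar_prod_def)
  also have "\<dots> = (\<Sum>j\<in>{0..<n}. if j = i then c * w $ j else 0)"
    by (intro sum.cong) auto
  also have "\<dots> = (c \<cdot>\<^sub>v w) $ i" using i assms by simp
  finally show "((c \<cdot>\<^sub>m 1\<^sub>m n) *\<^sub>v w) $ i = (c \<cdot>\<^sub>v w) $ i" .
qed (use assms in simp)

text \<open>The Krylov matrix K sends an eigenvector w of eigenvalue x to the sum of its entries
  times (1, x, x^2, ...), so the adjugate of K recovers w, up to scale, as a polynomial in \<eta>
  and x. Continuity of the eigenvectors thus follows from that of the eigenvalues, and every
  eigenspace is a line. The entries of \<open>v\<close> add up to 1, which makes it a unit vector at
  \<eta> = 0.\<close>

lemma ray_eigenvectors_mat:
  fixes A :: "complex poly mat"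
  assumes A: "A \<in> carrier_mat n n" and n: "n > 0"
    and diag: "\<And>i j. i < n \<Longrightarrow> j < n \<Longrightarrow> i \<noteq> j \<Longrightarrow> poly (A $$ (i, j)) 0 = 0"
    and inj: "inj_on (\<lambda>i. poly (A $$ (i, i)) 0) {..<n}"
  obtains \<omega> v g where "\<omega> \<noteq> (0::complex)"
    "\<And>b j. b < n \<Longrightarrow> j < n \<Longrightarrow> continuous_on {0..} (\<lambda>r::real. v b r j)"
    "\<And>b j. b < n \<Longrightarrow> j < n \<Longrightarrow> v b 0 j = (if j = b then 1 else (0::complex))"
    "\<And>b i r. b < n \<Longrightarrow> i < n \<Longrightarrow> r \<ge> 0 \<Longrightarrow> (\<Sum>j<n. poly (A $$ (i, j)) (\<omega> * of_real r) * v b r j) = g b r * v b r i"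
    "\<And>b b' r. b < n \<Longrightarrow> b' < n \<Longrightarrow> b \<noteq> b' \<Longrightarrow> r \<ge> 0 \<Longrightarrow> g b r \<noteq> (g b' r :: complex)"
    "\<And>b r. b < n \<Longrightarrow> r \<ge> 0 \<Longrightarrow> (\<exists>j<n. v b r j \<noteq> 0)"
    "\<And>b r w. b < n \<Longrightarrow> r \<ge> 0 \<Longrightarrow> (\<And>i. i < n \<Longrightarrow> (\<Sum>j<n. poly (A $$ (i, j)) (\<omega> * of_real r) * w j) = g b r * w i)
      \<Longrightarrow> \<exists>s. \<forall>j<n. w j = s * v b r j"
proof -
  define M where "M \<eta> = map_mat (\<lambda>p. poly p \<eta>) A" for \<eta>
  have M: "M \<eta> \<in> carrier_mat n n" for \<eta> using A by (simp add: M_def)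
  have Mij: "M \<eta> $$ (i, j) = poly (A $$ (i, j)) \<eta>" if "i < n" "j < n" for \<eta> i j
    using A that by (simp add: M_def)
  define d where "d i = poly (A $$ (i, i)) 0" for i
  have injd: "inj_on d {..<n}" using inj unfolding d_def .
  define ch where "ch \<eta> = char_poly (M \<eta>)" for \<eta>
  have roots0: "{x. poly (ch 0) x = 0} = d ` {..<n}"
  proof -
    have "upper_triangular (M 0)" using carrier_matD[OF M[of 0]] diag by (auto simp: upper_triangular_def Mij)
    from char_poly_upper_triangular[OF M this]
    have "ch 0 = (\<Prod>a\<leftarrow>diag_mat (M 0). [:- a, 1:])" by (simp add: ch_def)
    then have "{x. poly (ch 0) x = 0} = set (diag_mat (M 0))"
      by (auto simp: poly_prod_list prod_list_zero_iff)
    also have "\<dots> = d ` {..<n}" using carrier_matD[OF M[of 0]] by (auto simp: diag_mat_def d_def Mij)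
    finally show ?thesis .
  qed
  then have card0: "card {x. poly (ch 0) x = 0} = n" using injd by (simp add: card_image)
  define K where "K = mat n n (\<lambda>(i, j). \<Sum>k<n. (A ^\<^sub>m i) $$ (k, j))"
  have K: "K \<in> carrier_mat n n" by (simp add: K_def)
  have crh: "comm_ring_hom (\<lambda>p. poly p \<eta>)" for \<eta> :: complex by unfold_locales
  have sh: "semiring_hom (\<lambda>p. poly p \<eta>)" for \<eta> :: complex by unfold_locales
  have powA: "A ^\<^sub>m i \<in> carrier_mat n n" for i using A by simp
  have powM: "M \<eta> ^\<^sub>m i = map_mat (\<lambda>p. poly p \<eta>) (A ^\<^sub>m i)" for \<eta> i
    unfolding M_def using semiring_hom.mat_hom_pow[OF sh A] by simp
  define K' where "K' \<eta> = map_mat (\<lambda>p. poly p \<eta>) K" for \<eta>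
  have K': "K' \<eta> \<in> carrier_mat n n" for \<eta> by (simp add: K'_def K)
  have K'_vec: "K' \<eta> *\<^sub>v w = sum (($) w) {..<n} \<cdot>\<^sub>v vec n (\<lambda>i. c ^ i)"
    if w: "w \<in> carrier_vec n" "M \<eta> *\<^sub>v w = c \<cdot>\<^sub>v w" for \<eta> w c
  proof (rule eq_vecI)
    fix i assume "i < dim_vec (sum (($) w) {..<n} \<cdot>\<^sub>v vec n (\<lambda>i. c ^ i))"
    then have i: "i < n" by simp
    have pw: "(M \<eta> ^\<^sub>m i) *\<^sub>v w = c ^ i \<cdot>\<^sub>v w" for i
    proof (induction i)
      case 0
      then show ?case using w M[of \<eta>] by (simp add: carrier_matD)
    next
      case (Suc i)
      have "(M \<eta> ^\<^sub>m Suc i) *\<^sub>v w = (M \<eta> ^\<^sub>m i) *\<^sub>v (M \<eta> *\<^sub>v w)"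
        using M[of \<eta>] w by (simp add: assoc_mult_mat_vec[OF pow_carrier_mat[OF M] M w(1)])
      also have "\<dots> = c \<cdot>\<^sub>v (c ^ i \<cdot>\<^sub>v w)"
        unfolding w(2) using Suc mult_mat_vec[OF pow_carrier_mat[OF M] w(1)] by simp
      finally show ?case by (simp add: smult_smult_assoc)
    qed
    have "(K' \<eta> *\<^sub>v w) $ i = (\<Sum>j<n. (\<Sum>k<n. poly ((A ^\<^sub>m i) $$ (k, j)) \<eta>) * w $ j)"
      using i w K by (simp add: K'_def K_def scalar_prod_def poly_sum lessThan_atLeast0)
    also have "\<dots> = (\<Sum>k<n. \<Sum>j<n. poly ((A ^\<^sub>m i) $$ (k, j)) \<eta> * w $ j)"
      by (subst sum.swap) (simp add: sum_distrib_right)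
    also have "\<dots> = (\<Sum>k<n. ((M \<eta> ^\<^sub>m i) *\<^sub>v w) $ k)"
      using w carrier_matD[OF powA[of i]] by (intro sum.cong refl) (simp add: powM scalar_prod_def lessThan_atLeast0)
    also have "\<dots> = (\<Sum>k<n. c ^ i * w $ k)" using w by (simp add: pw)
    finally show "(K' \<eta> *\<^sub>v w) $ i = (sum (($) w) {..<n} \<cdot>\<^sub>v vec n (\<lambda>i. c ^ i)) $ i"
      using i by (simp add: sum_distrib_left mult.commute)
  qed (use carrier_matD[OF K'] in simp)
  have detK: "poly (det K) \<eta> = det (K' \<eta>)" for \<eta>
    unfolding K'_def using comm_ring_hom.hom_det[OF crh] by simp
  define V where "V \<eta> c j = (\<Sum>i<n. poly (adj_mat K $$ (j, i)) \<eta> * c ^ i)" for \<eta> c j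
  have adjK: "adj_mat K \<in> carrier_mat n n" using adj_mat[OF K] by simp
  have V: "det (K' \<eta>) * w $ j = sum (($) w) {..<n} * V \<eta> c j"
    if w: "w \<in> carrier_vec n" "M \<eta> *\<^sub>v w = c \<cdot>\<^sub>v w" and j: "j < n" for \<eta> w c j
  proof -
    let ?a = "map_mat (\<lambda>p. poly p \<eta>) (adj_mat K)"
    have a: "?a \<in> carrier_mat n n" using adjK by simp
    have "?a * K' \<eta> = map_mat (\<lambda>p. poly p \<eta>) (adj_mat K * K)"
      unfolding K'_def by (rule semiring_hom.mat_hom_mult[OF sh adjK K, symmetric])
    also have "\<dots> = det (K' \<eta>) \<cdot>\<^sub>m 1\<^sub>m n"
      unfolding adj_mat(3)[OF K] by (rule eq_matI) (auto simp: detK)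
    finally have "det (K' \<eta>) \<cdot>\<^sub>v w = ?a *\<^sub>v (K' \<eta> *\<^sub>v w)"
      using w(1) by (simp flip: assoc_mult_mat_vec[OF a K' w(1)] add: smult_mat_one_vec[OF w(1)])
    also have "\<dots> = sum (($) w) {..<n} \<cdot>\<^sub>v (?a *\<^sub>v vec n (\<lambda>i. c ^ i))"
      unfolding K'_vec[OF w] by (rule mult_mat_vec[OF a]) simp
    finally have "(det (K' \<eta>) \<cdot>\<^sub>v w) $ j = (sum (($) w) {..<n} \<cdot>\<^sub>v (?a *\<^sub>v vec n (\<lambda>i. c ^ i))) $ j" by simp
    then show ?thesis using w j carrier_matD[OF adjK] by (simp add: V_def scalar_prod_def lessThan_atLeast0)
  qed
  have eig0: "M 0 *\<^sub>v unit_vec n b = d b \<cdot>\<^sub>v unit_vec n b" if "b < n" for b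
    using carrier_matD[OF M[of 0]] that by (intro eq_vecI) (auto simp: Mij d_def diag)
  \<comment> \<open>At \<eta> = 0 the matrix is diagonal and its eigenvectors are the unit vectors,
    so K becomes the Vandermonde matrix of the distinct numbers \<open>d j\<close>.\<close>
  have "det (K' 0) \<noteq> 0"
  proof
    assume "det (K' 0) = 0"
    then have "det (transpose_mat (K' 0)) = 0" using det_transpose[OF K'] by simp
    then obtain a where a: "a \<in> carrier_vec n" "a \<noteq> 0\<^sub>v n" "transpose_mat (K' 0) *\<^sub>v a = 0\<^sub>v n"
      using det_0_iff_vec_prod_zero[of "transpose_mat (K' 0)" n] K'[of 0] by auto
    have col: "K' 0 $$ (i, j) = d j ^ i" if "i < n" "j < n" for i j
    proof -
      have "(K' 0 *\<^sub>v unit_vec n j) $ i = d j ^ i"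
        unfolding K'_vec[OF unit_vec_carrier eig0[OF that(2)]] using that
        by (simp add: unit_vec_def sum.delta)
      then show ?thesis using that carrier_matD[OF K'[of 0]] by simp
    qed
    have "(\<Sum>i<n. a $ i * d j ^ i) = 0" if j: "j < n" for j
    proof -
      have "(\<Sum>i<n. a $ i * d j ^ i) = (transpose_mat (K' 0) *\<^sub>v a) $ j"
        using j a(1) carrier_matD[OF K'[of 0]] by (simp add: scalar_prod_def col lessThan_atLeast0 mult.commute)
      then show ?thesis using a(3) j by simp
    qed
    then have "a $ i = 0" if "i < n" for i using vandermonde_kernel[OF injd, of "\<lambda>i. a $ i"] that by blast
    then have "a = 0\<^sub>v n" using a(1) by (intro eq_vecI) auto
    with a(2) show False by simp
  qed
  then have "det K \<noteq> 0" using detK[of 0] by auto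
  define B where "B = {\<eta>. card {x. poly (ch \<eta>) x = 0} \<noteq> n} \<union> {\<eta>. poly (det K) \<eta> = 0}"
  have fB: "finite B" unfolding B_def ch_def M_def
    using finite_char_poly_multiple_roots[OF A] card0 poly_roots_finite[OF \<open>det K \<noteq> 0\<close>] by (simp add: ch_def M_def)
  have B0: "0 \<notin> B" using card0 \<open>det (K' 0) \<noteq> 0\<close> by (simp add: B_def detK)
  obtain \<omega> where \<omega>: "\<omega> \<noteq> 0" "\<And>r::real. \<omega> * of_real r \<notin> B"
    using ray_avoiding_finite[OF fB B0] by blast
  define p where "p r = ch (\<omega> * of_real r)" for r :: real
  have p0: "p 0 = ch 0" by (simp add: p_def)
  have pdeg: "degree (p r) = n" "lead_coeff (p r) = 1" for r
    using degree_monic_char_poly[OF M] by (auto simp: p_def ch_def)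
  have pcard: "card {x. poly (p r) x = 0} = n" for r using \<omega>(2)[of r] by (simp add: B_def p_def)
  have pcont: "continuous_on {0..} (\<lambda>r. poly (p r) x)" for x
  proof -
    have "ch \<eta> = map_poly (\<lambda>p. poly p \<eta>) (char_poly A)" for \<eta>
      unfolding ch_def M_def by (rule poly_hom.char_poly_hom[OF A])
    then have co: "coeff (p r) i = poly (coeff (char_poly A) i) (\<omega> * of_real r)" for r i
      by (simp add: p_def coeff_map_poly)
    have "(\<lambda>r. poly (p r) x) = (\<lambda>r. \<Sum>i\<le>n. poly (coeff (char_poly A) i) (\<omega> * of_real r) * x ^ i)"
      unfolding poly_altdef[of "p _"] pdeg(1) co ..
    then show ?thesis by (simp only:) (intro continuous_intros)
  qed
  from roots_lift[of p n, OF pdeg pcard pcont n]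
  obtain g0 where g0: "\<forall>x. poly (p 0) x = 0 \<longrightarrow> continuous_on {0..} (g0 x) \<and> g0 x 0 = x \<and>
    (\<forall>r\<ge>0. poly (p r) (g0 x r) = 0 \<and> (\<forall>y. poly (p 0) y = 0 \<longrightarrow> x \<noteq> y \<longrightarrow> g0 x r \<noteq> g0 y r))"
    ..
  have root: "poly (p 0) (d b) = 0" if "b < n" for b using roots0 that unfolding p0 by blast
  define g where "g b = g0 (d b)" for b
  have g: "continuous_on {0..} (g b)" "g b 0 = d b" "r \<ge> 0 \<Longrightarrow> poly (p r) (g b r) = 0"
    if "b < n" for b r
    using g0 root[OF that] by (simp_all add: g_def)
  have g_inj: "g b r \<noteq> g b' r" if "b < n" "b' < n" "b \<noteq> b'" "r \<ge> 0" for b b' r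
    using g0[rule_format, OF root[OF that(1)]] root[OF that(2)] that inj_onD[OF injd, of b b'] by (auto simp: g_def)
  define v where "v b r j = V (\<omega> * of_real r) (g b r) j / det (K' (\<omega> * of_real r))" for b and r :: real and j
  have detK0: "det (K' (\<omega> * of_real r)) \<noteq> 0" for r :: real using \<omega>(2)[of r] by (simp add: B_def detK)
  have eig: "\<exists>w. w \<in> carrier_vec n \<and> M (\<omega> * of_real r) *\<^sub>v w = g b r \<cdot>\<^sub>v w \<and> (\<forall>j<n. v b r j = w $ j) \<and> w \<noteq> 0\<^sub>v n"
    if b: "b < n" and r: "r \<ge> 0" for b and r :: real
  proof -
    let ?\<eta> = "\<omega> * of_real r"
    have "poly (char_poly (M ?\<eta>)) (g b r) = 0" using g(3)[OF b r] by (simp add: p_def ch_def)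
    then have "eigenvalue (M ?\<eta>) (g b r)" using eigenvalue_root_char_poly[OF M] by simp
    then obtain w where w: "w \<in> carrier_vec n" "w \<noteq> 0\<^sub>v n" "M ?\<eta> *\<^sub>v w = g b r \<cdot>\<^sub>v w"
      using carrier_matD[OF M[of ?\<eta>]] by (auto simp: eigenvalue_def eigenvector_def)
    define s where "s = sum (($) w) {..<n}"
    have Vw: "det (K' ?\<eta>) * w $ j = s * V ?\<eta> (g b r) j" if "j < n" for j
      using V[OF w(1,3) that] by (simp add: s_def)
    \<comment> \<open>By the adjugate formula an eigenvector with entry sum 0 would be annihilated
      by the nonzero determinant of K.\<close>
    have "s \<noteq> 0"
    proof
      assume "s = 0"
      then have "w $ j = 0" if "j < n" for j using Vw[OF that] detK0[of r] by simp
      then have "w = 0\<^sub>v n" using w(1) by (intro eq_vecI) auto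
      with w(2) show False by simp
    qed
    have "v b r j = ((1/s) \<cdot>\<^sub>v w) $ j" if "j < n" for j
      using Vw[OF that] that w(1) \<open>s \<noteq> 0\<close> detK0[of r] by (simp add: v_def field_simps)
    moreover have "M ?\<eta> *\<^sub>v ((1/s) \<cdot>\<^sub>v w) = g b r \<cdot>\<^sub>v ((1/s) \<cdot>\<^sub>v w)"
      using mult_mat_vec[OF M w(1)] w(3) by (simp add: smult_smult_assoc mult.commute)
    moreover have "(1/s) \<cdot>\<^sub>v w \<noteq> 0\<^sub>v n"
    proof
      assume z: "(1/s) \<cdot>\<^sub>v w = 0\<^sub>v n"
      have "w $ j = 0" if "j < n" for j
        using arg_cong[OF z, of "\<lambda>x. x $ j"] that w(1) \<open>s \<noteq> 0\<close> by simp
      then have "w = 0\<^sub>v n" using w(1) by (intro eq_vecI) auto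
      with w(2) show False by simp
    qed
    ultimately show ?thesis using w(1) by (intro exI[of _ "(1/s) \<cdot>\<^sub>v w"]) simp
  qed
  show ?thesis
  proof (rule that[of \<omega> v g])
    show "\<omega> \<noteq> 0" by fact
    fix b assume b: "b < n"
    show "continuous_on {0..} (\<lambda>r. v b r j)" if "j < n" for j
      unfolding v_def V_def detK[symmetric] using g(1)[OF b] detK0 unfolding detK[symmetric]
      by (intro continuous_intros) simp_all
    show "v b 0 j = (if j = b then 1 else 0)" if j: "j < n" for j
    proof -
      have "sum (($) (unit_vec n b)) {..<n} = (1::complex)" using b by (simp add: unit_vec_def sum.delta)
      with V[OF unit_vec_carrier eig0[OF b] j] show ?thesis
        using detK0[of 0] j b g(2)[OF b] by (simp add: v_def field_simps split: if_splits)
    qed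
    show "(\<Sum>j<n. poly (A $$ (i, j)) (\<omega> * of_real r) * v b r j) = g b r * v b r i"
      if i: "i < n" and r: "r \<ge> 0" for i r
    proof -
      from eig[OF b r] obtain w where w: "w \<in> carrier_vec n" "M (\<omega> * of_real r) *\<^sub>v w = g b r \<cdot>\<^sub>v w" "\<And>j. j < n \<Longrightarrow> v b r j = w $ j"
        by blast
      have "(M (\<omega> * of_real r) *\<^sub>v w) $ i = (\<Sum>j<n. poly (A $$ (i, j)) (\<omega> * of_real r) * v b r j)"
        using i w(1,3) carrier_matD[OF M[of "\<omega> * of_real r"]] by (simp add: scalar_prod_def Mij lessThan_atLeast0)
      then show ?thesis using w i by simp
    qed
    show "\<exists>j<n. v b r j \<noteq> 0" if r: "r \<ge> 0" for r
    proof (rule ccontr)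
      assume c: "\<not> ?thesis"
      from eig[OF b r] obtain w where w: "w \<in> carrier_vec n" "\<And>j. j < n \<Longrightarrow> v b r j = w $ j" "w \<noteq> 0\<^sub>v n"
        by blast
      then have "w = 0\<^sub>v n" using c by (intro eq_vecI) auto
      with w(3) show False by simp
    qed
    show "\<exists>s. \<forall>j<n. w j = s * v b r j" if "r \<ge> 0"
      and w: "\<And>i. i < n \<Longrightarrow> (\<Sum>j<n. poly (A $$ (i, j)) (\<omega> * of_real r) * w j) = g b r * w i" for r w
    proof (intro exI allI impI)
      let ?w = "vec n w"
      have "M (\<omega> * of_real r) *\<^sub>v ?w = g b r \<cdot>\<^sub>v ?w"
      proof (rule eq_vecI)
        fix i assume "i < dim_vec (g b r \<cdot>\<^sub>v ?w)"
        then have i: "i < n" by simp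
        then have "(M (\<omega> * of_real r) *\<^sub>v ?w) $ i = (\<Sum>j<n. poly (A $$ (i, j)) (\<omega> * of_real r) * w j)"
          using carrier_matD[OF M[of "\<omega> * of_real r"]] by (simp add: scalar_prod_def Mij lessThan_atLeast0)
        then show "(M (\<omega> * of_real r) *\<^sub>v ?w) $ i = (g b r \<cdot>\<^sub>v ?w) $ i" using w[OF i] i by simp
      qed (use carrier_matD[OF M[of "\<omega> * of_real r"]] in simp)
      from V[OF _ this] show "w j = sum (($) ?w) {..<n} * v b r j" if "j < n" for j
        using that detK0[of r] by (simp add: v_def field_simps)
    qed
    fix b' r assume "b' < n" "b \<noteq> b'" "(r::real) \<ge> 0"
    with b show "g b r \<noteq> g b' r" by (intro g_inj)
  qed
qed

text \<open>Transport of the matrix version along an enumeration of I; the empty index set, whose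
  matrix would have size 0, is treated apart.\<close>

lemma ray_eigenvectors:
  fixes N :: "'a \<Rightarrow> 'a \<Rightarrow> complex poly"
  assumes I: "finite I"
    and diag: "\<And>p q. p \<in> I \<Longrightarrow> q \<in> I \<Longrightarrow> p \<noteq> q \<Longrightarrow> poly (N p q) 0 = 0"
    and inj: "inj_on (\<lambda>p. poly (N p p) 0) I"
  shows "\<exists>\<omega> v g. \<omega> \<noteq> (0::complex) \<and> (\<forall>b\<in>I. \<forall>q\<in>I. continuous_on {0..} (\<lambda>r::real. v b r q)) \<and>
    (\<forall>b\<in>I. \<forall>q\<in>I. v b 0 q = (if q = b then 1 else 0)) \<and>
    (\<forall>b\<in>I. \<forall>r\<ge>0. \<forall>p\<in>I. (\<Sum>q\<in>I. poly (N p q) (\<omega> * of_real r) * v b r q) = g b r * v b r p) \<and>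
    (\<forall>b\<in>I. \<forall>b'\<in>I. b \<noteq> b' \<longrightarrow> (\<forall>r\<ge>0. g b r \<noteq> g b' r)) \<and> (\<forall>b\<in>I. \<forall>r\<ge>0. \<exists>q\<in>I. v b r q \<noteq> 0) \<and>
    (\<forall>b\<in>I. \<forall>r\<ge>0. \<forall>w. (\<forall>p\<in>I. (\<Sum>q\<in>I. poly (N p q) (\<omega> * of_real r) * w q) = g b r * w p) \<longrightarrow>
      (\<exists>s. \<forall>q\<in>I. w q = s * v b r q))"
proof (cases "I = {}")
  case True
  then show ?thesis by (intro exI[of _ 1]) simp
next
  case False
  define n where "n = card I"
  have n: "n > 0" using False I by (simp add: n_def card_gt_0_iff)
  obtain h where h: "bij_betw h {..<n} I"
    using ex_bij_betw_nat_finite[OF I] unfolding n_def lessThan_atLeast0 by blast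
  define k where "k = the_inv_into {..<n} h"
  have hI: "h i \<in> I" if "i < n" for i using h that by (auto simp: bij_betw_def)
  have inj_h: "inj_on h {..<n}" using h by (simp add: bij_betw_def)
  have kh: "k (h i) = i" if "i < n" for i
    unfolding k_def using the_inv_into_f_f[OF inj_h] that by simp
  have hk: "h (k p) = p" "k p < n" if "p \<in> I" for p
    using f_the_inv_into_f_bij_betw[OF h] the_inv_into_into[OF inj_h, of p "{..<n}"] that h
    by (auto simp: k_def bij_betw_def)
  define A where "A = mat n n (\<lambda>(i, j). N (h i) (h j))"
  have A: "A \<in> carrier_mat n n" by (simp add: A_def)
  have Aij: "A $$ (i, j) = N (h i) (h j)" if "i < n" "j < n" for i j using that by (simp add: A_def)
  have d: "poly (A $$ (i, j)) 0 = 0" if "i < n" "j < n" "i \<noteq> j" for i j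
    using diag[OF hI hI] that kh by (metis Aij)
  have ij: "inj_on (\<lambda>i. poly (A $$ (i, i)) 0) {..<n}"
  proof (rule inj_onI)
    fix i j assume i: "i \<in> {..<n}" and j: "j \<in> {..<n}" and "poly (A $$ (i, i)) 0 = poly (A $$ (j, j)) 0"
    then have "poly (N (h i) (h i)) 0 = poly (N (h j) (h j)) 0" by (simp add: Aij)
    with inj_onD[OF inj, of "h i" "h j"] hI i j have "h i = h j" by simp
    with inj_onD[OF inj_h] i j show "i = j" by simp
  qed
  have S: "(\<Sum>q\<in>I. f q) = (\<Sum>i<n. f (h i))" for f :: "'a \<Rightarrow> complex"
    using sum.reindex_bij_betw[OF h, of f] by simp
  show ?thesis
  proof (rule ray_eigenvectors_mat[OF A n d ij])
    fix \<omega> v g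
    assume H: "\<omega> \<noteq> (0::complex)"
    "\<And>b j. b < n \<Longrightarrow> j < n \<Longrightarrow> continuous_on {0..} (\<lambda>r::real. v b r j)"
    "\<And>b j. b < n \<Longrightarrow> j < n \<Longrightarrow> v b 0 j = (if j = b then 1 else (0::complex))"
    "\<And>b i r. b < n \<Longrightarrow> i < n \<Longrightarrow> r \<ge> 0 \<Longrightarrow> (\<Sum>j<n. poly (A $$ (i, j)) (\<omega> * of_real r) * v b r j) = g b r * v b r i"
    "\<And>b b' r. b < n \<Longrightarrow> b' < n \<Longrightarrow> b \<noteq> b' \<Longrightarrow> r \<ge> 0 \<Longrightarrow> g b r \<noteq> (g b' r :: complex)"
    "\<And>b r. b < n \<Longrightarrow> r \<ge> 0 \<Longrightarrow> (\<exists>j<n. v b r j \<noteq> 0)"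
    "\<And>b r w. b < n \<Longrightarrow> r \<ge> 0 \<Longrightarrow> (\<And>i. i < n \<Longrightarrow> (\<Sum>j<n. poly (A $$ (i, j)) (\<omega> * of_real r) * w j) = g b r * w i)
      \<Longrightarrow> \<exists>s. \<forall>j<n. w j = s * v b r j"
    show ?thesis
    proof (rule exI[of _ \<omega>], rule exI[of _ "\<lambda>b r q. v (k b) r (k q)"], rule exI[of _ "\<lambda>b. g (k b)"], intro conjI ballI allI impI)
      show "\<omega> \<noteq> 0" by fact
      fix b assume b: "b \<in> I"
      show "continuous_on {0..} (\<lambda>r. v (k b) r (k q))" if "q \<in> I" for q
        using H(2) hk(2) b that by simp
      show "v (k b) 0 (k q) = (if q = b then 1 else 0)" if "q \<in> I" for q
        using H(3)[OF hk(2)[OF b] hk(2)[OF that]] hk(1)[OF b] hk(1)[OF that] by (metis (full_types))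
      show "\<exists>q\<in>I. v (k b) r (k q) \<noteq> 0" if "r \<ge> 0" for r
        using H(6)[OF hk(2)[OF b] that] hI kh by metis
      show "g (k b) r \<noteq> g (k b') r" if "b' \<in> I" "b \<noteq> b'" "r \<ge> 0" for b' r
        using H(5)[OF hk(2)[OF b] hk(2)[OF that(1)] _ that(3)] hk(1)[OF b] hk(1)[OF that(1)] that(2) by metis
      show "\<exists>s. \<forall>q\<in>I. w q = s * v (k b) r (k q)" if r: "r \<ge> 0"
        and w: "\<forall>p\<in>I. (\<Sum>q\<in>I. poly (N p q) (\<omega> * of_real r) * w q) = g (k b) r * w p" for r :: real and w
      proof -
        have "(\<Sum>j<n. poly (A $$ (i, j)) (\<omega> * of_real r) * w (h j)) = g (k b) r * w (h i)" if i: "i < n" for i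
        proof -
          have "(\<Sum>j<n. poly (A $$ (i, j)) (\<omega> * of_real r) * w (h j)) = (\<Sum>q\<in>I. poly (N (h i) q) (\<omega> * of_real r) * w q)"
            unfolding S by (intro sum.cong refl) (use i in \<open>simp add: Aij\<close>)
          then show ?thesis using w hI[OF i] by simp
        qed
        from H(7)[OF hk(2)[OF b] r, of "\<lambda>i. w (h i)", OF this]
        obtain s where s: "\<And>j. j < n \<Longrightarrow> w (h j) = s * v (k b) r j" by blast
        have "w q = s * v (k b) r (k q)" if "q \<in> I" for q
          using s[OF hk(2)[OF that]] hk(1)[OF that] by simp
        then show ?thesis by blast
      qed
      fix r :: real and p assume r: "r \<ge> 0" and p: "p \<in> I"
      have "(\<Sum>q\<in>I. poly (N p q) (\<omega> * of_real r) * v (k b) r (k q)) = (\<Sum>j<n. poly (A $$ (k p, j)) (\<omega> * of_real r) * v (k b) r j)"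
        unfolding S by (intro sum.cong refl) (use hk[OF p] kh in \<open>simp add: Aij\<close>)
      then show "(\<Sum>q\<in>I. poly (N p q) (\<omega> * of_real r) * v (k b) r (k q)) = g (k b) r * v (k b) r (k p)"
        using H(4)[OF hk(2)[OF b] hk(2)[OF p] r] by simp
    qed
  qed
qed

section \<open>The generic ray\<close>

lemma TT_cong: "(\<And>m. m < K \<Longrightarrow> x m = y m) \<Longrightarrow> TT x D K i j = TT y D K i j"
  by (induction K arbitrary: j) simp_all

lemma Gp_nth_0:
  "j \<in> {-1,1} \<Longrightarrow> fps_nth (Gp y D K i j) 0 = (if i = j then (\<Prod>m<K. y m) *\<^sub>c 1 else 0)"
proof (induction K arbitrary: j)
  case (Suc K)
  show ?case unfolding Gp_nth_Suc[OF Suc.prems] Suc.IH[OF Suc.prems]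
    by (simp add: scale_scale scale_zero_right mult.commute)
qed (simp add: scale_one)

text \<open>In the term linear in X of a product of factors y_m + D_m X, one factor contributes D_m
  and each of the others its scalar.\<close>

lemma Gp_nth_1:
  assumes "i \<in> {-1,1}" "\<And>m. m < K \<Longrightarrow> y m \<noteq> 0"
  shows "j \<in> {-1,1} \<Longrightarrow> fps_nth (Gp y D K i j) 1 = (\<Prod>m<K. y m) *\<^sub>c (\<Sum>m<K. (1 / y m) *\<^sub>c D m i j)"
  using assms(2)
proof (induction K arbitrary: j)
  case (Suc K)
  let ?P = "\<Prod>m<K. y m"
  have "fps_nth (Gp y D (Suc K) i j) 1 = y K *\<^sub>c (?P *\<^sub>c (\<Sum>m<K. (1 / y m) *\<^sub>c D m i j))
     + (\<Sum>c\<in>{-1,1}. (if i = c then ?P *\<^sub>c 1 else 0) * D K c j)"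
    unfolding Gp_nth_Suc[OF Suc.prems(1)] using Suc.IH[OF Suc.prems(1)] Suc.prems(2) by (simp add: Gp_nth_0 del: Gp.simps)
  also have "(\<Sum>c\<in>{-1,1}. (if i = c then ?P *\<^sub>c 1 else 0) * D K c j) = ?P *\<^sub>c D K i j"
    using assms(1) by (auto simp: scale_mult_left)
  also have "y K *\<^sub>c (?P *\<^sub>c (\<Sum>m<K. (1 / y m) *\<^sub>c D m i j)) + ?P *\<^sub>c D K i j
     = (\<Prod>m<Suc K. y m) *\<^sub>c (\<Sum>m<Suc K. (1 / y m) *\<^sub>c D m i j)"
    using Suc.prems(2)[of K] by (simp add: scale_add_right scale_scale mult_ac)
  finally show ?case .
qed (use assms(1) in \<open>auto simp: scale_zero_right\<close>)

text \<open>Applying N - g(b0) to a linear relation removes \<open>b0\<close> and rescales the other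
  coefficients by nonzero numbers; hence the induction over the set J of vectors involved, with
  arbitrary coefficients.\<close>

lemma eigenvectors_lin_indep:
  fixes N :: "'a \<Rightarrow> 'a \<Rightarrow> complex"
  assumes I: "finite I"
    and eig: "\<And>b p. b \<in> I \<Longrightarrow> p \<in> I \<Longrightarrow> (\<Sum>q\<in>I. N p q * v b q) = g b * v b p"
    and dist: "\<And>b b'. b \<in> I \<Longrightarrow> b' \<in> I \<Longrightarrow> b \<noteq> b' \<Longrightarrow> g b \<noteq> g b'"
    and nz: "\<And>b. b \<in> I \<Longrightarrow> \<exists>q\<in>I. v b q \<noteq> 0"
  shows "finite J \<Longrightarrow> J \<subseteq> I \<Longrightarrow> (\<And>q. q \<in> I \<Longrightarrow> (\<Sum>b\<in>J. a b * v b q) = 0) \<Longrightarrow> b \<in> J \<Longrightarrow> a b = 0"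
proof (induction J arbitrary: a b rule: finite_induct)
  case (insert b0 J)
  have b0: "b0 \<in> I" and J: "J \<subseteq> I" using insert.prems by auto
  have J0: "a b = 0" if b: "b \<in> J" for b
  proof -
    have "(\<Sum>b\<in>J. a b * (g b - g b0) * v b p) = 0" if p: "p \<in> I" for p
    proof -
      have "0 = (\<Sum>q\<in>I. N p q * (\<Sum>b\<in>insert b0 J. a b * v b q)) - g b0 * (\<Sum>b\<in>insert b0 J. a b * v b p)"
        using insert.prems(2) p by simp
      also have "(\<Sum>q\<in>I. N p q * (\<Sum>b\<in>insert b0 J. a b * v b q)) = (\<Sum>b\<in>insert b0 J. a b * (\<Sum>q\<in>I. N p q * v b q))"
        unfolding sum_distrib_left by (subst sum.swap) (simp add: mult_ac)
      also have "\<dots> = (\<Sum>b\<in>insert b0 J. a b * (g b * v b p))"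
        using b0 J by (intro sum.cong refl) (use eig[OF _ p] in auto)
      also have "\<dots> - g b0 * (\<Sum>b\<in>insert b0 J. a b * v b p) = (\<Sum>b\<in>insert b0 J. a b * (g b - g b0) * v b p)"
        unfolding sum_distrib_left sum_subtractf[symmetric] by (intro sum.cong refl) (simp add: algebra_simps)
      finally show ?thesis using insert.hyps by simp
    qed
    from insert.IH[OF J this b] have "a b * (g b - g b0) = 0" .
    moreover have "g b \<noteq> g b0" using dist b0 J b insert.hyps(2) by blast
    ultimately show ?thesis by simp
  qed
  have "a b0 * v b0 q = 0" if "q \<in> I" for q
    using insert.prems(2)[OF that] insert.hyps J0 by simp
  then have "a b0 = 0" using nz[OF b0] by auto
  then show ?case using J0 insert.prems(3) by auto
qed simp

section \<open>The odd part of s_11 on the ray and its leading term\<close>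

context multiplicity_space
begin

text \<open>On the ray z = \<tau> c the site parameters at u = \<tau> and u = -\<tau> are \<tau>(c_m
  + 1) and \<tau>(c_m - 1); this is the resulting series of \<open>Qop\<close> in 1/\<tau>.\<close>

definition Hs :: "(nat \<Rightarrow> complex) \<Rightarrow> xidx endo fps" where
  "Hs c = (\<Sum>a\<in>{-1,1}. fscale (theta spc a 1)
     (Gp (\<lambda>m. c m + 1) E0 (Suc k) 1 a * Gp (\<lambda>m. c m - 1) E0 (Suc k) (-1) (- a)
      - Gp (\<lambda>m. c m - 1) E0 (Suc k) 1 a * Gp (\<lambda>m. c m + 1) E0 (Suc k) (-1) (- a)))"

text \<open>\<open>z\<close> is indexed from 1, the slots from 0.\<close>

definition ray :: "(nat \<Rightarrow> complex) \<Rightarrow> complex \<Rightarrow> nat \<Rightarrow> complex" where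
  "ray c \<tau> j = \<tau> * c (j - 1)"

lemma shifted_0: "shifted (\<lambda>_. 0) E0 = E0"
  by (intro ext) (simp add: shifted_def Lop_def scale_zero_left)

text \<open>Slot k is not shifted by z; the condition c_k = 0 lets it follow the same
  formula.\<close>

lemma That_ray:
  assumes "c k = 0" "j \<in> {-1,1}"
  shows "That (ray c \<tau>) \<tau> i j = Ev (Suc k) (Gp (\<lambda>m. c m + 1) E0 (Suc k) i j) \<tau>"
    and "That (ray c \<tau>) (- \<tau>) i j = Ev (Suc k) (Gp (\<lambda>m. c m - 1) E0 (Suc k) i j) \<tau>"
proof -
  have That: "That z u i j = TT (\<lambda>m. u + zx z m) E0 (Suc k) i j" for z u
    unfolding That_def using TT_eq_Ev[OF assms(2), of u "\<lambda>_. 1" "zx z" E0 "Suc k" i] by simp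
  have z: "zx (ray c \<tau>) m = \<tau> * c m" if "m < Suc k" for m
    using that assms(1) by (auto simp: zx_def ray_def less_Suc_eq)
  have "TT (\<lambda>m. \<tau> + zx (ray c \<tau>) m) E0 (Suc k) i j = TT (\<lambda>m. \<tau> * (c m + 1) + 0) E0 (Suc k) i j"
    by (rule TT_cong) (simp add: z algebra_simps)
  then show "That (ray c \<tau>) \<tau> i j = Ev (Suc k) (Gp (\<lambda>m. c m + 1) E0 (Suc k) i j) \<tau>"
    unfolding That TT_eq_Ev[OF assms(2)] shifted_0 .
  have "TT (\<lambda>m. - \<tau> + zx (ray c \<tau>) m) E0 (Suc k) i j = TT (\<lambda>m. \<tau> * (c m - 1) + 0) E0 (Suc k) i j"
    by (rule TT_cong) (simp add: z algebra_simps)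
  then show "That (ray c \<tau>) (- \<tau>) i j = Ev (Suc k) (Gp (\<lambda>m. c m - 1) E0 (Suc k) i j) \<tau>"
    unfolding That TT_eq_Ev[OF assms(2)] shifted_0 .
qed

lemma Qop_ray:
  assumes "c k = 0"
  shows "Qop (ray c \<tau>) \<tau> = Ev (2 * Suc k) (Hs c) \<tau>"
proof -
  let ?p = "Gp (\<lambda>m. c m + 1) E0 (Suc k)" and ?m = "Gp (\<lambda>m. c m - 1) E0 (Suc k)"
  have m: "Ev (2 * Suc k) (Gp y E0 (Suc k) 1 a * Gp y' E0 (Suc k) (-1) b) \<tau>
      = Ev (Suc k) (Gp y E0 (Suc k) 1 a) \<tau> * Ev (Suc k) (Gp y' E0 (Suc k) (-1) b) \<tau>" for y y' a b
    unfolding mult_2 by (rule Ev_mult) (simp_all add: Gp_nth_eq_0 del: Gp.simps)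
  have "Ev (2 * Suc k) (Hs c) \<tau> = (\<Sum>a\<in>{-1,1}. theta spc a 1 *\<^sub>c
     (Ev (Suc k) (?p 1 a) \<tau> * Ev (Suc k) (?m (-1) (- a)) \<tau> - Ev (Suc k) (?m 1 a) \<tau> * Ev (Suc k) (?p (-1) (- a)) \<tau>))"
    unfolding Hs_def m[symmetric] Ev_diff[symmetric] Ev_fscale[symmetric] by (simp add: Ev_add del: Gp.simps)
  also have "\<dots> = Qop (ray c \<tau>) \<tau>"
    unfolding Qop_def Bop_def using That_ray[where c=c, OF assms]
    by (simp add: theta_def scale_one scale_diff_right algebra_simps del: Gp.simps)
  finally show ?thesis ..
qed

text \<open>The weight of h in slot m. In slot k of the orthogonal case it is 1/2 - (1 - \<delta>),
  the weight at exponent 0.\<close>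

definition cval :: "idx \<Rightarrow> nat \<Rightarrow> complex" where
  "cval = (\<lambda>(\<sigma>, p) m. if m < k then of_real (fa \<sigma> m) - of_real (fb \<sigma> m) - 2 * of_nat (p ! m)
     else if spc then 0 else of_real (deltaW lam \<sigma>) - 1/2)"

lemma app_cartan:
  assumes "m \<le> k"
  shows "app (E0 m 1 1) \<phi> (emb x) - app (E0 m (-1) (-1)) \<phi> (emb x) = cval x m * \<phi> (emb x)"
proof -
  obtain \<sigma> p where x: "x = (\<sigma>, p)" by force
  show ?thesis
  proof (cases "m < k")
    case True
    then show ?thesis by (simp add: E0_def emb_def x cval_def app_glop algebra_simps)
  next
    case False
    then have "m = k" using assms by simp
    then show ?thesis by (simp add: E0_def emb_def x cval_def app_glop app_simps algebra_simps)
  qed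
qed

text \<open>The constant terms of the two products are equal scalars, so the degree of Q in \<tau>
  drops to at most 2k + 1.\<close>

lemma Hs_nth_0: "fps_nth (Hs c) 0 = 0"
  unfolding Hs_def by (simp add: fps_sum_nth fscale_nth Gp_nth_0 scale_mult_left scale_mult_right scale_scale scale_zero_right mult.commute del: Gp.simps)

text \<open>Only a = 1 survives, since off-diagonal entries of the monodromy have no constant term.
  Slot m enters through h with the factor 1/(c_m + 1) - 1/(c_m - 1) = 2/(1 - c_m^2).\<close>

lemma Hs_nth_1:
  assumes "\<And>m. m \<le> k \<Longrightarrow> (c m)\<^sup>2 \<noteq> 1"
  shows "app (fps_nth (Hs c) 1) \<phi> (emb x) =
    2 * (\<Prod>m\<le>k. c m + 1) * (\<Prod>m\<le>k. c m - 1) * (\<Sum>m\<le>k. cval x m / (1 - (c m)\<^sup>2)) * \<phi> (emb x)"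
proof -
  have c: "c m + 1 \<noteq> 0" "c m - 1 \<noteq> 0" if "m < Suc k" for m
    using assms[of m] that by (auto simp: add_eq_0_iff2 power2_eq_1_iff)
  define P where "P = (\<Prod>m<Suc k. c m + 1)"
  define M where "M = (\<Prod>m<Suc k. c m - 1)"
  define D where "D i = (\<Sum>m<Suc k. (1 / (c m + 1)) *\<^sub>c E0 m i i)" for i
  define D' where "D' i = (\<Sum>m<Suc k. (1 / (c m - 1)) *\<^sub>c E0 m i i)" for i
  have nth: "fps_nth (f * g) 1 = fps_nth f 0 * fps_nth g 1 + fps_nth f 1 * fps_nth g 0" for f g :: "xidx endo fps"
    by (simp add: fps_mult_nth)
  have p0: "fps_nth (Gp (\<lambda>m. c m + 1) E0 (Suc k) i j) 0 = (if i = j then P *\<^sub>c 1 else 0)"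
    and m0: "fps_nth (Gp (\<lambda>m. c m - 1) E0 (Suc k) i j) 0 = (if i = j then M *\<^sub>c 1 else 0)" if "j \<in> {-1,1}" for i j
    using Gp_nth_0[OF that] by (simp_all only: P_def M_def)
  have p1: "fps_nth (Gp (\<lambda>m. c m + 1) E0 (Suc k) i i) 1 = P *\<^sub>c D i"
    and m1: "fps_nth (Gp (\<lambda>m. c m - 1) E0 (Suc k) i i) 1 = M *\<^sub>c D' i" if "i \<in> {-1,1}" for i
    using Gp_nth_1[OF that c(1) that] Gp_nth_1[OF that c(2) that] by (simp_all only: P_def M_def D_def D'_def)
  have "fps_nth (Hs c) 1 = (P * M) *\<^sub>c (D' (-1) + D 1 - D (-1) - D' 1)"
    unfolding Hs_def fps_sum_nth fscale_nth
    by (simp add: nth[unfolded One_nat_def] p0 m0 p1[unfolded One_nat_def] m1[unfolded One_nat_def] theta_def scale_one scale_mult_left scale_mult_right scale_scale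
        scale_add_right scale_diff_right scale_zero_right mult.commute[of M P] del: Gp.simps)
  then have "app (fps_nth (Hs c) 1) \<phi> (emb x) = P * M * (\<Sum>m<Suc k. (1 / (c m + 1) - 1 / (c m - 1)) *
     (app (E0 m 1 1) \<phi> (emb x) - app (E0 m (-1) (-1)) \<phi> (emb x)))"
    by (simp only: app_simps app_scale app_sum D_def D'_def) (simp add: algebra_simps sum_subtractf sum.distrib del: sum.lessThan_Suc)
  also have "\<dots> = P * M * (\<Sum>m<Suc k. 2 * (cval x m / (1 - (c m)\<^sup>2)) * \<phi> (emb x))"
  proof (rule arg_cong2[where f="(*)", OF refl], rule sum.cong[OF refl])
    fix m assume "m \<in> {..<Suc k}"
    then have m: "m < Suc k" by simp
    have "1 - (c m)\<^sup>2 \<noteq> 0" using assms[of m] m by simp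
    then have "1 / (c m + 1) - 1 / (c m - 1) = 2 / (1 - (c m)\<^sup>2)"
      using c[OF m] by (simp add: divide_simps) (simp add: power2_eq_square algebra_simps)
    then show "(1 / (c m + 1) - 1 / (c m - 1)) * (app (E0 m 1 1) \<phi> (emb x) - app (E0 m (-1) (-1)) \<phi> (emb x))
      = 2 * (cval x m / (1 - (c m)\<^sup>2)) * \<phi> (emb x)"
      using app_cartan[of m \<phi> x] m by simp
  qed
  finally show ?thesis
    unfolding P_def M_def lessThan_Suc_atMost by (simp add: sum_distrib_left sum_distrib_right mult_ac)
qed

text \<open>For half-integral weights the value in slot k tells U from U' through \<delta>. For
  integral weights \<delta> is the same, but the first weights of slot 0 differ by 1, so the
  h-weights there have different parity.\<close>

lemma cval_separates:
  assumes x: "x \<in> I" "x' \<in> I" and eq: "\<And>m. m \<le> k \<Longrightarrow> cval x m = cval x' m"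
  shows "x = x'"
proof -
  obtain \<sigma> p \<sigma>' p' where sp: "x = (\<sigma>, p)" "x' = (\<sigma>', p')" by (metis prod.exhaust)
  have p: "length p = k" "length p' = k" "\<sigma> \<in> sigset spc" "\<sigma>' \<in> sigset spc" using x by (auto simp: sp Ix_def)
  have d: "fa \<sigma> m - fb \<sigma> m - 2 * real (p ! m) = fa \<sigma>' m - fb \<sigma>' m - 2 * real (p' ! m)" if "m < k" for m
  proof -
    have "complex_of_real (fa \<sigma> m - fb \<sigma> m - 2 * real (p ! m)) = complex_of_real (fa \<sigma>' m - fb \<sigma>' m - 2 * real (p' ! m))"
      using eq[of m] that by (simp add: cval_def sp)
    then show ?thesis by (simp only: of_real_eq_iff)
  qed
  have "\<sigma> = \<sigma>'"
  proof (cases spc)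
    case True
    then show ?thesis using p by (simp add: sigset_def)
  next
    case spc: False
    have dw: "deltaW lam \<sigma> = deltaW lam \<sigma>'"
      using eq[of k] unfolding cval_def sp using spc by simp
    have sig: "\<sigma> \<in> {0,1}" "\<sigma>' \<in> {0,1}" using p spc by (simp_all add: sigset_def)
    show ?thesis
    proof (cases "lam 1 \<in> \<int>")
      case False
      then show ?thesis using dw sig by (auto simp: deltaW_def)
    next
      case True
      have f0: "fa \<sigma> 0 - fb \<sigma> 0 = fa 0 0 - fb 0 0 - real \<sigma>" if "\<sigma> \<in> {0,1}" for \<sigma>
        using True spc that by (auto simp: fac_ab_def)
      have "fa \<sigma> 0 - fb \<sigma> 0 - 2 * real (p ! 0) = fa \<sigma>' 0 - fb \<sigma>' 0 - 2 * real (p' ! 0)"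
        by (rule d) (use k in simp)
      with f0[OF sig(1)] f0[OF sig(2)] have "real (\<sigma> + 2 * (p ! 0)) = real (\<sigma>' + 2 * (p' ! 0))" by linarith
      then have "\<sigma> + 2 * (p ! 0) = \<sigma>' + 2 * (p' ! 0)" by (simp only: of_nat_eq_iff)
      then show ?thesis using sig by auto presburger+
    qed
  qed
  moreover have "p = p'"
    using d p(1,2) \<open>\<sigma> = \<sigma>'\<close> by (intro nth_equalityI) auto
  ultimately show ?thesis by (simp add: sp)
qed

lemma generic_direction:
  obtains c where "c k = 0" "\<And>m. m \<le> k \<Longrightarrow> (c m)\<^sup>2 \<noteq> 1" "inj_on (\<lambda>x. \<Sum>m\<le>k. cval x m / (1 - (c m)\<^sup>2)) I"
proof -
  \<comment> \<open>Choose $c$ such that $1/(1-c_m^2) = s^{m+1}$; distinct joint eigenvalues then give distinct polynomials in $s$.\<close>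
  define D where "D x x' = [:cval x k - cval x' k:] + (\<Sum>m<k. monom (cval x m - cval x' m) (Suc m))" for x x'
  have coeff: "coeff (D x x') (Suc m) = cval x m - cval x' m" if "m < k" for x x' m
    using that by (simp add: D_def coeff_sum coeff_pCons)
  have coeff0: "coeff (D x x') 0 = cval x k - cval x' k" for x x' by (simp add: D_def coeff_sum)
  have D0: "D x x' \<noteq> 0" if "x \<in> I" "x' \<in> I" "x \<noteq> x'" for x x'
  proof
    assume "D x x' = 0"
    then have "cval x m = cval x' m" if "m \<le> k" for m
      using coeff[of m x x'] coeff0[of x x'] that by (cases "m = k") auto
    with cval_separates[OF that(1,2)] that(3) show False by blast
  qed
  have "finite ({0} \<union> (\<Union>x\<in>I. \<Union>x'\<in>I - {x}. {s. poly (D x x') s = 0}))"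
    using finite_I D0 by (intro finite_UnI finite_UN_I poly_roots_finite) auto
  then obtain s where s: "s \<notin> {0} \<union> (\<Union>x\<in>I. \<Union>x'\<in>I - {x}. {s. poly (D x x') s = 0})"
    using ex_new_if_finite infinite_UNIV_char_0 by blast
  \<comment> \<open>In slot k the value c = 0 gives the factor 1, so that slot supplies the constant
    term of the polynomial in s.\<close>
  define c where "c m = (if m < k then csqrt (1 - 1 / s ^ Suc m) else 0)" for m
  have s0: "s \<noteq> 0" using s by simp
  have c: "1 / (1 - (c m)\<^sup>2) = (if m < k then s ^ Suc m else 1)" for m
    using s0 by (simp add: c_def)
  show ?thesis
  proof (rule that[of c])
    show "c k = 0" by (simp add: c_def)
    show "(c m)\<^sup>2 \<noteq> 1" if "m \<le> k" for m using s0 by (simp add: c_def)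
    have P: "(\<Sum>m\<le>k. cval x m / (1 - (c m)\<^sup>2)) = cval x k + (\<Sum>m<k. cval x m * s ^ Suc m)" for x
    proof -
      have "(\<Sum>m\<le>k. cval x m / (1 - (c m)\<^sup>2)) = (\<Sum>m\<le>k. cval x m * (if m < k then s ^ Suc m else 1))"
        by (intro sum.cong refl) (simp only: c[symmetric], simp)
      then show ?thesis unfolding lessThan_Suc_atMost[symmetric] by (simp add: add.commute)
    qed
    show "inj_on (\<lambda>x. \<Sum>m\<le>k. cval x m / (1 - (c m)\<^sup>2)) I"
    proof (rule inj_onI, rule ccontr)
      fix x x' assume x: "x \<in> I" "x' \<in> I" "x \<noteq> x'"
        and eq: "(\<Sum>m\<le>k. cval x m / (1 - (c m)\<^sup>2)) = (\<Sum>m\<le>k. cval x' m / (1 - (c m)\<^sup>2))"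
      have "poly (D x x') s = (cval x k + (\<Sum>m<k. cval x m * s ^ Suc m)) - (cval x' k + (\<Sum>m<k. cval x' m * s ^ Suc m))"
        by (simp add: D_def poly_sum poly_monom algebra_simps sum_subtractf)
      also have "\<dots> = 0" using eq unfolding P by simp
      finally show False using s x by auto
    qed
  qed
qed

text \<open>The variable is \<eta> = 1/\<tau>. The coefficients start at index 1 of
  \<open>Hs\<close>, the one of index 0 being zero.\<close>

definition Nmat :: "(nat \<Rightarrow> complex) \<Rightarrow> idx \<Rightarrow> idx \<Rightarrow> complex poly" where
  "Nmat c p q = (\<Sum>r<2 * Suc k. monom (app (fps_nth (Hs c) (Suc r)) (\<lambda>x. if x = emb q then 1 else 0) (emb p)) r)"

lemma Bmat_ray:
  assumes "c k = 0" "p \<in> I" "q \<in> I" "\<tau> \<noteq> 0"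
  shows "Bmat (ray c \<tau>) \<tau> p q = \<tau> ^ (2 * k + 1) * poly (Nmat c p q) (1 / \<tau>)"
proof -
  let ?e = "\<lambda>r. app (fps_nth (Hs c) r) (\<lambda>x. if x = emb q then 1 else 0) (emb p)"
  have "Bmat (ray c \<tau>) \<tau> p q = app (Ev (2 * Suc k) (Hs c) \<tau>) (\<lambda>x. if x = emb q then 1 else 0) (emb p)"
    unfolding rep_entry[OF rep_Bmat assms(2,3)] Qop_ray[where c=c, OF assms(1)] ..
  also have "\<dots> = (\<Sum>r\<le>2 * Suc k. \<tau> ^ (2 * Suc k - r) * ?e r)"
    by (simp only: Ev_def app_sum app_scale)
  also have "\<dots> = (\<Sum>r<Suc (2 * Suc k). \<tau> ^ (2 * Suc k - r) * ?e r)"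
    by (simp only: lessThan_Suc_atMost)
  also have "\<dots> = (\<Sum>r<2 * Suc k. \<tau> ^ (2 * Suc k - Suc r) * ?e (Suc r))"
    unfolding sum.lessThan_Suc_shift by (simp add: Hs_nth_0 app_simps)
  also have "\<dots> = (\<Sum>r<2 * Suc k. \<tau> ^ (2 * k + 1) * (?e (Suc r) * (1 / \<tau>) ^ r))"
  proof (intro sum.cong refl)
    fix r assume "r \<in> {..<2 * Suc k}"
    then have "2 * k + 1 = (2 * Suc k - Suc r) + r" by simp
    then have "\<tau> ^ (2 * k + 1) = \<tau> ^ (2 * Suc k - Suc r) * \<tau> ^ r" by (metis power_add)
    then show "\<tau> ^ (2 * Suc k - Suc r) * ?e (Suc r) = \<tau> ^ (2 * k + 1) * (?e (Suc r) * (1 / \<tau>) ^ r)"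
      using assms(4) by (simp add: power_divide)
  qed
  finally show ?thesis by (simp only: Nmat_def poly_sum poly_monom sum_distrib_left)
qed

lemma Nmat_0:
  assumes "\<And>m. m \<le> k \<Longrightarrow> (c m)\<^sup>2 \<noteq> 1" "p \<in> I" "q \<in> I"
  shows "poly (Nmat c p q) 0 = (if p = q then
    2 * (\<Prod>m\<le>k. c m + 1) * (\<Prod>m\<le>k. c m - 1) * (\<Sum>m\<le>k. cval p m / (1 - (c m)\<^sup>2)) else 0)"
proof -
  have eq: "poly (Nmat c p q) 0 = app (fps_nth (Hs c) 1) (\<lambda>x. if x = emb q then 1 else 0) (emb p)"
    by (simp add: Nmat_def poly_sum poly_monom sum.lessThan_Suc_shift del: sum.lessThan_Suc)
  moreover have "emb p = emb q \<longleftrightarrow> p = q" using emb_inj assms(2,3) by (auto dest: inj_onD)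
  moreover have "app (fps_nth (Hs c) 1) (\<lambda>x. if x = emb q then 1 else 0) (emb p) =
    2 * (\<Prod>m\<le>k. c m + 1) * (\<Prod>m\<le>k. c m - 1) * (\<Sum>m\<le>k. cval p m / (1 - (c m)\<^sup>2)) *
      (if emb p = emb q then 1 else 0)"
    by (rule Hs_nth_1) (rule assms(1))
  ultimately show ?thesis unfolding eq by simp
qed

text \<open>X commutes with the matrix of Q, so it maps the eigenline spanned by v into
  itself.\<close>

lemma Bimage_eigvec:
  assumes X: "X \<in> Bimage spc k lam mu z"
    and B: "\<And>p q. p \<in> I \<Longrightarrow> q \<in> I \<Longrightarrow> Bmat z u p q = \<beta> * N p q" "\<beta> \<noteq> 0"
    and v: "\<And>p. p \<in> I \<Longrightarrow> (\<Sum>q\<in>I. N p q * v q) = g * v p"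
    and uniq: "\<And>w. (\<And>p. p \<in> I \<Longrightarrow> (\<Sum>q\<in>I. N p q * w q) = g * w p) \<Longrightarrow> \<exists>s. \<forall>q\<in>I. w q = s * v q"
  shows "\<exists>s. is_eigvec I X v s"
proof -
  define w where "w p = (\<Sum>q\<in>I. X p q * v q)" for p
  have Bv: "(\<Sum>q\<in>I. Bmat z u p q * v q) = \<beta> * g * v p" if "p \<in> I" for p
  proof -
    have "(\<Sum>q\<in>I. Bmat z u p q * v q) = \<beta> * (\<Sum>q\<in>I. N p q * v q)"
      unfolding sum_distrib_left by (intro sum.cong refl) (use B(1) that in simp)
    then show ?thesis using v[OF that] by simp
  qed
  have "(\<Sum>q\<in>I. N p q * w q) = g * w p" if p: "p \<in> I" for p
  proof -
    have "\<beta> * (\<Sum>q\<in>I. N p q * w q) = (\<Sum>q\<in>I. Bmat z u p q * w q)"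
      unfolding sum_distrib_left by (intro sum.cong refl) (use B(1) p in simp)
    also have "\<dots> = (\<Sum>r\<in>I. mmul I (Bmat z u) X p r * v r)"
      unfolding w_def mmul_def sum_distrib_left sum_distrib_right by (subst sum.swap) (simp add: mult.assoc)
    also have "\<dots> = (\<Sum>r\<in>I. mmul I X (Bmat z u) p r * v r)"
      by (intro sum.cong refl) (simp add: Bmat_commute[OF X p])
    also have "\<dots> = (\<Sum>q\<in>I. X p q * (\<Sum>r\<in>I. Bmat z u q r * v r))"
      unfolding mmul_def sum_distrib_left sum_distrib_right by (subst sum.swap) (simp add: mult.assoc)
    also have "\<dots> = (\<Sum>q\<in>I. X p q * (\<beta> * g * v q))" by (intro sum.cong refl) (simp add: Bv)
    also have "\<dots> = \<beta> * (g * w p)" unfolding w_def sum_distrib_left by (intro sum.cong refl) (simp add: mult_ac)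
    finally show ?thesis using B(2) by simp
  qed
  from uniq[OF this] show ?thesis unfolding is_eigvec_def w_def .
qed

end

theorem theoremB:
  fixes spc :: bool and k :: nat and lam mu :: "nat \<Rightarrow> real"
  assumes "k \<ge> 1"
    and "dominant spc k lam"
    and "dominant spc (k - 1) mu"
    and "occurs k lam mu"
  shows "\<exists>z :: real \<Rightarrow> nat \<Rightarrow> complex.
    (\<forall>j\<in>{1..k}. continuous_on {0..} (\<lambda>t. z t j)) \<and>
    (\<forall>j\<in>{1..k}. z 0 j = 0) \<and>
    (\<forall>t>0. simple_spec (Ix spc k lam mu) (Bimage spc k lam mu (z t))) \<and>
    (\<exists>v :: idx \<Rightarrow> real \<Rightarrow> idx \<Rightarrow> complex.
       (\<forall>b\<in>Ix spc k lam mu. \<forall>q\<in>Ix spc k lam mu. continuous_on {0<..} (\<lambda>t. v b t q)) \<and>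
       (\<forall>t>0. lin_indep (Ix spc k lam mu) (\<lambda>b. v b t) \<and>
          (\<forall>b\<in>Ix spc k lam mu. \<forall>X\<in>Bimage spc k lam mu (z t).
              \<exists>c. is_eigvec (Ix spc k lam mu) X (v b t) c)) \<and>
       (\<forall>b\<in>Ix spc k lam mu. \<exists>c. c \<noteq> 0 \<and>
          (\<forall>q\<in>Ix spc k lam mu. ((\<lambda>t. v b t q) \<longlongrightarrow> (if q = b then c else 0)) at_top)))"
proof -
  interpret multiplicity_space spc k lam mu
    by unfold_locales (use assms in auto)
  let ?I = "Ix spc k lam mu"
  obtain c where ck: "c k = 0" and c1: "\<And>m. m \<le> k \<Longrightarrow> (c m)\<^sup>2 \<noteq> 1"
    and cinj: "inj_on (\<lambda>x. \<Sum>m\<le>k. cval x m / (1 - (c m)\<^sup>2)) ?I"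
    using generic_direction by blast
  define P where "P = 2 * (\<Prod>m\<le>k. c m + 1) * (\<Prod>m\<le>k. c m - 1)"
  have "c m + 1 \<noteq> 0 \<and> c m - 1 \<noteq> 0" if "m \<le> k" for m
    using c1[OF that] by (auto simp: add_eq_0_iff2 power2_eq_1_iff)
  then have "P \<noteq> 0" by (simp add: P_def)
  have N0: "poly (Nmat c p q) 0 = (if p = q then P * (\<Sum>m\<le>k. cval p m / (1 - (c m)\<^sup>2)) else 0)"
    if "p \<in> ?I" "q \<in> ?I" for p q
    unfolding P_def by (rule Nmat_0) (use c1 that in auto)
  have diag: "poly (Nmat c p q) 0 = 0" if "p \<in> ?I" "q \<in> ?I" "p \<noteq> q" for p q
    using N0[OF that(1,2)] that(3) by simp
  have inj: "inj_on (\<lambda>p. poly (Nmat c p p) 0) ?I"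
  proof (rule inj_onI)
    fix x y assume xy: "x \<in> ?I" "y \<in> ?I" "poly (Nmat c x x) 0 = poly (Nmat c y y) 0"
    then have "P * (\<Sum>m\<le>k. cval x m / (1 - (c m)\<^sup>2)) = P * (\<Sum>m\<le>k. cval y m / (1 - (c m)\<^sup>2))"
      by (simp add: N0)
    then show "x = y" using inj_onD[OF cinj _ xy(1,2)] \<open>P \<noteq> 0\<close> by simp
  qed
  obtain \<omega> v g where \<omega>: "\<omega> \<noteq> (0::complex)"
    and cont: "\<forall>b\<in>?I. \<forall>q\<in>?I. continuous_on {0..} (\<lambda>r::real. v b r q)"
    and v0: "\<forall>b\<in>?I. \<forall>q\<in>?I. v b 0 q = (if q = b then 1 else 0)"
    and eig: "\<forall>b\<in>?I. \<forall>r\<ge>0. \<forall>p\<in>?I. (\<Sum>q\<in>?I. poly (Nmat c p q) (\<omega> * of_real r) * v b r q) = g b r * v b r p"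
    and dist: "\<forall>b\<in>?I. \<forall>b'\<in>?I. b \<noteq> b' \<longrightarrow> (\<forall>r\<ge>0. g b r \<noteq> g b' r)"
    and nz: "\<forall>b\<in>?I. \<forall>r\<ge>0. \<exists>q\<in>?I. v b r q \<noteq> 0"
    and uniq: "\<forall>b\<in>?I. \<forall>r\<ge>0. \<forall>w. (\<forall>p\<in>?I. (\<Sum>q\<in>?I. poly (Nmat c p q) (\<omega> * of_real r) * w q) = g b r * w p) \<longrightarrow>
      (\<exists>s. \<forall>q\<in>?I. w q = s * v b r q)"
    by (rule exE[OF ray_eigenvectors[where N = "Nmat c", OF finite_I diag inj]], assumption+)
      (elim exE conjE, rule that, assumption+)
  \<comment> \<open>Dividing by \<omega> turns 1/\<tau> into \<omega>/t, a point of the ray on which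
    the eigenvalues stay distinct.\<close>
  define z where "z t = ray c (of_real t / \<omega>)" for t :: real
  \<comment> \<open>With r = 1/t the limit of large t is the end point r = 0, at which the
    eigenvectors are still continuous.\<close>
  define V where "V b t q = v b (1 / t) q" for b and t :: real and q
  have B: "Bmat (z t) (of_real t / \<omega>) p q = (of_real t / \<omega>) ^ (2 * k + 1) * poly (Nmat c p q) (\<omega> * of_real (1 / t))"
    if "t > 0" "p \<in> ?I" "q \<in> ?I" for t p q
    using Bmat_ray[where c = c and \<tau> = "of_real t / \<omega>", OF ck that(2,3)] that(1) \<omega> by (simp add: z_def)
  have eigX: "\<exists>s. is_eigvec ?I X (V b t) s" if t: "t > 0" and b: "b \<in> ?I" and X: "X \<in> Bimage spc k lam mu (z t)" for t b X
  proof (rule Bimage_eigvec[OF X])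
    have r: "1 / t \<ge> 0" using t by simp
    show "Bmat (z t) (of_real t / \<omega>) p q = (of_real t / \<omega>) ^ (2 * k + 1) * poly (Nmat c p q) (\<omega> * of_real (1 / t))"
      if "p \<in> ?I" "q \<in> ?I" for p q by (rule B[OF t that])
    show "(of_real t / \<omega>) ^ (2 * k + 1) \<noteq> 0" using t \<omega> by simp
    show "(\<Sum>q\<in>?I. poly (Nmat c p q) (\<omega> * of_real (1 / t)) * V b t q) = g b (1 / t) * V b t p" if "p \<in> ?I" for p
      unfolding V_def using eig b r that by blast
    show "\<exists>s. \<forall>q\<in>?I. w q = s * V b t q"
      if "\<And>p. p \<in> ?I \<Longrightarrow> (\<Sum>q\<in>?I. poly (Nmat c p q) (\<omega> * of_real (1 / t)) * w q) = g b (1 / t) * w p" for w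
      unfolding V_def using uniq b r that by blast
  qed
  have nzV: "\<exists>q\<in>?I. V b t q \<noteq> 0" if "t > 0" "b \<in> ?I" for t b
    unfolding V_def using nz that by simp
  have indep: "lin_indep ?I (\<lambda>b. V b t)" if t: "t > 0" for t
    unfolding lin_indep_def
  proof (intro allI impI ballI)
    fix a b assume a: "\<forall>q\<in>?I. (\<Sum>b\<in>?I. a b * V b t q) = 0" and b: "b \<in> ?I"
    have r: "1 / t \<ge> 0" using t by simp
    show "a b = 0"
    proof (rule eigenvectors_lin_indep[OF finite_I _ _ _ finite_I subset_refl _ b])
      show "(\<Sum>q\<in>?I. poly (Nmat c p q) (\<omega> * of_real (1 / t)) * V b t q) = g b (1 / t) * V b t p" if "b \<in> ?I" "p \<in> ?I" for b p
        unfolding V_def using eig that r by blast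
      show "g b (1 / t) \<noteq> g b' (1 / t)" if "b \<in> ?I" "b' \<in> ?I" "b \<noteq> b'" for b b'
        using dist that r by blast
      show "\<exists>q\<in>?I. V b t q \<noteq> 0" if "b \<in> ?I" for b by (rule nzV[OF t that])
      show "(\<Sum>b\<in>?I. a b * V b t q) = 0" if "q \<in> ?I" for q using a that by blast
    qed
  qed
  have simple: "simple_spec ?I (Bimage spc k lam mu (z t))" if t: "t > 0" for t
    unfolding simple_spec_def
  proof (intro exI[of _ "\<lambda>b. V b t"] conjI ballI impI)
    show "lin_indep ?I (\<lambda>b. V b t)" by (rule indep[OF t])
    show "\<exists>s. is_eigvec ?I X (V b t) s" if "b \<in> ?I" "X \<in> Bimage spc k lam mu (z t)" for b X
      by (rule eigX[OF t that])
    fix b b' assume b: "b \<in> ?I" "b' \<in> ?I" "b \<noteq> b'"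
    let ?\<beta> = "(of_real t / \<omega>) ^ (2 * k + 1)"
    have r: "1 / t \<ge> 0" using t by simp
    have BV: "(\<Sum>q\<in>?I. Bmat (z t) (of_real t / \<omega>) p q * V b t q) = ?\<beta> * g b (1 / t) * V b t p"
      if b: "b \<in> ?I" and p: "p \<in> ?I" for b p
    proof -
      have "(\<Sum>q\<in>?I. Bmat (z t) (of_real t / \<omega>) p q * V b t q)
          = ?\<beta> * (\<Sum>q\<in>?I. poly (Nmat c p q) (\<omega> * of_real (1 / t)) * V b t q)"
        unfolding sum_distrib_left by (intro sum.cong refl) (simp only: B[OF t p] mult.assoc)
      also have "(\<Sum>q\<in>?I. poly (Nmat c p q) (\<omega> * of_real (1 / t)) * V b t q) = g b (1 / t) * V b t p"
        unfolding V_def using eig b p r by blast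
      finally show ?thesis by (simp only: mult.assoc)
    qed
    \<comment> \<open>The matrix of Q at u = t/\<omega> serves for every pair, since its eigenvalues
      are distinct.\<close>
    show "\<exists>X\<in>Bimage spc k lam mu (z t). \<exists>s. is_eigvec ?I X (V b t) s \<and> \<not> is_eigvec ?I X (V b' t) s"
    proof (rule bexI[OF _ Bmat_in_Bimage[of "z t" "of_real t / \<omega>"]], rule exI[of _ "?\<beta> * g b (1 / t)"], rule conjI)
      show "is_eigvec ?I (Bmat (z t) (of_real t / \<omega>)) (V b t) (?\<beta> * g b (1 / t))"
        unfolding is_eigvec_def using BV[OF b(1)] by blast
      show "\<not> is_eigvec ?I (Bmat (z t) (of_real t / \<omega>)) (V b' t) (?\<beta> * g b (1 / t))"
      proof
        assume "is_eigvec ?I (Bmat (z t) (of_real t / \<omega>)) (V b' t) (?\<beta> * g b (1 / t))"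
        then have *: "?\<beta> * g b (1 / t) * V b' t p = ?\<beta> * g b' (1 / t) * V b' t p" if "p \<in> ?I" for p
          using BV[OF b(2) that] that unfolding is_eigvec_def by simp
        have "?\<beta> \<noteq> 0" using t \<omega> by simp
        moreover have "g b (1 / t) \<noteq> g b' (1 / t)" using dist b r by blast
        ultimately have "V b' t p = 0" if "p \<in> ?I" for p using *[OF that] by simp
        with nzV[OF t b(2)] show False by blast
      qed
    qed
  qed
  show ?thesis
  proof (intro exI[of _ z] exI[of _ V] conjI ballI allI impI)
    show "continuous_on {0..} (\<lambda>t. z t j)" for j
      unfolding z_def ray_def using \<omega> by (intro continuous_intros) auto
    show "z 0 j = 0" for j by (simp add: z_def ray_def)
    show "simple_spec ?I (Bimage spc k lam mu (z t))" if "t > 0" for t by (rule simple[OF that])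
    show "lin_indep ?I (\<lambda>b. V b t)" if "t > 0" for t by (rule indep[OF that])
    fix b assume b: "b \<in> ?I"
    show "\<exists>s. is_eigvec ?I X (V b t) s" if "t > 0" "X \<in> Bimage spc k lam mu (z t)" for t X
      by (rule eigX[OF that(1) b that(2)])
    show "continuous_on {0<..} (\<lambda>t. V b t q)" if "q \<in> ?I" for q
      unfolding V_def
      by (rule continuous_on_compose2[of "{0..}" "\<lambda>r. v b r q"]) (use cont b that in \<open>auto intro!: continuous_intros\<close>)
    \<comment> \<open>The limit constant is 1 because the eigenvector labelled by b is exactly the
      unit vector at r = 0.\<close>
    show "\<exists>c. c \<noteq> 0 \<and> (\<forall>q\<in>?I. ((\<lambda>t. V b t q) \<longlongrightarrow> (if q = b then c else 0)) at_top)"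
    proof (intro exI[of _ 1] conjI ballI)
      fix q assume q: "q \<in> ?I"
      have "((\<lambda>t. v b (1 / t) q) \<longlongrightarrow> v b 0 q) at_top"
      proof (rule continuous_on_tendsto_compose[of "{0..}" "\<lambda>r. v b r q"])
        show "continuous_on {0..} (\<lambda>r. v b r q)" using cont b q by blast
        show "((\<lambda>t::real. 1 / t) \<longlongrightarrow> 0) at_top"
          using tendsto_inverse_0_at_top[OF filterlim_ident] by (simp add: inverse_eq_divide)
        show "\<forall>\<^sub>F t::real in at_top. 1 / t \<in> {0..}"
          using eventually_ge_at_top[of 0] by eventually_elim simp
      qed simp
      then show "((\<lambda>t. V b t q) \<longlongrightarrow> (if q = b then 1 else 0)) at_top"
        using v0 b q by (simp add: V_def)
    qed simp
  qed
qed

end
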